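(* Let $\Gamma$ be a non-trivial cyclic Fuchsian group and let $(G,\psi)$ be a $\Gamma$-gain graph. Then $(G,\psi)$ is $\Gamma$-isostatic if and only if it is $(2,3,1)$-gain tight.
   Context: **Hyperbolic plane.** $\mathbb{H}=\{z\in\mathbb{C}:\operatorname{Im} z>0\}$ carries the metric $(dx^2+dy^2)/y^2$; $\mathrm{PSL}(2,\mathbb{R})$ acts by Möbius transformations. A Fuchsian group is a discrete subgroup of $\mathrm{PSL}(2,\mathbb{R})$. For distinct $P,Q\in\mathbb{H}$, $\gamma_{P,Q}:\mathbb{R}\to\mathbb{H}$ is the unit-speed (hyperbolic metric) geodesic with $\gamma_{P,Q}(0)=P$ that passes through $Q$ at a positive time; $\dot\gamma_{P,Q}(0)\in\mathbb{R}^2$ is its initial velocity ($T_P\mathbb{H}$ identified with $\mathbb{R}^2$). Convention: $\dot\gamma_{P,P}(0)=\mathbf 0$. **Gain graphs.** A $\Gamma$-gain graph $(G,\psi)$ is a finite directed multigraph $G$ (loops and parallel edges allowed, nonempty vertex set) with a map $\psi:E(G)\to\Gamma$ such that: loops have non-identity gain; distinct parallel edges (including loops at the same vertex) with the same orientation have different gains; distinct parallel edges $e,f$ with opposite orientation satisfy $\psi(e)\ne\psi(f)^{-1}$ (for two loops at one vertex both conditions apply). Write $u\xrightarrow{g}v$ for an edge from $u$ to $v$ with gain $g$; it may be replaced by $v\xrightarrow{g^{-1}}u$. The gain of a walk is the product in order of the gains of its edges, an edge traversed backwards contributing the inverse of its gain. A connected subgraph is balanced if all its closed walks have gain $\mathrm{id}$.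 **Sparsity.** A graph is $(2,\ell)$-sparse if $|E(H)|\le 2|V(H)|-\ell$ for every subgraph $H$ with $E(H)\neq\emptyset$. $(G,\psi)$ is $(2,3,1)$-gain sparse if $G$ is $(2,1)$-sparse and every balanced subgraph with non-empty edge set is $(2,3)$-sparse. It is $(2,3,1)$-gain tight if in addition $|E(G)|=2|V(G)|-1$. **Rigidity.** A realisation of $(G,\psi)$ is any map $p:V(G)\to\mathbb{H}$. The orbit rigidity matrix $O(G,\psi,p)$ is the $|E(G)|\times 2|V(G)|$ real matrix with two columns per vertex whose row for a non-loop edge $u\xrightarrow{g}v$ has $\dot\gamma_{p(u),g\cdot p(v)}(0)$ in the columns of $u$, $\dot\gamma_{p(v),g^{-1}\cdot p(u)}(0)$ in the columns of $v$, and zeros elsewhere, and whose row for a loop $v\xrightarrow{g}v$ has $\dot\gamma_{p(v),g\cdot p(v)}(0)+\dot\gamma_{p(v),g^{-1}\cdot p(v)}(0)$ in the columns of $v$ and zeros elsewhere. $(G,\psi,p)$ is $\Gamma$-symmetrically independent if $\operatorname{rank}O(G,\psi,p)=|E(G)|$. It is infinitesimally $\Gamma$-symmetrically rigid if either $|V(G)|=1$ and $\Gamma$ is trivial, or $\operatorname{rank}O(G,\psi,p)$ equals $2|V(G)|-3$ if $\Gamma$ is trivial, $2|V(G)|-1$ if $\Gamma$ is non-trivial cyclic, and $2|V(G)|$ otherwise. $(G,\psi)$ is $\Gamma$-symmetrically independent (resp. rigid) if some realisation $p$ makes $(G,\psi,p)$ $\Gamma$-symmetrically independent (resp. infinitesimally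 $\Gamma$-symmetrically rigid), and $\Gamma$-isostatic if it is both. *)

theory Defs
  imports
    "HOL-Algebra.Elementary_Groups"
    "Graph_Theory.Digraph_Component"
    "HOL-Analysis.Analysis"
begin

section \<open>The group PSL(2,R) and Fuchsian groups\<close>

definition SL2 :: "(real^2^2) monoid" where
  "SL2 = \<lparr>carrier = {A. det A = 1}, monoid.mult = (**), one = mat 1\<rparr>"

definition PSL2 :: "(real^2^2) set monoid" where
  "PSL2 = SL2 Mod {mat 1, - mat 1}"

lemma group_SL2: "group SL2"
proof (rule groupI)
  fix A assume A: "A \<in> carrier SL2"
  then have "invertible A"
    by (simp add: SL2_def invertible_det_nz)
  then obtain B where inv: "B ** A = mat 1"
    unfolding invertible_def by blast
  then have "det B * det A = 1"
    by (metis det_I det_mul)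
  with A inv show "\<exists>B\<in>carrier SL2. B \<otimes>\<^bsub>SL2\<^esub> A = \<one>\<^bsub>SL2\<^esub>"
    by (auto simp: SL2_def)
qed (auto simp: SL2_def det_mul matrix_mul_assoc)

lemma normal_SL2: "{mat 1, - mat 1} \<lhd> SL2"
proof -
  interpret group SL2 by (rule group_SL2)
  have mI: "(- mat 1) ** A = - A" "A ** (- mat 1) = - A" for A :: "real^2^2"
    by (simp_all add: vec_eq_iff matrix_matrix_mult_def mat_def sum_2 forall_2)
  have det: "det (- mat 1 :: real^2^2) = 1"
    by (simp add: det_2 mat_def)
  have "inv\<^bsub>SL2\<^esub> (- mat 1) = - mat 1"
    by (rule inv_equality) (auto simp: SL2_def mI det)
  moreover have "inv\<^bsub>SL2\<^esub> (mat 1) = mat 1"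
    using inv_one by (simp add: SL2_def)
  ultimately have "subgroup {mat 1, - mat 1} SL2"
    by (intro subgroupI) (auto simp: SL2_def mI det)
  then show ?thesis
    by (rule normalI) (auto simp: r_coset_def l_coset_def SL2_def mI)
qed

lemma group_PSL2: "group PSL2"
  unfolding PSL2_def by (rule normal.factorgroup_is_group[OF normal_SL2])

text \<open>The quotient topology; elements of \<^const>\<open>PSL2\<close> are cosets, so the union of a set of them
  is its preimage in \<^const>\<open>SL2\<close>.\<close>

definition PSL2_topology :: "(real^2^2) set topology" where
  "PSL2_topology =
     topology (\<lambda>U. U \<subseteq> carrier PSL2 \<and> openin (top_of_set (carrier SL2)) (\<Union>U))"

lemma rcosets_SL2_disjoint:
  "\<lbrakk>X \<in> carrier PSL2; Y \<in> carrier PSL2; X \<noteq> Y\<rbrakk> \<Longrightarrow> X \<inter> Y = {}"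
  using group.rcos_disjoint[OF group_SL2 normal_imp_subgroup[OF normal_SL2]]
  by (auto simp: PSL2_def FactGroup_def pairwise_def disjnt_def)

lemma openin_PSL2_topology:
  "openin PSL2_topology U \<longleftrightarrow>
     U \<subseteq> carrier PSL2 \<and> openin (top_of_set (carrier SL2)) (\<Union>U)"
proof -
  have "\<Union>(U \<inter> V) = \<Union>U \<inter> \<Union>V" if "U \<subseteq> carrier PSL2" "V \<subseteq> carrier PSL2" for U V
    using that rcosets_SL2_disjoint by blast
  moreover have "openin (top_of_set (carrier SL2)) (\<Union>(\<Union>K))"
    if "\<forall>U\<in>K. openin (top_of_set (carrier SL2)) (\<Union>U)" for K :: "(real^2^2) set set set"
  proof -
    have "\<Union>(\<Union>K) = (\<Union>U\<in>K. \<Union>U)" by blast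
    with that show ?thesis by (metis (no_types, lifting) imageE openin_Union)
  qed
  ultimately have "istopology (\<lambda>U. U \<subseteq> carrier PSL2 \<and> openin (top_of_set (carrier SL2)) (\<Union>U))"
    unfolding istopology_def by (simp add: openin_Int Sup_le_iff le_infI1)
  then show ?thesis
    by (simp add: PSL2_topology_def topology_inverse')
qed

definition fuchsian_group :: "(real^2^2) set set \<Rightarrow> bool" where
  "fuchsian_group \<Gamma> \<longleftrightarrow>
     subgroup \<Gamma> PSL2 \<and> subtopology PSL2_topology \<Gamma> = discrete_topology \<Gamma>"

section \<open>The hyperbolic plane\<close>

definition upper_half_plane :: "complex set" where
  "upper_half_plane = {z. Im z > 0}"

definition SL2_act :: "real^2^2 \<Rightarrow> complex \<Rightarrow> complex" where
  "SL2_act A =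
     moebius (of_real (A $ 1 $ 1)) (of_real (A $ 1 $ 2)) (of_real (A $ 2 $ 1)) (of_real (A $ 2 $ 2))"

text \<open>The two representatives of an element of \<^const>\<open>PSL2\<close> act in the same way.\<close>

definition PSL2_act :: "(real^2^2) set \<Rightarrow> complex \<Rightarrow> complex" where
  "PSL2_act g z = the_elem ((\<lambda>A. SL2_act A z) ` g)"

lemma PSL2_act_coset:
  assumes "A \<in> carrier SL2"
  shows "PSL2_act ({mat 1, - mat 1} #>\<^bsub>SL2\<^esub> A) z = SL2_act A z"
proof -
  have "mat 1 ** A = A" "(- mat 1) ** A = - A"
    by (simp_all add: vec_eq_iff matrix_matrix_mult_def mat_def sum_2 forall_2)
  then have "{mat 1, - mat 1} #>\<^bsub>SL2\<^esub> A = {A, - A}"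
    by (auto simp: r_coset_def SL2_def)
  moreover have "SL2_act (- A) z = SL2_act A z"
    using minus_divide_divide[of "of_real (A $ 1 $ 1) * z + of_real (A $ 1 $ 2)"
        "of_real (A $ 2 $ 1) * z + of_real (A $ 2 $ 2)"]
    by (simp add: SL2_act_def moebius_def)
  ultimately show ?thesis
    by (simp add: PSL2_act_def)
qed

text \<open>The norm of a tangent vector at \<open>z\<close> for the metric \<open>(dx^2 + dy^2) / y^2\<close>.\<close>

definition hyp_norm :: "complex \<Rightarrow> complex \<Rightarrow> real" where
  "hyp_norm z v = sqrt (((Re v)\<^sup>2 + (Im v)\<^sup>2) / (Im z)\<^sup>2)"

text \<open>
  Geodesics are the curves with vanishing covariant acceleration. The nonzero Christoffel symbols
  of \<open>(dx^2 + dy^2) / y^2\<close> are \<open>- 1 / y\<close> for \<open>x, xy\<close> (and \<open>x, yx\<close>), \<open>1 / y\<close> for \<open>y, xx\<close> and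
  \<open>- 1 / y\<close> for \<open>y, yy\<close> (upper index first), so the geodesic equation is
  \<open>x'' = 2 x' y' / y\<close>, \<open>y'' = (y'^2 - x'^2) / y\<close>.
\<close>

definition unit_speed_geodesic :: "(real \<Rightarrow> complex) \<Rightarrow> bool" where
  "unit_speed_geodesic \<gamma> \<longleftrightarrow>
     range \<gamma> \<subseteq> upper_half_plane \<and>
     (\<exists>\<gamma>'. (\<forall>t. (\<gamma> has_vector_derivative \<gamma>' t) (at t)) \<and>
           (\<forall>t. hyp_norm (\<gamma> t) (\<gamma>' t) = 1) \<and>
           (\<forall>t. (\<gamma>' has_vector_derivative
                   Complex (2 * Re (\<gamma>' t) * Im (\<gamma>' t) / Im (\<gamma> t))
                           (((Im (\<gamma>' t))\<^sup>2 - (Re (\<gamma>' t))\<^sup>2) / Im (\<gamma> t))) (at t)))"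

definition geodesic_through :: "complex \<Rightarrow> complex \<Rightarrow> real \<Rightarrow> complex" where
  "geodesic_through P Q =
     (THE \<gamma>. unit_speed_geodesic \<gamma> \<and> \<gamma> 0 = P \<and> (\<exists>t>0. \<gamma> t = Q))"

definition geodesic_direction :: "complex \<Rightarrow> complex \<Rightarrow> complex" where
  "geodesic_direction P Q =
     (if P = Q then 0 else vector_derivative (geodesic_through P Q) (at 0))"

section \<open>Gain graphs\<close>

definition gain_graph ::
    "(real^2^2) set set \<Rightarrow> ('v, 'e) pre_digraph \<Rightarrow> ('e \<Rightarrow> (real^2^2) set) \<Rightarrow> bool" where
  "gain_graph \<Gamma> G \<psi> \<longleftrightarrow>
     fin_digraph G \<and> verts G \<noteq> {} \<and> \<psi> \<in> arcs G \<rightarrow> \<Gamma> \<and>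
     (\<forall>e\<in>arcs G. tail G e = head G e \<longrightarrow> \<psi> e \<noteq> \<one>\<^bsub>PSL2\<^esub>) \<and>
     (\<forall>e\<in>arcs G. \<forall>f\<in>arcs G. e \<noteq> f \<and> tail G e = tail G f \<and> head G e = head G f
        \<longrightarrow> \<psi> e \<noteq> \<psi> f) \<and>
     (\<forall>e\<in>arcs G. \<forall>f\<in>arcs G. e \<noteq> f \<and> tail G e = head G f \<and> head G e = tail G f
        \<longrightarrow> \<psi> e \<noteq> inv\<^bsub>PSL2\<^esub> \<psi> f)"

text \<open>Walks may traverse an edge backwards, which is recorded by \<^const>\<open>False\<close>.\<close>

fun undirected_walk ::
    "('v, 'e) pre_digraph \<Rightarrow> 'v \<Rightarrow> ('e \<times> bool) list \<Rightarrow> 'v \<Rightarrow> bool" where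
  "undirected_walk G u [] v \<longleftrightarrow> u \<in> verts G \<and> u = v"
| "undirected_walk G u ((e, forwards) # w) v \<longleftrightarrow>
     e \<in> arcs G \<and>
     (if forwards then tail G e = u \<and> undirected_walk G (head G e) w v
      else head G e = u \<and> undirected_walk G (tail G e) w v)"

fun walk_gain :: "('e \<Rightarrow> (real^2^2) set) \<Rightarrow> ('e \<times> bool) list \<Rightarrow> (real^2^2) set" where
  "walk_gain \<psi> [] = \<one>\<^bsub>PSL2\<^esub>"
| "walk_gain \<psi> ((e, forwards) # w) =
     (if forwards then \<psi> e else inv\<^bsub>PSL2\<^esub> \<psi> e) \<otimes>\<^bsub>PSL2\<^esub> walk_gain \<psi> w"

definition balanced :: "('v, 'e) pre_digraph \<Rightarrow> ('e \<Rightarrow> (real^2^2) set) \<Rightarrow> bool" where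
  "balanced H \<psi> \<longleftrightarrow>
     Digraph_Component.connected H \<and>
     (\<forall>v w. undirected_walk H v w v \<longrightarrow> walk_gain \<psi> w = \<one>\<^bsub>PSL2\<^esub>)"

text \<open>\<open>two_sparse l G\<close> states that \<open>G\<close> is \<open>(2,l)\<close>-sparse.\<close>

definition two_sparse :: "int \<Rightarrow> ('v, 'e) pre_digraph \<Rightarrow> bool" where
  "two_sparse l G \<longleftrightarrow>
     (\<forall>H. subgraph H G \<and> arcs H \<noteq> {} \<longrightarrow>
        int (card (arcs H)) \<le> 2 * int (card (verts H)) - l)"

definition gain_sparse_2_3_1 :: "('v, 'e) pre_digraph \<Rightarrow> ('e \<Rightarrow> (real^2^2) set) \<Rightarrow> bool" where
  "gain_sparse_2_3_1 G \<psi> \<longleftrightarrow>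
     two_sparse 1 G \<and>
     (\<forall>H. subgraph H G \<and> arcs H \<noteq> {} \<and> balanced H \<psi> \<longrightarrow> two_sparse 3 H)"

definition gain_tight_2_3_1 :: "('v, 'e) pre_digraph \<Rightarrow> ('e \<Rightarrow> (real^2^2) set) \<Rightarrow> bool" where
  "gain_tight_2_3_1 G \<psi> \<longleftrightarrow>
     gain_sparse_2_3_1 G \<psi> \<and> int (card (arcs G)) = 2 * int (card (verts G)) - 1"

section \<open>Rigidity\<close>

text \<open>The rank of a real matrix with rows indexed by the finite set \<open>I\<close> and columns indexed by the
  finite set \<open>J\<close>: the largest number of linearly independent rows.\<close>

definition matrix_rank :: "'i set \<Rightarrow> 'j set \<Rightarrow> ('i \<Rightarrow> 'j \<Rightarrow> real) \<Rightarrow> nat" where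
  "matrix_rank I J M =
     Max {card F | F. F \<subseteq> I \<and>
       (\<forall>c. (\<forall>j\<in>J. (\<Sum>i\<in>F. c i * M i j) = 0) \<longrightarrow> (\<forall>i\<in>F. c i = 0))}"

lemma matrix_rank_eq_rank:
  fixes A :: "real^'n^'m"
  shows "matrix_rank UNIV UNIV (\<lambda>i j. A $ i $ j) = rank A"
proof -
  let ?ind = "\<lambda>F::'m set. \<forall>c::'m \<Rightarrow> real. (\<forall>j\<in>UNIV. (\<Sum>i\<in>F. c i * A $ i $ j) = 0) \<longrightarrow> (\<forall>i\<in>F. c i = 0)"
  have eq: "(\<forall>j\<in>UNIV. (\<Sum>i\<in>F. c i * A $ i $ j) = 0) \<longleftrightarrow> (\<Sum>i\<in>F. c i *\<^sub>R row i A) = 0" for F c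
    by (simp add: vec_eq_iff row_def)
  have ind: "inj_on (\<lambda>i. row i A) F \<and> independent ((\<lambda>i. row i A) ` F)" if F: "?ind F" for F
  proof -
    have inj: "inj_on (\<lambda>i. row i A) F"
    proof (rule inj_onI, rule ccontr)
      fix i k assume ik: "i \<in> F" "k \<in> F" "row i A = row k A" "i \<noteq> k"
      define c :: "'m \<Rightarrow> real" where "c = (\<lambda>x. if x = i then 1 else if x = k then -1 else 0)"
      have "(\<Sum>x\<in>F. c x *\<^sub>R row x A) = (\<Sum>x\<in>{i, k}. c x *\<^sub>R row x A)"
        by (rule sum.mono_neutral_right) (use ik in \<open>auto simp: c_def\<close>)
      also have "\<dots> = 0" using ik by (simp add: c_def)
      finally have "\<forall>i\<in>F. c i = 0" using F eq by blast
      then show False using ik by (auto simp: c_def)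
    qed
    moreover have "independent ((\<lambda>i. row i A) ` F)"
      unfolding dependent_finite[OF finite_imageI[OF finite[of F]]]
    proof (rule notI, elim exE conjE)
      fix u assume u: "\<exists>v\<in>(\<lambda>i. row i A) ` F. u v \<noteq> 0" "(\<Sum>v\<in>(\<lambda>i. row i A) ` F. u v *\<^sub>R v) = 0"
      then have "(\<Sum>i\<in>F. u (row i A) *\<^sub>R row i A) = 0"
        by (simp add: sum.reindex[OF inj])
      with F[rule_format, of "\<lambda>i. u (row i A)"] eq[where c = "\<lambda>i. u (row i A)" and F = F] u(1)
      show False by auto
    qed
    ultimately show ?thesis ..
  qed
  have "Max {card F | F. F \<subseteq> UNIV \<and> ?ind F} = rank A"
  proof (rule Max_eqI)
    show "finite {card F | F. F \<subseteq> UNIV \<and> ?ind F}"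
      by (rule finite_image_set) simp
    show "y \<le> rank A" if "y \<in> {card F | F. F \<subseteq> UNIV \<and> ?ind F}" for y
    proof -
      from that obtain F where F: "y = card F" "?ind F" by auto
      have "card F = card ((\<lambda>i. row i A) ` F)"
        using ind[OF F(2)] by (simp add: card_image)
      also have "\<dots> \<le> dim (rows A)"
        by (rule independent_card_le_dim) (use ind[OF F(2)] in \<open>auto simp: rows_def\<close>)
      finally show ?thesis by (simp add: F row_rank_def)
    qed
    obtain B where B: "B \<subseteq> rows A" "independent B" "card B = dim (rows A)"
      using basis_exists[of "rows A"] by metis
    have "rows A = range (\<lambda>i. row i A)" by (auto simp: rows_def)
    with B obtain F where F: "inj_on (\<lambda>i. row i A) F" "B = (\<lambda>i. row i A) ` F"
      by (metis subset_image_inj)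
    have "?ind F"
    proof (intro allI impI)
      fix c :: "'m \<Rightarrow> real"
      assume "\<forall>j\<in>UNIV. (\<Sum>i\<in>F. c i * A $ i $ j) = 0"
      then have "(\<Sum>i\<in>F. c i *\<^sub>R row i A) = 0" using eq by blast
      moreover have "(\<Sum>i\<in>F. c i *\<^sub>R row i A)
          = (\<Sum>v\<in>B. c (the_inv_into F (\<lambda>i. row i A) v) *\<^sub>R v)"
        unfolding F(2) by (simp add: sum.reindex[OF F(1)] the_inv_into_f_f[OF F(1)])
      ultimately have "\<forall>v\<in>B. c (the_inv_into F (\<lambda>i. row i A) v) = 0"
        using B(2) dependent_finite[of B] F(2) by auto
      then show "\<forall>i\<in>F. c i = 0"
        by (auto simp: F(2) the_inv_into_f_f[OF F(1)])
    qed
    moreover have "rank A = card F"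
      using B(3) F by (simp add: card_image row_rank_def)
    ultimately show "rank A \<in> {card F | F. F \<subseteq> UNIV \<and> ?ind F}"
      by auto
  qed
  then show ?thesis by (simp add: matrix_rank_def)
qed

text \<open>The block of the row of \<open>e\<close> in the two columns of \<open>v\<close>, as an element of the plane.\<close>

definition orbit_block ::
    "('v, 'e) pre_digraph \<Rightarrow> ('e \<Rightarrow> (real^2^2) set) \<Rightarrow> ('v \<Rightarrow> complex) \<Rightarrow> 'e \<Rightarrow> 'v \<Rightarrow> complex" where
  "orbit_block G \<psi> p e v =
     (let a = tail G e; b = head G e;
          out_dir = geodesic_direction (p a) (PSL2_act (\<psi> e) (p b));
          in_dir = geodesic_direction (p b) (PSL2_act (inv\<^bsub>PSL2\<^esub> \<psi> e) (p a))
      in if a = b then (if v = a then out_dir + in_dir else 0)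
         else if v = a then out_dir else if v = b then in_dir else 0)"

text \<open>Columns are indexed by pairs of a vertex and a vector of the standard basis
  \<open>Basis = {1, \<i>}\<close> of the plane.\<close>

definition orbit_rigidity_matrix ::
    "('v, 'e) pre_digraph \<Rightarrow> ('e \<Rightarrow> (real^2^2) set) \<Rightarrow> ('v \<Rightarrow> complex)
      \<Rightarrow> 'e \<Rightarrow> 'v \<times> complex \<Rightarrow> real" where
  "orbit_rigidity_matrix G \<psi> p e = (\<lambda>(v, b). orbit_block G \<psi> p e v \<bullet> b)"

definition orbit_rank ::
    "('v, 'e) pre_digraph \<Rightarrow> ('e \<Rightarrow> (real^2^2) set) \<Rightarrow> ('v \<Rightarrow> complex) \<Rightarrow> nat" where
  "orbit_rank G \<psi> p =
     matrix_rank (arcs G) (verts G \<times> Basis) (orbit_rigidity_matrix G \<psi> p)"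

definition realisation :: "('v, 'e) pre_digraph \<Rightarrow> ('v \<Rightarrow> complex) \<Rightarrow> bool" where
  "realisation G p \<longleftrightarrow> p \<in> verts G \<rightarrow> upper_half_plane"

abbreviation PSL2_subgroup :: "(real^2^2) set set \<Rightarrow> (real^2^2) set monoid" where
  "PSL2_subgroup \<Gamma> \<equiv> PSL2\<lparr>carrier := \<Gamma>\<rparr>"

definition independent_framework ::
    "('v, 'e) pre_digraph \<Rightarrow> ('e \<Rightarrow> (real^2^2) set) \<Rightarrow> ('v \<Rightarrow> complex) \<Rightarrow> bool" where
  "independent_framework G \<psi> p \<longleftrightarrow> orbit_rank G \<psi> p = card (arcs G)"

definition rigid_framework ::
    "(real^2^2) set set \<Rightarrow> ('v, 'e) pre_digraph \<Rightarrow> ('e \<Rightarrow> (real^2^2) set) \<Rightarrow> ('v \<Rightarrow> complex) \<Rightarrow> bool" where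
  "rigid_framework \<Gamma> G \<psi> p \<longleftrightarrow>
     (card (verts G) = 1 \<and> trivial_group (PSL2_subgroup \<Gamma>)) \<or>
     int (orbit_rank G \<psi> p) = 2 * int (card (verts G)) -
       (if trivial_group (PSL2_subgroup \<Gamma>) then 3
        else if cyclic_group (PSL2_subgroup \<Gamma>) then 1
        else 0)"

definition symmetrically_independent ::
    "('v, 'e) pre_digraph \<Rightarrow> ('e \<Rightarrow> (real^2^2) set) \<Rightarrow> bool" where
  "symmetrically_independent G \<psi> \<longleftrightarrow> (\<exists>p. realisation G p \<and> independent_framework G \<psi> p)"

definition symmetrically_rigid ::
    "(real^2^2) set set \<Rightarrow> ('v, 'e) pre_digraph \<Rightarrow> ('e \<Rightarrow> (real^2^2) set) \<Rightarrow> bool" where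
  "symmetrically_rigid \<Gamma> G \<psi> \<longleftrightarrow> (\<exists>p. realisation G p \<and> rigid_framework \<Gamma> G \<psi> p)"

definition symmetrically_isostatic ::
    "(real^2^2) set set \<Rightarrow> ('v, 'e) pre_digraph \<Rightarrow> ('e \<Rightarrow> (real^2^2) set) \<Rightarrow> bool" where
  "symmetrically_isostatic \<Gamma> G \<psi> \<longleftrightarrow>
     symmetrically_independent G \<psi> \<and> symmetrically_rigid \<Gamma> G \<psi>"

end

theory Submission
  imports Defs
begin

text \<open>
  The rank of the orbit rigidity matrix is studied in the hyperboloid model. There the hyperbolic plane
  is a set of vectors in \<open>real^3\<close>, a generator of \<open>\<Gamma>\<close> and its powers act by linear maps \<open>A n\<close>, for
  integers \<open>n\<close>, that fix a common axis \<open>z\<close>, and a velocity at \<open>P\<close> is a vector \<open>X\<close> modulo the multiples of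
  \<open>P\<close>. Solving the geodesic equation (\<open>1 / y\<close> and \<open>x / y\<close> satisfy \<open>u'' = u\<close>) gives the initial directions
  explicitly, see \<open>geodesic_direction_eq\<close>. Up to a nonzero factor, the row of an edge from \<open>u\<close> to \<open>w\<close> with
  the gain of exponent \<open>n\<close> then becomes the functional that maps the velocities \<open>X\<close> to the determinant of
  \<open>X u - A n (X w)\<close>, \<open>P u\<close> and \<open>A n (P w)\<close>; see \<open>orbit_block_sum\<close>. On the combinatorial side, a connected
  subgraph is balanced if and only if it has a potential, that is, the gain of each edge is the
  difference of the values of a function on the vertices. It remains to prove that these functionals
  are independent at some position if and only if the graph is sparse: a nonempty edge set on \<open>k\<close> vertices
  has at most \<open>2 k - 1\<close> edges, and at most \<open>2 k - 3\<close> if it has a potential.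

  Sparsity is necessary because of trivial motions (\<open>sparse_if_prescribable\<close>). All functionals
  vanish on the constant velocity \<open>z\<close>, and a potential \<open>\<theta>\<close> provides the motions \<open>A (- \<theta> a) C\<close> for all
  vectors \<open>C\<close>, a space of dimension three.

  Sparsity is sufficient by induction on the number of vertices (\<open>prescribable_if_sparse\<close>). Some
  vertex \<open>v\<close> has at most three edges. Seen from \<open>v\<close>, each edge leads to a vector, its anchor: the image
  of its far end, or \<open>z\<close> if it is a loop. If there are at most two edges, then any position of \<open>v\<close> off the
  plane of the anchors works. If there are three, then \<open>v\<close> is replaced by a bridge between two far ends,
  and it is put back on the line through the two anchors (\<open>prescribable_replace_bridge\<close>). If none of
  the three bridges preserves sparsity, then each of them is blocked by a tight set of edges. By the
  induction hypothesis these sets are independent, hence they have trivial motions only, and three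
  independent anchors force the parameters \<open>C\<close> of the three sets to agree. Then either the potentials
  of the sets fit together, or all motions of their union are multiples of \<open>z\<close>. In both cases the union
  has so many edges that adding \<open>v\<close> and its edges violates sparsity (\<open>three_blocks_contradiction\<close>).

  Anchors are brought into general position by moving vertices slightly, which preserves independence.
  This fails in one case only: a loop at \<open>v\<close> and two edges to the same vertex whose gains
  differ by a rotation by \<open>\<pi>\<close>. There the parallelogram law permits to replace \<open>v\<close> by a
  loop (\<open>prescribable_half_turn\<close>).
\<close>

section \<open>Counting dimensions\<close>

text \<open>Elimination of one equation at a time. Working with explicit coefficient functions avoids a vector
  space structure on the rows, which are indexed by sets that change during the proofs below.\<close>

lemma underdetermined_system:
  fixes M :: "'i \<Rightarrow> 'j \<Rightarrow> real"
  assumes "finite J" "finite I" "card J < card I"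
  shows "\<exists>c. (\<exists>i\<in>I. c i \<noteq> 0) \<and> (\<forall>j\<in>J. (\<Sum>i\<in>I. c i * M i j) = 0)"
  using assms
proof (induction J arbitrary: I M rule: finite_induct)
  case empty
  then obtain i where "i \<in> I"
    by fastforce
  then show ?case
    by (intro exI[of _ "\<lambda>_. 1"]) auto
next
  case (insert j J)
  show ?case
  proof (cases "\<forall>i\<in>I. M i j = 0")
    case True
    obtain c where "\<exists>i\<in>I. c i \<noteq> 0" "\<forall>j\<in>J. (\<Sum>i\<in>I. c i * M i j) = 0"
      using insert.IH[of I M] insert.prems insert.hyps by auto
    with True show ?thesis
      by (intro exI[of _ c]) auto
  next
    case False
    then obtain i0 where i0: "i0 \<in> I" "M i0 j \<noteq> 0"
      by blast
    define M' where "M' i k = M i k - M i j / M i0 j * M i0 k" for i k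
    have card: "card J < card (I - {i0})"
      using insert.prems insert.hyps i0 by simp
    obtain c where c: "\<exists>i\<in>I - {i0}. c i \<noteq> 0"
        "\<forall>k\<in>J. (\<Sum>i\<in>I - {i0}. c i * M' i k) = 0"
      using insert.IH[of "I - {i0}" M'] card insert.prems by auto
    define s where "s = (\<Sum>i\<in>I - {i0}. c i * M i j) / M i0 j"
    define c' where "c' i = (if i = i0 then - s else c i)" for i
    have split: "(\<Sum>i\<in>I. c' i * M i k) = - s * M i0 k + (\<Sum>i\<in>I - {i0}. c i * M i k)" for k
      using i0 insert.prems by (subst sum.remove[of I i0]) (auto simp: c'_def intro!: sum.cong)
    have "(\<Sum>i\<in>I - {i0}. c i * M' i k) = - s * M i0 k + (\<Sum>i\<in>I - {i0}. c i * M i k)" for k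
      unfolding M'_def s_def
      by (simp add: algebra_simps sum_subtractf sum_distrib_left sum_divide_distrib)
    then have "(\<Sum>i\<in>I. c' i * M i k) = 0" if "k \<in> J" for k
      using split c(2) that by metis
    moreover have "(\<Sum>i\<in>I. c' i * M i j) = 0"
      using split[of j] i0 by (simp add: s_def)
    moreover have "\<exists>i\<in>I. c' i \<noteq> 0"
      using c(1) by (auto simp: c'_def)
    ultimately show ?thesis
      by (intro exI[of _ c']) auto
  qed
qed

text \<open>Vector fields on a finite set \<open>V\<close> are functions into \<open>real^3\<close>; only their values on \<open>V\<close>
  matter.\<close>

definition pairing :: "'v set \<Rightarrow> ('v \<Rightarrow> real^3) \<Rightarrow> ('v \<Rightarrow> real^3) \<Rightarrow> real" where
  "pairing V X Y = (\<Sum>a\<in>V. X a \<bullet> Y a)"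

definition independent_fields :: "'v set \<Rightarrow> 'i set \<Rightarrow> ('i \<Rightarrow> 'v \<Rightarrow> real^3) \<Rightarrow> bool" where
  "independent_fields V I m \<longleftrightarrow>
     (\<forall>c. (\<forall>a\<in>V. (\<Sum>i\<in>I. c i *\<^sub>R m i a) = 0) \<longrightarrow> (\<forall>i\<in>I. c i = 0))"

lemma pairing_sum_left:
  "pairing V (\<lambda>a. \<Sum>i\<in>I. c i *\<^sub>R m i a) Y = (\<Sum>i\<in>I. c i * pairing V (m i) Y)"
  unfolding pairing_def inner_sum_left inner_scaleR_left sum_distrib_left
  by (rule sum.swap)

lemma pairing_commute: "pairing V X Y = pairing V Y X"
  by (simp add: pairing_def inner_commute)

lemma pairing_self_eq_0: "finite V \<Longrightarrow> pairing V X X = 0 \<longleftrightarrow> (\<forall>a\<in>V. X a = 0)"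
  unfolding pairing_def by (subst sum_nonneg_eq_0_iff) auto

text \<open>If a combination of rows plus a combination \<open>Z\<close> of solutions vanishes, then pairing it
  with \<open>Z\<close> leaves \<open>\<parallel>Z\<parallel>\<^sup>2 = 0\<close>; so rows and solutions are jointly independent.\<close>

lemma card_rows_add_card_solutions_le:
  fixes R :: "'e \<Rightarrow> 'v \<Rightarrow> real^3" and m :: "'i \<Rightarrow> 'v \<Rightarrow> real^3"
  assumes fin: "finite V" "finite F" "finite I"
    and ann: "\<And>e i. e \<in> F \<Longrightarrow> i \<in> I \<Longrightarrow> pairing V (R e) (m i) = 0"
    and indR: "independent_fields V F R" and indm: "independent_fields V I m"
  shows "card F + card I \<le> 3 * card V"
proof (rule ccontr)
  assume "\<not> ?thesis"
  then have "card (V \<times> (UNIV :: 3 set)) < card (F <+> I)"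
    using fin by (simp add: card_cartesian_product card_Plus)
  moreover define M where
    "M = case_sum (\<lambda>e (a, k). R e a $ k) (\<lambda>i (a, k). m i a $ (k::3))"
  ultimately obtain c where c: "\<exists>x\<in>F <+> I. c x \<noteq> 0"
      "\<forall>j\<in>V \<times> UNIV. (\<Sum>x\<in>F <+> I. c x * M x j) = 0"
    using underdetermined_system[of "V \<times> (UNIV :: 3 set)" "F <+> I" M] fin by auto
  define Y where "Y a = (\<Sum>e\<in>F. c (Inl e) *\<^sub>R R e a)" for a
  define Z where "Z a = (\<Sum>i\<in>I. c (Inr i) *\<^sub>R m i a)" for a
  have YZ: "Y a = - Z a" if "a \<in> V" for a
  proof -
    have "Y a $ k + Z a $ k = 0" for k
      using c(2)[rule_format, of "(a, k)"] that fin
      by (simp add: Y_def Z_def M_def sum.Plus o_def)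
    then show ?thesis
      by (simp add: vec_eq_iff eq_neg_iff_add_eq_0)
  qed
  have "pairing V Y Z = 0"
    unfolding Y_def pairing_sum_left
  proof (rule sum.neutral, rule ballI)
    fix e assume e: "e \<in> F"
    have "pairing V Z (R e) = 0"
      unfolding Z_def pairing_sum_left
      by (intro sum.neutral ballI) (use ann e in \<open>simp add: pairing_commute\<close>)
    then show "c (Inl e) * pairing V (R e) Z = 0"
      by (simp add: pairing_commute)
  qed
  moreover have "pairing V Y Z = - pairing V Z Z"
    by (simp add: pairing_def YZ sum_negf)
  ultimately have Z0: "\<forall>a\<in>V. Z a = 0"
    using pairing_self_eq_0[OF fin(1), of Z] by simp
  then have "\<forall>i\<in>I. c (Inr i) = 0"
    using indm[unfolded independent_fields_def, rule_format, of "\<lambda>i. c (Inr i)"]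
    by (auto simp: Z_def)
  moreover have "\<forall>e\<in>F. c (Inl e) = 0"
    using indR[unfolded independent_fields_def, rule_format, of "\<lambda>e. c (Inl e)"] YZ Z0
    by (auto simp: Y_def)
  ultimately show False
    using c(1) by auto
qed

text \<open>A solution that is a combination of the fields \<open>m i\<close> and is orthogonal to all of them is
  zero, so the equations together with orthogonality to the \<open>m i\<close> have full rank.\<close>

lemma card_rows_add_card_spanning_ge:
  fixes R :: "'e \<Rightarrow> 'v \<Rightarrow> real^3" and m :: "'i \<Rightarrow> 'v \<Rightarrow> real^3"
  assumes fin: "finite V" "finite F" "finite I"
    and span: "\<And>X. (\<And>e. e \<in> F \<Longrightarrow> pairing V (R e) X = 0) \<Longrightarrow>
      \<exists>b. \<forall>a\<in>V. X a = (\<Sum>i\<in>I. b i *\<^sub>R m i a)"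
  shows "3 * card V \<le> card F + card I"
proof (rule ccontr)
  assume "\<not> ?thesis"
  then have less: "card (F <+> I) < card (V \<times> (UNIV :: 3 set))"
    using fin by (simp add: card_cartesian_product card_Plus)
  define M where
    "M = (\<lambda>(a, k). case_sum (\<lambda>e. R e a $ k) (\<lambda>i. m i a $ (k::3)))"
  obtain c where c: "\<exists>x\<in>V \<times> UNIV. c x \<noteq> 0"
      "\<forall>j\<in>F <+> I. (\<Sum>x\<in>V \<times> UNIV. c x * M x j) = 0"
    using underdetermined_system[OF _ _ less, of M] fin by auto
  define X where "X a = (\<chi> k. c (a, k))" for a
  have pair: "pairing V Y X = (\<Sum>x\<in>V \<times> UNIV. c x * (case x of (a, k) \<Rightarrow> Y a $ k))" for Y
    by (simp add: pairing_def inner_vec_def X_def sum.cartesian_product mult.commute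
        case_prod_unfold)
  have R: "pairing V (R e) X = 0" if "e \<in> F" for e
    using c(2)[rule_format, OF InlI[OF that]] by (simp add: pair M_def case_prod_unfold)
  have m: "pairing V (m i) X = 0" if "i \<in> I" for i
    using c(2)[rule_format, OF InrI[OF that]] by (simp add: pair M_def case_prod_unfold)
  obtain b where b: "\<forall>a\<in>V. X a = (\<Sum>i\<in>I. b i *\<^sub>R m i a)"
    using span[OF R] by blast
  then have "pairing V X X = pairing V (\<lambda>a. \<Sum>i\<in>I. b i *\<^sub>R m i a) X"
    by (simp add: pairing_def)
  also have "\<dots> = 0"
    by (simp add: pairing_sum_left m)
  finally have "\<forall>a\<in>V. X a = 0"
    using pairing_self_eq_0[OF fin(1)] by blast
  then show False
    using c(1) by (auto simp: X_def vec_eq_iff)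
qed

text \<open>The induction adds a functional that is independent of the previous ones; hence it does not vanish on
  their common kernel, onto which \<open>proj\<close> projects.\<close>

lemma dual_family:
  fixes \<phi> :: "'e \<Rightarrow> ('v \<Rightarrow> real^3) \<Rightarrow> real"
  assumes "finite E"
    and lin: "\<And>e X Y k. \<phi> e (\<lambda>a. X a + k *\<^sub>R Y a) = \<phi> e X + k * \<phi> e Y"
    and "\<And>c. (\<And>X. (\<Sum>e\<in>E. c e * \<phi> e X) = 0) \<Longrightarrow> \<forall>e\<in>E. c e = 0"
  shows "\<exists>Y. \<forall>e\<in>E. \<forall>f\<in>E. \<phi> e (Y f) = (if e = f then 1 else 0)"
  using assms(1,3)
proof (induction E rule: finite_induct)
  case empty
  then show ?case by simp
next
  case (insert e0 E)
  have zero: "\<phi> e (\<lambda>a. 0) = 0" for e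
    using lin[of e "\<lambda>a. 0" 1 "\<lambda>a. 0"] by simp
  have lin_sum: "\<phi> e (\<lambda>a. X a + (\<Sum>f\<in>E. k f *\<^sub>R Y f a)) = \<phi> e X + (\<Sum>f\<in>E. k f * \<phi> e (Y f))"
    for e X k Y
    using \<open>finite E\<close>
  proof (induction E rule: finite_induct)
    case (insert f E)
    have "\<phi> e (\<lambda>a. X a + (\<Sum>f\<in>insert f E. k f *\<^sub>R Y f a))
        = \<phi> e (\<lambda>a. (X a + (\<Sum>f\<in>E. k f *\<^sub>R Y f a)) + k f *\<^sub>R Y f a)"
      using insert.hyps by (simp add: algebra_simps)
    also have "\<dots> = \<phi> e (\<lambda>a. X a + (\<Sum>f\<in>E. k f *\<^sub>R Y f a)) + k f * \<phi> e (Y f)"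
      by (rule lin)
    finally show ?case
      using insert.hyps by (simp add: insert.IH ac_simps)
  qed simp
  have "\<forall>e\<in>E. c e = 0" if "\<And>X. (\<Sum>e\<in>E. c e * \<phi> e X) = 0" for c
  proof -
    have "(\<Sum>e\<in>insert e0 E. (if e = e0 then 0 else c e) * \<phi> e X) = (\<Sum>e\<in>E. c e * \<phi> e X)" for X
      using insert.hyps by (auto intro!: sum.cong)
    then have "\<forall>e\<in>insert e0 E. (if e = e0 then 0 else c e) = 0"
      using that by (intro insert.prems) simp
    then show ?thesis
      using insert.hyps by (metis insertCI)
  qed
  then obtain Y where Y: "\<forall>e\<in>E. \<forall>f\<in>E. \<phi> e (Y f) = (if e = f then 1 else 0)"
    using insert.IH by blast
  define proj where "proj X = (\<lambda>a. X a + (\<Sum>f\<in>E. (- \<phi> f X) *\<^sub>R Y f a))" for X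
  have proj: "\<phi> e (proj X) = \<phi> e X + (\<Sum>f\<in>E. (- \<phi> f X) * \<phi> e (Y f))" for e X
    unfolding proj_def by (rule lin_sum)
  have proj0: "\<phi> e (proj X) = 0" if "e \<in> E" for e X
  proof -
    have "(\<Sum>f\<in>E. (- \<phi> f X) * \<phi> e (Y f)) = (\<Sum>f\<in>E. if e = f then - \<phi> f X else 0)"
      using Y that by (intro sum.cong) auto
    then show ?thesis
      using that \<open>finite E\<close> by (simp add: proj)
  qed
  have "\<exists>X. \<phi> e0 (proj X) \<noteq> 0"
  proof (rule ccontr)
    assume "\<nexists>X. \<phi> e0 (proj X) \<noteq> 0"
    then have "\<phi> e0 X - (\<Sum>f\<in>E. \<phi> e0 (Y f) * \<phi> f X) = 0" for X
      using proj[of e0 X] by (simp add: sum_negf mult.commute)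
    then have rel: "(\<Sum>e\<in>insert e0 E. (if e = e0 then 1 else - \<phi> e0 (Y e)) * \<phi> e X) = 0" for X
    proof -
      have "(\<Sum>e\<in>E. (if e = e0 then 1 else - \<phi> e0 (Y e)) * \<phi> e X)
          = (\<Sum>e\<in>E. - (\<phi> e0 (Y e) * \<phi> e X))"
        using insert.hyps by (intro sum.cong) auto
      then show ?thesis
        using insert.hyps \<open>\<phi> e0 X - _ = 0\<close> by (simp add: sum_negf)
    qed
    from insert.prems[OF rel] show False
      by simp
  qed
  then obtain X where X: "\<phi> e0 (proj X) \<noteq> 0" by blast
  define Z where "Z = (\<lambda>a. 0 + (1 / \<phi> e0 (proj X)) *\<^sub>R proj X a)"
  have Z: "\<phi> e Z = \<phi> e (proj X) / \<phi> e0 (proj X)" for e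
    unfolding Z_def by (subst lin) (simp add: zero)
  define Y' where "Y' f = (if f = e0 then Z else (\<lambda>a. Y f a + (- \<phi> e0 (Y f)) *\<^sub>R Z a))" for f
  have "\<phi> e (Y' f) = (if e = f then 1 else 0)" if "e \<in> insert e0 E" "f \<in> insert e0 E" for e f
  proof (cases "f = e0")
    case True
    then show ?thesis
      using that X proj0 by (auto simp: Y'_def Z)
  next
    case False
    have "\<phi> e (Y' f) = \<phi> e (Y f) + (- \<phi> e0 (Y f)) * \<phi> e Z"
      unfolding Y'_def using False by (simp only: if_False lin)
    then show ?thesis
      using that X proj0 Y False insert.hyps by (auto simp: Z)
  qed
  then show ?case by blast
qed

text \<open>Compare the largest coefficient of a relation with the other terms of its column.\<close>

lemma diagonally_dominant_independent:
  fixes M :: "'e \<Rightarrow> 'e \<Rightarrow> real"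
  assumes "finite E"
    and near: "\<And>e f. e \<in> E \<Longrightarrow> f \<in> E \<Longrightarrow> \<bar>M e f - (if e = f then 1 else 0)\<bar> < 1 / (card E + 1)"
    and rel: "\<And>f. f \<in> E \<Longrightarrow> (\<Sum>e\<in>E. c e * M e f) = 0"
  shows "\<forall>e\<in>E. c e = 0"
proof (cases "E = {}")
  case False
  define m where "m = Max ((\<lambda>e. \<bar>c e\<bar>) ` E)"
  have le: "\<bar>c e\<bar> \<le> m" if "e \<in> E" for e
    using that \<open>finite E\<close> by (simp add: m_def)
  have "m \<in> (\<lambda>e. \<bar>c e\<bar>) ` E"
    unfolding m_def using \<open>finite E\<close> False by (intro Max_in) auto
  then obtain f where f: "f \<in> E" "m = \<bar>c f\<bar>" by blast
  have "c f = (\<Sum>e\<in>E. c e * (if e = f then 1 else 0))"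
    using f(1) \<open>finite E\<close> by (simp add: if_distrib sum.delta cong: if_cong)
  also have "\<dots> = - (\<Sum>e\<in>E. c e * (M e f - (if e = f then 1 else 0)))"
    using rel[OF f(1)] by (simp add: right_diff_distrib sum_subtractf)
  finally have "m \<le> (\<Sum>e\<in>E. \<bar>c e * (M e f - (if e = f then 1 else 0))\<bar>)"
    using f by (simp add: sum_abs)
  also have "\<dots> \<le> (\<Sum>e\<in>E. m * (1 / (card E + 1)))"
  proof (rule sum_mono)
    fix e assume e: "e \<in> E"
    show "\<bar>c e * (M e f - (if e = f then 1 else 0))\<bar> \<le> m * (1 / (card E + 1))"
      unfolding abs_mult
      by (rule mult_mono) (use le[OF e] near[OF e f(1)] f(2) in \<open>simp_all add: less_imp_le\<close>)
  qed
  also have "\<dots> = m * (card E / (card E + 1))"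
    by simp
  finally have "m * (1 - card E / (card E + 1)) \<le> 0"
    by (simp add: algebra_simps)
  moreover have "1 - card E / (card E + 1) = 1 / (real (card E) + 1)"
    by (simp add: field_simps)
  ultimately have "m \<le> 0"
    by (simp add: field_simps mult_le_0_iff zero_le_divide_iff)
  then show ?thesis
    using le by fastforce
qed simp

section \<open>Quadratic form and triple product on three-space\<close>

definition triple :: "real^3 \<Rightarrow> real^3 \<Rightarrow> real^3 \<Rightarrow> real" where
  "triple x y w = x \<bullet> cross3 y w"

lemma triple_component:
  "triple x y w = x$1 * (y$2 * w$3 - y$3 * w$2) + x$2 * (y$3 * w$1 - y$1 * w$3)
     + x$3 * (y$1 * w$2 - y$2 * w$1)"
  by (simp add: triple_def cross3_simps)

lemma triple_linear [simp]:
  "triple (x + x') y w = triple x y w + triple x' y w"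
  "triple x (y + y') w = triple x y w + triple x y' w"
  "triple x y (w + w') = triple x y w + triple x y w'"
  "triple (x - x') y w = triple x y w - triple x' y w"
  "triple x (y - y') w = triple x y w - triple x y' w"
  "triple x y (w - w') = triple x y w - triple x y w'"
  "triple (- x) y w = - triple x y w"
  "triple x (- y) w = - triple x y w"
  "triple x y (- w) = - triple x y w"
  "triple (c *\<^sub>R x) y w = c * triple x y w"
  "triple x (c *\<^sub>R y) w = c * triple x y w"
  "triple x y (c *\<^sub>R w) = c * triple x y w"
  "triple 0 y w = 0" "triple x 0 w = 0" "triple x y 0 = 0"
  by (simp_all add: triple_component algebra_simps)

lemma triple_alternating [simp]: "triple x x w = 0" "triple x y y = 0" "triple x y x = 0"
  by (simp_all add: triple_component algebra_simps)

lemma triple_rotate: "triple x y w = triple y w x"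
  by (simp add: triple_component algebra_simps)

lemma triple_swap: "triple x y w = - triple y x w"
  by (simp add: triple_component algebra_simps)

lemma triple_swap': "triple x y w = - triple x w y"
  by (simp add: triple_component algebra_simps)

lemma triple_eq_0_if_cross: "cross3 y w = 0 \<Longrightarrow> triple x y w = 0"
  by (simp add: triple_def)

lemma cross3_nz_if_triple:
  assumes "triple x y w \<noteq> 0"
  shows "cross3 x y \<noteq> 0" "cross3 y w \<noteq> 0" "cross3 x w \<noteq> 0"
proof -
  show "cross3 y w \<noteq> 0" using assms triple_eq_0_if_cross by blast
  show "cross3 x y \<noteq> 0" using assms triple_eq_0_if_cross[of x y w] triple_rotate[of w x y] by auto
  show "cross3 x w \<noteq> 0" using assms triple_eq_0_if_cross[of x w y] triple_swap[of x y w] by auto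
qed

lemma parallel_if_cross3_eq_0:
  assumes "cross3 x y = 0" "x \<noteq> 0"
  obtains c where "y = c *\<^sub>R x"
proof -
  have "(x \<bullet> y) *\<^sub>R x = (x \<bullet> x) *\<^sub>R y"
    using Lagrange[of x x y] assms by simp
  then have "y = ((x \<bullet> y) / (x \<bullet> x)) *\<^sub>R x"
    using assms by (metis (no_types) divide_inverse_commute inner_eq_zero_iff pth_1 scaleR_scaleR left_inverse)
  then show ?thesis by (rule that)
qed

lemma span_if_triple_eq_0:
  assumes "cross3 x y \<noteq> 0" "triple x y w = 0"
  obtains \<alpha> \<beta> where "w = \<alpha> *\<^sub>R x + \<beta> *\<^sub>R y"
proof -
  let ?N = "cross3 x y"
  have "?N \<bullet> w = 0"
    using assms(2) triple_rotate[of w x y] by (simp add: triple_def inner_commute)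
  then have "(?N \<bullet> ?N) *\<^sub>R w = cross3 ?N (cross3 w ?N)"
    unfolding Lagrange[of ?N w ?N] by simp
  also have "\<dots> = (w \<bullet> y) *\<^sub>R cross3 ?N x - (w \<bullet> x) *\<^sub>R cross3 ?N y"
    unfolding Lagrange[of w x y] by (simp add: cross_mult_right Cross3.right_diff_distrib)
  also have "cross3 ?N x = - ((x \<bullet> y) *\<^sub>R x - (x \<bullet> x) *\<^sub>R y)"
    unfolding cross_skew[of ?N x] Lagrange[of x x y] ..
  also have "cross3 ?N y = - ((y \<bullet> y) *\<^sub>R x - (y \<bullet> x) *\<^sub>R y)"
    unfolding cross_skew[of ?N y] Lagrange[of y x y] ..
  finally have "(?N \<bullet> ?N) *\<^sub>R w = ((w \<bullet> x) * (y \<bullet> y) - (w \<bullet> y) * (x \<bullet> y)) *\<^sub>R x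
      + ((w \<bullet> y) * (x \<bullet> x) - (w \<bullet> x) * (y \<bullet> x)) *\<^sub>R y"
    by (simp add: algebra_simps)
  then have "w = inverse (?N \<bullet> ?N) *\<^sub>R (((w \<bullet> x) * (y \<bullet> y) - (w \<bullet> y) * (x \<bullet> y)) *\<^sub>R x
      + ((w \<bullet> y) * (x \<bullet> x) - (w \<bullet> x) * (y \<bullet> x)) *\<^sub>R y)"
    using assms(1) by (metis (no_types) inner_eq_zero_iff left_inverse scaleR_one scaleR_scaleR)
  then show ?thesis
    using that by (simp add: scaleR_add_right)
qed

lemma prescribe_two_triples:
  assumes "triple p x y \<noteq> 0"
  obtains w where "triple w p x = \<alpha>" "triple w p y = \<beta>"
proof
  let ?w = "(\<alpha> / triple p x y) *\<^sub>R y - (\<beta> / triple p x y) *\<^sub>R x"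
  have "triple y p x = triple p x y" "triple x p y = - triple p x y"
    using triple_rotate[of y p x] triple_swap[of x p y] by auto
  then show "triple ?w p x = \<alpha>" "triple ?w p y = \<beta>"
    using assms by simp_all
qed

definition qform :: "real^3 \<Rightarrow> real" where
  "qform x = x$1 * x$3 - (x$2)\<^sup>2"

definition bform :: "real^3 \<Rightarrow> real^3 \<Rightarrow> real" where
  "bform x y = x$1 * y$3 + x$3 * y$1 - 2 * (x$2 * y$2)"

definition cone :: "(real^3) set" where
  "cone = {x. qform x > 0 \<and> x$3 > 0}"

lemma bform_linear [simp]:
  "bform (x + x') y = bform x y + bform x' y" "bform x (y + y') = bform x y + bform x y'"
  "bform (x - x') y = bform x y - bform x' y" "bform x (y - y') = bform x y - bform x y'"
  "bform (c *\<^sub>R x) y = c * bform x y" "bform x (c *\<^sub>R y) = c * bform x y"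
  "bform (- x) y = - bform x y" "bform x (- y) = - bform x y"
  "bform 0 y = 0" "bform x 0 = 0"
  by (simp_all add: bform_def algebra_simps)

lemma bform_commute: "bform x y = bform y x"
  by (simp add: bform_def)

lemma bform_self: "bform x x = 2 * qform x"
  by (simp add: bform_def qform_def power2_eq_square)

lemma qform_add: "qform (x + y) = qform x + bform x y + qform y"
  by (simp add: bform_def qform_def power2_eq_square algebra_simps)

lemma qform_scaleR: "qform (c *\<^sub>R x) = c\<^sup>2 * qform x"
  by (simp add: qform_def power2_eq_square algebra_simps)

text \<open>The form \<open>qform\<close> has signature \<open>(1, 2)\<close> and \<open>P\<close> spans a positive line, so it is negative definite
  on the orthogonal complement of \<open>P\<close>.\<close>

lemma null_orthogonal_to_cone_eq_0:
  assumes P: "P \<in> cone" and orth: "bform P D = 0" and null: "qform D = 0"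
  shows "D = 0"
proof -
  have P': "P$1 * P$3 > (P$2)\<^sup>2" "P$3 > 0"
    using P by (auto simp: cone_def qform_def)
  then have P1: "P$1 > 0"
    by (metis zero_le_power2 le_less_trans zero_less_mult_pos2)
  have D: "D$1 * D$3 = (D$2)\<^sup>2" and PD: "P$1 * D$3 + P$3 * D$1 = 2 * (P$2 * D$2)"
    using orth null by (auto simp: bform_def qform_def)
  have "0 \<le> (P$1 * D$3 - P$3 * D$1)\<^sup>2"
    by simp
  also have "\<dots> = (P$1 * D$3 + P$3 * D$1)\<^sup>2 - 4 * (P$1 * P$3) * (D$1 * D$3)"
    by (simp add: power2_eq_square algebra_simps)
  also have "\<dots> = 4 * (D$2)\<^sup>2 * ((P$2)\<^sup>2 - P$1 * P$3)"
    unfolding PD D by (simp add: power2_eq_square algebra_simps)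
  finally have "(D$2)\<^sup>2 * ((P$2)\<^sup>2 - P$1 * P$3) \<ge> 0"
    by simp
  then have D2: "D$2 = 0"
    using P'(1) by (auto simp: zero_le_mult_iff)
  then have "D$1 = 0 \<or> D$3 = 0"
    using D by simp
  then have "D$1 = 0" "D$3 = 0"
    using PD D2 P1 P'(2) by auto
  then show ?thesis
    using D2 by (simp add: vec_eq_iff forall_3)
qed

text \<open>The equality case of the reversed Cauchy-Schwarz inequality.\<close>

lemma cross3_eq_0_if_cauchy_schwarz_eq:
  assumes P: "P \<in> cone" and eq: "(bform y P)\<^sup>2 = 4 * qform y * qform P"
  shows "cross3 P y = 0"
proof -
  have q: "qform P \<noteq> 0" using P by (simp add: cone_def)
  define k where "k = bform y P / (2 * qform P)"
  let ?D = "y + (- k) *\<^sub>R P"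
  have "bform P ?D = 0"
    using q by (simp add: bform_self bform_commute[of P y] k_def)
  moreover have "qform ?D = qform y - (bform y P)\<^sup>2 / (4 * qform P)"
    unfolding qform_add qform_scaleR k_def using q
    by (simp add: power2_eq_square field_simps)
  then have "qform ?D = 0"
    using eq q by simp
  ultimately have "?D = 0"
    using null_orthogonal_to_cone_eq_0[OF P] by blast
  then have "y = k *\<^sub>R P" by simp
  then show ?thesis
    by (simp add: cross_mult_right)
qed

lemma cone_nz: "x \<in> cone \<Longrightarrow> x \<noteq> 0"
  by (auto simp: cone_def)

section \<open>Linear actions with a common axis\<close>

text \<open>All that the combinatorial part needs to know about a cyclic group of isometries: its linear action
  on the hyperboloid model by the maps \<open>A n\<close>, which need not be pairwise different. The vector \<open>z\<close>
  spans the common axis: the fixed point, the fixed point at infinity or the pole of the invariant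
  geodesic, for an elliptic, parabolic or hyperbolic generator. By the loop identity, a point that is
  joined to its images under \<open>A n\<close> and \<open>A (- n)\<close> behaves as if it were joined to \<open>z\<close>.\<close>

locale axial_action =
  fixes A :: "int \<Rightarrow> real^3 \<Rightarrow> real^3" and z :: "real^3"
    and \<tau> \<kappa> :: "int \<Rightarrow> real"
  assumes linear_A: "linear (A n)"
    and A_add: "A (m + n) x = A m (A n x)"
    and A_0 [simp]: "A 0 x = x"
    and triple_A [simp]: "triple (A n x) (A n y) (A n w) = triple x y w"
    and qform_A [simp]: "qform (A n x) = qform x"
    and cone_A: "x \<in> cone \<Longrightarrow> A n x \<in> cone"
    and A_axis [simp]: "A n z = z"
    and axis_nz: "z \<noteq> 0"
    and fixed_vector: "A n x = x \<Longrightarrow> A n \<noteq> id \<Longrightarrow> cross3 x z = 0"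
    and loop_identity: "A n x + A (- n) x = \<tau> n *\<^sub>R x + (\<kappa> n * bform z x) *\<^sub>R z"
    and \<kappa>_nz: "A n \<noteq> id \<Longrightarrow> \<kappa> n \<noteq> 0"
    and A_1: "A 1 \<noteq> id"
begin

lemma A_linear [simp]:
  "A n (x + y) = A n x + A n y" "A n (x - y) = A n x - A n y"
  "A n (c *\<^sub>R x) = c *\<^sub>R A n x" "A n 0 = 0" "A n (- x) = - A n x"
  using linear_A[of n] by (simp_all add: linear_add linear_diff linear_cmul linear_0 linear_neg)

lemma A_cancel [simp]: "A n (A (- n) x) = x" "A (- n) (A n x) = x"
  by (simp_all flip: A_add)

lemma A_eq_iff [simp]: "A n x = A n y \<longleftrightarrow> x = y"
  by (metis A_cancel(2))

lemma A_eq_0_iff [simp]: "A n x = 0 \<longleftrightarrow> x = 0"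
  using A_eq_iff[of n x 0] by simp

lemma A_sum: "A n (\<Sum>i\<in>I. f i) = (\<Sum>i\<in>I. A n (f i))"
  by (rule linear_sum[OF linear_A])

lemma triple_A_move: "triple (A n x) y (A n w) = triple x (A (- n) y) w"
  using triple_A[of n x "A (- n) y" w] by simp

lemma triple_A_move': "triple (A n x) (A n y) w = triple x y (A (- n) w)"
  using triple_A[of n x y "A (- n) w"] by simp

lemma A_eq_A_iff: "A m = A n \<longleftrightarrow> A (n - m) = id"
proof
  assume "A m = A n"
  then have "A (n - m) x = x" for x
    using A_add[of "- m" n x] A_add[of "- m" m x] by simp
  then show "A (n - m) = id" by auto
next
  assume *: "A (n - m) = id"
  have "A n x = A m x" for x
    using A_add[of m "n - m" x] * by simp
  then show "A m = A n" by auto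
qed

lemma bform_A [simp]: "bform (A n x) (A n y) = bform x y"
  using qform_add[of x y] qform_add[of "A n x" "A n y"] by (simp flip: A_linear)

lemma bform_axis_A [simp]: "bform z (A n x) = bform z x"
  using bform_A[of n z x] by simp

lemma cross3_A_eq_0_iff: "cross3 (A n x) (A n y) = 0 \<longleftrightarrow> cross3 x y = 0"
proof -
  have "cross3 (A n x) (A n y) = 0" if "cross3 x y = 0" for x y n
  proof (cases "x = 0")
    case False
    with that obtain c where "y = c *\<^sub>R x" by (rule parallel_if_cross3_eq_0)
    then show ?thesis by (simp add: cross_mult_right)
  qed simp
  from this[of x y n] this[of "A n x" "A n y" "- n"] show ?thesis by auto
qed

lemma cross3_A_axis: "cross3 (A n x) z = 0 \<longleftrightarrow> cross3 x z = 0"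
  using cross3_A_eq_0_iff[of n x z] by simp

text \<open>The points of the cone at which the Killing field of the axis does not vanish and that do not
  lie on the polar plane of the axis.\<close>

definition good :: "real^3 \<Rightarrow> bool" where
  "good x \<longleftrightarrow> x \<in> cone \<and> bform z x \<noteq> 0 \<and> cross3 x z \<noteq> 0"

lemma good_A [simp]: "good x \<Longrightarrow> good (A n x)"
  by (auto simp: good_def cone_A cross3_A_axis)

lemma good_nz: "good x \<Longrightarrow> x \<noteq> 0"
  by (auto simp: good_def)

lemma good_moved: "good x \<Longrightarrow> A n \<noteq> id \<Longrightarrow> A n x \<noteq> x"
  using fixed_vector by (auto simp: good_def)

lemma good_not_eigenvector:
  assumes "good x" "A n \<noteq> id"
  shows "cross3 x (A n x) \<noteq> 0"
proof
  assume "cross3 x (A n x) = 0"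
  then obtain c where c: "A n x = c *\<^sub>R x"
    using good_nz[OF assms(1)] by (rule parallel_if_cross3_eq_0)
  have "bform z x = c * bform z x"
    using bform_axis_A[of n x] by (simp add: c)
  then have "c = 1"
    using assms(1) by (simp add: good_def)
  then show False
    using good_moved[OF assms] c by simp
qed

text \<open>Three points of an orbit lie on a plane section of a quadric; if they were collinear in that
  plane, then the whole line would lie in the quadric.\<close>

lemma three_orbit_points_independent:
  assumes x: "good x" and ne: "A i \<noteq> A j" "A i \<noteq> A k" "A j \<noteq> A k"
  shows "triple (A i x) (A j x) (A k x) \<noteq> 0"
proof
  assume "triple (A i x) (A j x) (A k x) = 0"
  define m n where "m = j - i" and "n = k - i"
  have ids: "A m \<noteq> id" "A n \<noteq> id"
    using ne A_eq_A_iff by (auto simp: m_def n_def)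
  have "A (- i) (A j x) = A m x" "A (- i) (A k x) = A n x"
    by (simp_all add: m_def n_def flip: A_add)
  then have "triple x (A m x) (A n x) = 0"
    using \<open>triple _ _ _ = 0\<close> triple_A[of "- i" "A i x" "A j x" "A k x"] by simp
  then obtain \<alpha> \<beta> where ab: "A n x = \<alpha> *\<^sub>R x + \<beta> *\<^sub>R A m x"
    using span_if_triple_eq_0[OF good_not_eigenvector[OF x ids(1)]] by metis
  define D where "D = A m x - x"
  have "bform z x = (\<alpha> + \<beta>) * bform z x"
    using bform_axis_A[of n x] unfolding ab by (simp add: algebra_simps)
  then have \<alpha>: "\<alpha> = 1 - \<beta>"
    using x by (simp add: good_def)
  have nx: "A n x = x + \<beta> *\<^sub>R D"
    unfolding ab D_def \<alpha> by (simp add: algebra_simps)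
  have mx: "A m x = x + 1 *\<^sub>R D"
    by (simp add: D_def)
  have "\<beta> \<noteq> 0"
    using nx good_moved[OF x ids(2)] by auto
  moreover have "\<beta> \<noteq> 1"
  proof
    assume "\<beta> = 1"
    then have "A n x = A m x" using nx mx by simp
    then have "A (n - m) x = x"
      using A_add[of "- m" n x] by simp
    moreover have "A (n - m) \<noteq> id"
      using ne(3) A_eq_A_iff[of j k] by (simp add: m_def n_def)
    ultimately show False using good_moved[OF x] by blast
  qed
  moreover have eqs: "\<beta> * bform x D + \<beta>\<^sup>2 * qform D = 0" "bform x D + qform D = 0"
    using qform_A[of n x] qform_A[of m x] unfolding nx mx qform_add qform_scaleR
    by simp_all
  then have "(\<beta> * (\<beta> - 1)) * qform D = 0"
    by algebra
  ultimately have "qform D = 0" by simp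
  with eqs have "D = 0"
    using null_orthogonal_to_cone_eq_0[of x D] x by (simp add: good_def)
  then show False
    using mx good_moved[OF x ids(1)] by simp
qed

text \<open>By assumption \<open>x\<close> is an eigenvector of \<open>A n\<close> modulo \<open>z\<close>. Since \<open>A n\<close> preserves \<open>bform z\<close> and \<open>qform\<close>,
  the eigenvalue can only be \<open>- 1\<close>; then \<open>A n\<close> is the rotation by \<open>\<pi>\<close> about the axis.\<close>

lemma half_turn:
  assumes x: "good x" and n: "A n \<noteq> id" and dep: "triple z x (A n x) = 0"
  obtains c where "c \<noteq> 0" "\<And>y. A n y = - y + (c * bform z y) *\<^sub>R z"
proof -
  have zx: "cross3 z x \<noteq> 0"
    using x cross_skew[of z x] by (auto simp: good_def)
  obtain \<beta> \<alpha> where ab: "A n x = \<beta> *\<^sub>R z + \<alpha> *\<^sub>R x"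
    using span_if_triple_eq_0[OF zx dep] by metis
  have L: "bform z x \<noteq> 0" and xz: "cross3 x z \<noteq> 0" and cone: "x \<in> cone"
    using x by (auto simp: good_def)
  have \<beta>: "\<beta> \<noteq> 0"
    using good_not_eigenvector[OF x n] unfolding ab by (auto simp: cross_mult_right)
  define l q p where "l = bform z x" and "q = qform x" and "p = qform z"
  have lin: "l = \<beta> * (2 * p) + \<alpha> * l"
    using bform_axis_A[of n x] unfolding ab by (simp add: bform_self l_def p_def)
  have quad: "q = \<beta>\<^sup>2 * p + \<beta> * \<alpha> * l + \<alpha>\<^sup>2 * q"
    using qform_A[of n x] unfolding ab qform_add qform_scaleR
    by (simp add: l_def q_def p_def algebra_simps)
  \<comment> \<open>Otherwise the two equations combine to the equality case of Cauchy-Schwarz for \<open>x\<close> and \<open>z\<close>.\<close>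
  have "\<alpha> = - 1"
  proof (rule ccontr)
    assume "\<alpha> \<noteq> - 1"
    have "(1 + \<alpha>) * (2 * (q * (1 - \<alpha>)) - \<beta> * l) = 0"
      using lin quad by algebra
    then have "2 * (q * (1 - \<alpha>)) = \<beta> * l"
      using \<open>\<alpha> \<noteq> - 1\<close> by auto
    then have "\<beta> * (l\<^sup>2 - 4 * p * q) = 0"
      using lin by algebra
    then have "(bform z x)\<^sup>2 = 4 * qform z * qform x"
      using \<beta> by (simp add: l_def p_def q_def)
    then show False
      using cross3_eq_0_if_cauchy_schwarz_eq[OF cone] xz by blast
  qed
  then have nx: "A n x = \<beta> *\<^sub>R z - x"
    using ab by simp
  then have "A n (A n x) = x"
    by simp
  then have "A (n + n) x = x"
    by (simp only: A_add)
  then have "A (n + n) = id"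
    using good_moved[OF x] by blast
  then have inv: "A (- n) y = A n y" for y
    using A_add[of "- n" "n + n" y] by simp
  have two: "2 *\<^sub>R A n y = \<tau> n *\<^sub>R y + (\<kappa> n * bform z y) *\<^sub>R z" for y
    using loop_identity[of n y] by (simp add: inv scaleR_2)
  have "(2 * \<beta> - \<kappa> n * l) *\<^sub>R z = (\<tau> n + 2) *\<^sub>R x"
    using two[of x] by (simp add: nx l_def algebra_simps)
  moreover have "cross3 ((2 * \<beta> - \<kappa> n * l) *\<^sub>R z) z = 0"
    by (simp add: cross_mult_left)
  ultimately have "(\<tau> n + 2) *\<^sub>R cross3 x z = 0"
    by (simp add: cross_mult_left)
  then have "\<tau> n = - 2"
    using xz by simp
  then have "2 *\<^sub>R A n y = 2 *\<^sub>R (- y + (\<kappa> n / 2 * bform z y) *\<^sub>R z)" for y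
    using two[of y] by (simp add: algebra_simps)
  then have "A n y = - y + (\<kappa> n / 2 * bform z y) *\<^sub>R z" for y
    by (metis scaleR_cancel_left zero_neq_numeral)
  then show ?thesis
    using that[of "\<kappa> n / 2"] \<kappa>_nz[OF n] by simp
qed

end

section \<open>Sparsity and motions of gain graphs with integer gains\<close>

type_synonym 'v gain_edge = "'v \<times> int \<times> 'v"

definition ends :: "'v gain_edge \<Rightarrow> 'v set" where
  "ends e = {fst e, snd (snd e)}"

definition touched :: "'v gain_edge set \<Rightarrow> 'v set" where
  "touched F = (\<Union>e\<in>F. ends e)"

lemma ends_simp [simp]: "ends (u, n, w) = {u, w}"
  by (simp add: ends_def)

lemma finite_ends [simp]: "finite (ends e)"
  by (simp add: ends_def)

lemma finite_touched [simp]: "finite F \<Longrightarrow> finite (touched F)"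
  by (simp add: touched_def)

lemma ends_subset_touched: "e \<in> F \<Longrightarrow> ends e \<subseteq> touched F"
  by (auto simp: touched_def)

lemma touched_Un [simp]: "touched (E \<union> F) = touched E \<union> touched F"
  by (auto simp: touched_def)

lemma touched_insert [simp]: "touched (insert e F) = ends e \<union> touched F"
  by (auto simp: touched_def)

lemma touched_empty [simp]: "touched {} = {}"
  by (simp add: touched_def)

lemma touched_mono: "E \<subseteq> F \<Longrightarrow> touched E \<subseteq> touched F"
  by (auto simp: touched_def)

context axial_action
begin

text \<open>A potential certifies that every closed walk has trivial gain.\<close>

definition potential :: "'v gain_edge set \<Rightarrow> ('v \<Rightarrow> int) \<Rightarrow> bool" where
  "potential F \<theta> \<longleftrightarrow> (\<forall>(u, n, w)\<in>F. A n = A (\<theta> w - \<theta> u))"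

lemma potentialD: "potential F \<theta> \<Longrightarrow> (u, n, w) \<in> F \<Longrightarrow> A n = A (\<theta> w - \<theta> u)"
  unfolding potential_def by (drule (1) bspec) simp

definition sparse :: "'v gain_edge set \<Rightarrow> bool" where
  "sparse E \<longleftrightarrow> (\<forall>F\<subseteq>E. F \<noteq> {} \<longrightarrow> card F + 1 \<le> 2 * card (touched F) \<and>
     ((\<exists>\<theta>. potential F \<theta>) \<longrightarrow> card F + 3 \<le> 2 * card (touched F)))"

lemma sparse_subset: "sparse E \<Longrightarrow> E' \<subseteq> E \<Longrightarrow> sparse E'"
  unfolding sparse_def by blast

lemma sparseD: "sparse E \<Longrightarrow> F \<subseteq> E \<Longrightarrow> F \<noteq> {} \<Longrightarrow> card F + 1 \<le> 2 * card (touched F)"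
  unfolding sparse_def by blast

lemma sparseD_potential:
  "sparse E \<Longrightarrow> F \<subseteq> E \<Longrightarrow> F \<noteq> {} \<Longrightarrow> potential F \<theta> \<Longrightarrow> card F + 3 \<le> 2 * card (touched F)"
  unfolding sparse_def by blast

text \<open>Up to a nonzero factor, the first-order change of the length of the edge from \<open>P u\<close>
  to \<open>A n (P w)\<close> when the points move with velocities \<open>X\<close>.\<close>

definition length_change :: "('v \<Rightarrow> real^3) \<Rightarrow> 'v gain_edge \<Rightarrow> ('v \<Rightarrow> real^3) \<Rightarrow> real" where
  "length_change P e X =
     (case e of (u, n, w) \<Rightarrow> triple (X u - A n (X w)) (P u) (A n (P w)))"

definition length_row :: "('v \<Rightarrow> real^3) \<Rightarrow> 'v gain_edge \<Rightarrow> 'v \<Rightarrow> real^3" where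
  "length_row P e a = (case e of (u, n, w) \<Rightarrow>
     (if a = u then cross3 (P u) (A n (P w)) else 0)
     - (if a = w then cross3 (A (- n) (P u)) (P w) else 0))"

lemma length_change_simp [simp]:
  "length_change P (u, n, w) X = triple (X u - A n (X w)) (P u) (A n (P w))"
  by (simp add: length_change_def)

lemma length_change_reverse:
  "length_change P (u, n, w) X = length_change P (w, - n, u) X"
proof -
  have "triple (X w - A (- n) (X u)) (P w) (A (- n) (P u))
      = triple (A n (X w - A (- n) (X u))) (A n (P w)) (A n (A (- n) (P u)))"
    by (rule triple_A[symmetric])
  also have "\<dots> = triple (X u - A n (X w)) (P u) (A n (P w))"
    using triple_swap'[of _ "A n (P w)" "P u"] by simp
  finally show ?thesis by simp
qed

lemma length_change_linear:
  "length_change P e (\<lambda>a. X a + k *\<^sub>R Y a) = length_change P e X + k * length_change P e Y"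
proof (cases e)
  case (fields u n w)
  have "(X u + k *\<^sub>R Y u) - A n (X w + k *\<^sub>R Y w) = (X u - A n (X w)) + k *\<^sub>R (Y u - A n (Y w))"
    by (simp add: scaleR_diff_right)
  then show ?thesis
    unfolding fields length_change_simp by (simp only: triple_linear)
qed

lemma length_change_cong:
  assumes "\<And>a. a \<in> ends e \<Longrightarrow> P a = P' a" "\<And>a. a \<in> ends e \<Longrightarrow> X a = X' a"
  shows "length_change P e X = length_change P' e X'"
  using assms by (cases e) simp

lemma pairing_length_row:
  assumes "finite V" "ends e \<subseteq> V"
  shows "pairing V (length_row P e) X = length_change P e X"
proof (cases e)
  case (fields u n w)
  have "(\<Sum>a\<in>V. (if a = u then cross3 (P u) (A n (P w)) else 0) \<bullet> X a)
      = cross3 (P u) (A n (P w)) \<bullet> X u"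
    using assms by (simp add: if_distrib[of "\<lambda>x. x \<bullet> _"] fields cong: if_cong)
  moreover have "(\<Sum>a\<in>V. (if a = w then cross3 (A (- n) (P u)) (P w) else 0) \<bullet> X a)
      = cross3 (A (- n) (P u)) (P w) \<bullet> X w"
    using assms by (simp add: if_distrib[of "\<lambda>x. x \<bullet> _"] fields cong: if_cong)
  ultimately have "pairing V (length_row P e) X
      = cross3 (P u) (A n (P w)) \<bullet> X u - cross3 (A (- n) (P u)) (P w) \<bullet> X w"
    by (simp add: pairing_def length_row_def fields inner_diff_left sum_subtractf)
  also have "\<dots> = triple (X u) (P u) (A n (P w)) - triple (X w) (A (- n) (P u)) (P w)"
    by (simp add: triple_def inner_commute)
  finally show ?thesis
    by (simp add: fields triple_A_move)
qed

text \<open>Linear independence of the length changes is equivalent to the solvability of all systems with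
  prescribed length changes. The second form is the convenient one for adding a vertex, since the
  velocities of the old vertices can be chosen first.\<close>

definition independent_at :: "('v \<Rightarrow> real^3) \<Rightarrow> 'v gain_edge set \<Rightarrow> bool" where
  "independent_at P E \<longleftrightarrow>
     (\<forall>c. (\<forall>X. (\<Sum>e\<in>E. c e * length_change P e X) = 0) \<longrightarrow> (\<forall>e\<in>E. c e = 0))"

definition prescribable :: "('v \<Rightarrow> real^3) \<Rightarrow> 'v gain_edge set \<Rightarrow> bool" where
  "prescribable P E \<longleftrightarrow> (\<forall>b. \<exists>X. \<forall>e\<in>E. length_change P e X = b e)"

lemma length_change_sum:
  assumes "finite I"
  shows "length_change P e (\<lambda>a. \<Sum>i\<in>I. k i *\<^sub>R Y i a) = (\<Sum>i\<in>I. k i * length_change P e (Y i))"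
  using assms
proof (induction I rule: finite_induct)
  case empty
  then show ?case by (cases e) simp
next
  case (insert i I)
  then show ?case
    using length_change_linear[of P e "\<lambda>a. \<Sum>i\<in>I. k i *\<^sub>R Y i a" "k i" "Y i"]
    by (simp add: add.commute)
qed

lemma dual_motions:
  assumes "finite E" "independent_at P E"
  obtains Y where
    "\<And>e f. e \<in> E \<Longrightarrow> f \<in> E \<Longrightarrow> length_change P e (Y f) = (if e = f then 1 else 0)"
proof -
  have "\<exists>Y. \<forall>e\<in>E. \<forall>f\<in>E. length_change P e (Y f) = (if e = f then 1 else 0)"
    by (rule dual_family[OF assms(1) length_change_linear])
      (use assms(2) in \<open>simp add: independent_at_def\<close>)
  then show ?thesis
    using that by blast
qed

lemma prescribable_iff_independent_at:
  assumes "finite E"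
  shows "prescribable P E \<longleftrightarrow> independent_at P E"
proof
  assume presc: "prescribable P E"
  show "independent_at P E"
    unfolding independent_at_def
  proof (intro allI impI)
    fix c assume *: "\<forall>X. (\<Sum>e\<in>E. c e * length_change P e X) = 0"
    obtain X where "\<forall>e\<in>E. length_change P e X = c e"
      using presc by (auto simp: prescribable_def)
    then have "(\<Sum>e\<in>E. c e * c e) = (\<Sum>e\<in>E. c e * length_change P e X)"
      by simp
    then have "(\<Sum>e\<in>E. c e * c e) = 0"
      using * by simp
    then show "\<forall>e\<in>E. c e = 0"
      using assms by (simp add: sum_nonneg_eq_0_iff)
  qed
next
  assume "independent_at P E"
  then obtain Y where Y:
    "\<And>e f. e \<in> E \<Longrightarrow> f \<in> E \<Longrightarrow> length_change P e (Y f) = (if e = f then 1 else 0)"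
    using dual_motions[OF assms] by blast
  show "prescribable P E"
    unfolding prescribable_def
  proof (intro allI exI ballI)
    fix b e assume "e \<in> E"
    then have "(\<Sum>f\<in>E. b f * length_change P e (Y f)) = (\<Sum>f\<in>E. if e = f then b f else 0)"
      by (intro sum.cong) (auto simp: Y)
    then show "length_change P e (\<lambda>a. \<Sum>f\<in>E. b f *\<^sub>R Y f a) = b e"
      using assms \<open>e \<in> E\<close> by (simp add: length_change_sum)
  qed
qed

lemma prescribable_subset: "prescribable P E \<Longrightarrow> F \<subseteq> E \<Longrightarrow> prescribable P F"
  unfolding prescribable_def subset_iff by fast

lemma prescribable_cong:
  assumes "\<And>a. a \<in> touched E \<Longrightarrow> P a = P' a"
  shows "prescribable P E \<longleftrightarrow> prescribable P' E"
proof -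
  have "length_change P e X = length_change P' e X" if "e \<in> E" for e X
    using assms ends_subset_touched[OF that] by (intro length_change_cong) auto
  then show ?thesis
    unfolding prescribable_def by auto
qed

lemma independent_fields_length_row:
  assumes "finite F" "prescribable P F"
  shows "independent_fields (touched F) F (length_row P)"
  unfolding independent_fields_def
proof (intro allI impI)
  fix c assume *: "\<forall>a\<in>touched F. (\<Sum>e\<in>F. c e *\<^sub>R length_row P e a) = 0"
  have "(\<Sum>e\<in>F. c e * length_change P e X) = 0" for X
  proof -
    have "(\<Sum>e\<in>F. c e * length_change P e X)
        = (\<Sum>e\<in>F. c e * pairing (touched F) (length_row P e) X)"
      using assms by (intro sum.cong) (auto simp: pairing_length_row ends_subset_touched)
    also have "\<dots> = pairing (touched F) (\<lambda>a. \<Sum>e\<in>F. c e *\<^sub>R length_row P e a) X"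
      by (rule pairing_sum_left[symmetric])
    also have "\<dots> = 0"
      using * by (simp add: pairing_def)
    finally show ?thesis .
  qed
  then show "\<forall>e\<in>F. c e = 0"
    using assms prescribable_iff_independent_at[OF assms(1)] by (simp add: independent_at_def)
qed

text \<open>The fields \<open>A (- \<theta> a) C\<close> for \<open>C\<close> in the span of \<open>D\<close>, together with the multiples of \<open>P a\<close>
  at each single vertex, which represent the zero velocity.\<close>

definition trivial_field ::
    "('v \<Rightarrow> real^3) \<Rightarrow> ('v \<Rightarrow> int) \<Rightarrow> ('k \<Rightarrow> real^3) \<Rightarrow> 'v + 'k \<Rightarrow> 'v \<Rightarrow> real^3" where
  "trivial_field P \<theta> D = case_sum (\<lambda>v a. if a = v then P v else 0) (\<lambda>k a. A (- \<theta> a) (D k))"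

lemma trivial_field_sum:
  assumes "finite V" "finite K" "a \<in> V"
  shows "(\<Sum>i\<in>V <+> K. b i *\<^sub>R trivial_field P \<theta> D i a)
    = A (- \<theta> a) (\<Sum>k\<in>K. b (Inr k) *\<^sub>R D k) + b (Inl a) *\<^sub>R P a"
proof -
  have "(\<Sum>v\<in>V. b (Inl v) *\<^sub>R (if a = v then P v else 0)) = b (Inl a) *\<^sub>R P a"
    using assms by (simp add: if_distrib[of "\<lambda>x. _ *\<^sub>R x"] cong: if_cong)
  then show ?thesis
    using assms by (simp add: sum.Plus trivial_field_def A_sum o_def)
qed

definition preserves_lengths :: "'v gain_edge set \<Rightarrow> ('v \<Rightarrow> int) \<Rightarrow> real^3 \<Rightarrow> bool" where
  "preserves_lengths F \<theta> C \<longleftrightarrow> (\<forall>(u, n, w)\<in>F. A n (A (- \<theta> w) C) = A (- \<theta> u) C)"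

lemma preserves_lengthsD:
  "preserves_lengths F \<theta> C \<Longrightarrow> (u, n, w) \<in> F \<Longrightarrow> A n (A (- \<theta> w) C) = A (- \<theta> u) C"
  unfolding preserves_lengths_def by (drule (1) bspec) simp

lemma preserves_lengths_axis: "preserves_lengths F \<theta> z"
  by (auto simp: preserves_lengths_def)

lemma preserves_lengths_potential: "potential F \<theta> \<Longrightarrow> preserves_lengths F \<theta> C"
  unfolding preserves_lengths_def
proof (clarify)
  fix u n w assume "potential F \<theta>" "(u, n, w) \<in> F"
  then have "A n = A (\<theta> w - \<theta> u)"
    by (rule potentialD)
  moreover have "A (\<theta> w - \<theta> u) (A (- \<theta> w) C) = A (- \<theta> u) C"
    by (simp flip: A_add)
  ultimately show "A n (A (- \<theta> w) C) = A (- \<theta> u) C"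
    by simp
qed

lemma length_change_trivial_field:
  assumes "e \<in> F" "\<And>k. k \<in> K \<Longrightarrow> preserves_lengths F \<theta> (D k)" "i \<in> V <+> K"
  shows "length_change P e (trivial_field P \<theta> D i) = 0"
proof (cases e)
  case (fields u n w)
  show ?thesis
  proof (cases i)
    case (Inl v)
    then show ?thesis
      by (simp add: fields trivial_field_def)
  next
    case (Inr k)
    with assms fields have "A n (A (- \<theta> w) (D k)) = A (- \<theta> u) (D k)"
      by (auto intro: preserves_lengthsD)
    then show ?thesis
      by (simp add: fields trivial_field_def Inr)
  qed
qed

text \<open>A field that is a multiple of \<open>P\<close> at both ends of an edge of nonzero length can only come
  from \<open>C = 0\<close>, because \<open>P u\<close> and \<open>A n (P w)\<close> are not parallel.\<close>

lemma independent_trivial_field: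
  assumes fin: "finite F" "finite K" and "F \<noteq> {}" and presc: "prescribable P F"
    and pres: "\<And>k. k \<in> K \<Longrightarrow> preserves_lengths F \<theta> (D k)"
    and nz: "\<And>a. P a \<noteq> 0"
    and indep: "\<And>b. (\<Sum>k\<in>K. b k *\<^sub>R D k) = 0 \<Longrightarrow> \<forall>k\<in>K. b k = 0"
  shows "independent_fields (touched F) (touched F <+> K) (trivial_field P \<theta> D)"
  unfolding independent_fields_def
proof (intro allI impI)
  fix b assume *: "\<forall>a\<in>touched F. (\<Sum>i\<in>touched F <+> K. b i *\<^sub>R trivial_field P \<theta> D i a) = 0"
  define C where "C = (\<Sum>k\<in>K. b (Inr k) *\<^sub>R D k)"
  define r where "r a = b (Inl a)" for a
  have zero: "A (- \<theta> a) C + r a *\<^sub>R P a = 0" if "a \<in> touched F" for a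
    using * that fin by (simp add: trivial_field_sum C_def r_def)
  obtain u n w where e: "(u, n, w) \<in> F"
    using \<open>F \<noteq> {}\<close> by auto
  have uw: "u \<in> touched F" "w \<in> touched F"
    using ends_subset_touched[OF e] by auto
  obtain X where "length_change P (u, n, w) X = 1"
    using presc e by (fastforce simp: prescribable_def)
  then have nonpar: "cross3 (P u) (A n (P w)) \<noteq> 0"
    by (auto simp: triple_eq_0_if_cross)
  have "A n (A (- \<theta> w) C) = A (- \<theta> u) C"
    unfolding C_def A_sum A_linear
    by (intro sum.cong refl) (simp add: preserves_lengthsD[OF pres e])
  moreover have "A (- \<theta> w) C = - (r w *\<^sub>R P w)" "A (- \<theta> u) C = - (r u *\<^sub>R P u)"
    using zero uw by (auto simp: add_eq_0_iff2)
  ultimately have "r w *\<^sub>R A n (P w) = r u *\<^sub>R P u"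
    by simp
  then have "cross3 (P u) (r w *\<^sub>R A n (P w)) = 0"
    by (simp add: cross_mult_right)
  then have "r w = 0"
    using nonpar by (simp add: cross_mult_right)
  then have C0: "C = 0"
    using zero[OF uw(2)] by simp
  then have "\<forall>k\<in>K. b (Inr k) = 0"
    using indep[of "\<lambda>k. b (Inr k)"] by (simp add: C_def)
  moreover have "\<forall>a\<in>touched F. b (Inl a) = 0"
    using zero nz by (auto simp: C0 r_def)
  ultimately show "\<forall>i\<in>touched F <+> K. b i = 0"
    by auto
qed

lemma card_le_if_prescribable:
  assumes fin: "finite F" "finite K" and "F \<noteq> {}" and presc: "prescribable P F"
    and pres: "\<And>k. k \<in> K \<Longrightarrow> preserves_lengths F \<theta> (D k)"
    and nz: "\<And>a. P a \<noteq> 0"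
    and indep: "\<And>b. (\<Sum>k\<in>K. b k *\<^sub>R D k) = 0 \<Longrightarrow> \<forall>k\<in>K. b k = 0"
  shows "card F + card K \<le> 2 * card (touched F)"
proof -
  have "card F + card (touched F <+> K) \<le> 3 * card (touched F)"
  proof (rule card_rows_add_card_solutions_le)
    show "pairing (touched F) (length_row P e) (trivial_field P \<theta> D i) = 0"
      if "e \<in> F" "i \<in> touched F <+> K" for e i
      using that fin length_change_trivial_field[of e F K \<theta> D i "touched F" P] pres
      by (simp add: pairing_length_row ends_subset_touched)
  qed (use fin presc independent_fields_length_row independent_trivial_field[OF assms] in auto)
  then show ?thesis
    using fin by (simp add: card_Plus)
qed

text \<open>If the count is attained, then one more independent motion would exceed it.\<close>

lemma motion_trivial_if_tight:
  assumes fin: "finite F" "finite K" and "F \<noteq> {}" and presc: "prescribable P F"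
    and pres: "\<And>k. k \<in> K \<Longrightarrow> preserves_lengths F \<theta> (D k)"
    and nz: "\<And>a. P a \<noteq> 0"
    and indep: "\<And>b. (\<Sum>k\<in>K. b k *\<^sub>R D k) = 0 \<Longrightarrow> \<forall>k\<in>K. b k = 0"
    and tight: "card F + card K = 2 * card (touched F)"
    and X: "\<And>e. e \<in> F \<Longrightarrow> length_change P e X = 0"
  obtains b r where "\<And>a. a \<in> touched F \<Longrightarrow> X a = A (- \<theta> a) (\<Sum>k\<in>K. b k *\<^sub>R D k) + r a *\<^sub>R P a"
proof -
  let ?V = "touched F"
  let ?I = "insert None (Some ` (?V <+> K))"
  define m where "m = case_option X (trivial_field P \<theta> D)"
  have finI: "finite (?V <+> K)" using fin by simp
  have sum: "(\<Sum>i\<in>?I. b i *\<^sub>R m i a)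
      = b None *\<^sub>R X a + (\<Sum>i\<in>?V <+> K. b (Some i) *\<^sub>R trivial_field P \<theta> D i a)" for b a
    using finI by (subst sum.insert) (auto simp: m_def sum.reindex)
  have "\<not> independent_fields ?V ?I m"
  proof
    assume "independent_fields ?V ?I m"
    then have "card F + card ?I \<le> 3 * card ?V"
    proof (rule card_rows_add_card_solutions_le[rotated -1])
      show "pairing ?V (length_row P e) (m i) = 0" if "e \<in> F" "i \<in> ?I" for e i
      proof (cases i)
        case None
        then show ?thesis
          using that(1) fin X[OF that(1)]
          by (simp add: pairing_length_row ends_subset_touched m_def)
      next
        case (Some j)
        then have "length_change P e (m i) = 0"
          using that length_change_trivial_field[of e F K \<theta> D j "touched F" P] pres
          by (auto simp: m_def)
        then show ?thesis
          using that(1) fin by (simp add: pairing_length_row ends_subset_touched)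
      qed
    qed (use fin presc independent_fields_length_row in auto)
    moreover have "card ?I = Suc (card ?V + card K)"
      using fin by (subst card_insert_disjoint) (auto simp: card_image card_Plus)
    ultimately show False
      using tight by simp
  qed
  then obtain b where b: "\<forall>a\<in>?V. (\<Sum>i\<in>?I. b i *\<^sub>R m i a) = 0" "\<exists>i\<in>?I. b i \<noteq> 0"
    unfolding independent_fields_def by blast
  have ind: "independent_fields ?V (?V <+> K) (trivial_field P \<theta> D)"
    by (rule independent_trivial_field[OF fin \<open>F \<noteq> {}\<close> presc]) (use pres nz indep in auto)
  have "b None \<noteq> 0"
  proof
    assume None: "b None = 0"
    have "\<forall>i\<in>?V <+> K. b (Some i) = 0"
      using ind[unfolded independent_fields_def, rule_format, of "\<lambda>i. b (Some i)"]
        b(1)[unfolded sum None] by simp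
    then show False
      using b(2) None by auto
  qed
  define s where "s = - 1 / b None"
  have "X a = A (- \<theta> a) (\<Sum>k\<in>K. (s * b (Some (Inr k))) *\<^sub>R D k) + (s * b (Some (Inl a))) *\<^sub>R P a"
    if a: "a \<in> ?V" for a
  proof -
    let ?S = "\<Sum>i\<in>?V <+> K. b (Some i) *\<^sub>R trivial_field P \<theta> D i a"
    have "b None *\<^sub>R X a = - ?S"
      using b(1) a unfolding sum by (simp add: eq_neg_iff_add_eq_0)
    have "X a = (1 / b None) *\<^sub>R (b None *\<^sub>R X a)"
      using \<open>b None \<noteq> 0\<close> by simp
    also have "\<dots> = s *\<^sub>R ?S"
      unfolding \<open>b None *\<^sub>R X a = _\<close> by (simp add: s_def)
    finally show ?thesis
      using a fin by (simp add: trivial_field_sum A_sum scaleR_add_right scaleR_sum_right)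
  qed
  then show ?thesis by (rule that)
qed

lemma card_ge_if_motions_trivial:
  assumes fin: "finite F" "finite K"
    and triv: "\<And>X. (\<And>e. e \<in> F \<Longrightarrow> length_change P e X = 0) \<Longrightarrow>
      \<exists>b r. \<forall>a\<in>touched F. X a = A (- \<theta> a) (\<Sum>k\<in>K. b k *\<^sub>R D k) + r a *\<^sub>R P a"
  shows "2 * card (touched F) \<le> card F + card K"
proof -
  have "3 * card (touched F) \<le> card F + card (touched F <+> K)"
  proof (rule card_rows_add_card_spanning_ge)
    fix X assume "\<And>e. e \<in> F \<Longrightarrow> pairing (touched F) (length_row P e) X = 0"
    then have "length_change P e X = 0" if "e \<in> F" for e
      using that fin by (simp add: pairing_length_row ends_subset_touched)
    then obtain b r where
      "\<forall>a\<in>touched F. X a = A (- \<theta> a) (\<Sum>k\<in>K. b k *\<^sub>R D k) + r a *\<^sub>R P a"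
      using triv by blast
    then show "\<exists>b. \<forall>a\<in>touched F. X a = (\<Sum>i\<in>touched F <+> K. b i *\<^sub>R trivial_field P \<theta> D i a)"
      using fin by (intro exI[of _ "case_sum r b"]) (simp add: trivial_field_sum)
  qed (use fin in auto)
  then show ?thesis
    using fin by (simp add: card_Plus)
qed

lemma sum_axis: "(\<Sum>k\<in>(UNIV :: 3 set). b k *\<^sub>R axis k 1) = (\<chi> k. b k)"
proof -
  have "(\<Sum>k\<in>UNIV. b k * (if j = k then 1 else 0)) = b j" for j :: 3
    by (simp add: if_distrib cong: if_cong)
  then show ?thesis
    by (simp add: vec_eq_iff axis_def)
qed

text \<open>Every edge set has the motion with constant velocity \<open>z\<close>; a potential gives the three-dimensional
  space of motions \<open>A (- \<theta> a) C\<close>.\<close>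

theorem sparse_if_prescribable:
  assumes fin: "finite E" and presc: "prescribable P E" and nz: "\<And>a. P a \<noteq> 0"
  shows "sparse E"
  unfolding sparse_def
proof (intro allI impI conjI)
  fix F assume F: "F \<subseteq> E" "F \<noteq> {}"
  have fin: "finite F" and presc: "prescribable P F"
    using F fin presc finite_subset prescribable_subset by blast+
  show "card F + 1 \<le> 2 * card (touched F)"
  proof -
    have "card F + card {()} \<le> 2 * card (touched F)"
      by (rule card_le_if_prescribable[OF fin _ F(2) presc, where D = "\<lambda>_. z" and \<theta> = "\<lambda>_. 0"])
        (use nz axis_nz in \<open>auto simp: preserves_lengths_axis\<close>)
    then show ?thesis by simp
  qed
  assume "\<exists>\<theta>. potential F \<theta>"
  then obtain \<theta> where "potential F \<theta>" by blast
  then show "card F + 3 \<le> 2 * card (touched F)"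
  proof -
    assume "potential F \<theta>"
    then have "card F + card (UNIV :: 3 set) \<le> 2 * card (touched F)"
      by (intro card_le_if_prescribable[OF fin _ F(2) presc, where D = "\<lambda>k. axis k 1" and \<theta> = \<theta>])
        (use nz in \<open>auto simp: preserves_lengths_potential sum_axis vec_eq_iff\<close>)
    then show ?thesis by simp
  qed
qed

end

section \<open>Moving one vertex\<close>

lemma eventually_affine_nz:
  fixes \<alpha> \<beta> :: real
  assumes "\<alpha> \<noteq> 0 \<or> \<beta> \<noteq> 0"
  shows "\<forall>\<^sub>F t in at 0. \<alpha> + t * \<beta> \<noteq> 0"
proof (cases "\<alpha> = 0")
  case True
  have "\<forall>\<^sub>F t::real in at 0. t \<noteq> 0"
    by (simp add: eventually_at_filter)
  then show ?thesis
    using True assms by (auto elim: eventually_mono)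
next
  case False
  have "((\<lambda>t. \<alpha> + t * \<beta>) \<longlongrightarrow> \<alpha> + 0 * \<beta>) (at 0)"
    by (intro tendsto_intros)
  then show ?thesis
    using False tendsto_imp_eventually_ne by fastforce
qed

lemma tendsto_triple:
  assumes "(f \<longlongrightarrow> x) F" "(g \<longlongrightarrow> y) F" "(h \<longlongrightarrow> w) F"
  shows "((\<lambda>t. triple (f t) (g t) (h t)) \<longlongrightarrow> triple x y w) F"
  unfolding triple_component by (intro tendsto_intros assms)

lemma tendsto_add_multiple: "((\<lambda>t::real. x + t *\<^sub>R D) \<longlongrightarrow> (x :: real^3)) (at 0)"
proof -
  have "((\<lambda>t::real. x + t *\<^sub>R D) \<longlongrightarrow> x + 0 *\<^sub>R D) (at 0)"
    by (intro tendsto_intros)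
  then show ?thesis by simp
qed

lemma eventually_cone:
  assumes "x \<in> cone"
  shows "\<forall>\<^sub>F t in at 0. x + t *\<^sub>R D \<in> cone"
proof -
  have "((\<lambda>t. qform (x + t *\<^sub>R D)) \<longlongrightarrow> qform x) (at 0)"
    "((\<lambda>t. (x + t *\<^sub>R D) $ 3) \<longlongrightarrow> x $ 3) (at 0)"
    unfolding qform_def by (intro tendsto_intros tendsto_add_multiple)+
  then have "\<forall>\<^sub>F t in at 0. qform (x + t *\<^sub>R D) > 0" "\<forall>\<^sub>F t in at 0. (x + t *\<^sub>R D) $ 3 > 0"
    using assms by (auto simp: cone_def intro: order_tendstoD)
  then show ?thesis
    by eventually_elim (simp add: cone_def)
qed

lemma not_parallel_exists:
  assumes "Q \<noteq> 0"
  obtains E :: "real^3" where "cross3 Q E \<noteq> 0"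
  using cross_basis_nonzero[OF assms] by blast

context axial_action
begin

lemma exists_good:
  assumes N: "N \<noteq> 0"
  obtains x where "good x" "x \<bullet> N \<noteq> 0"
proof -
  obtain E where E: "cross3 z E \<noteq> 0"
    using not_parallel_exists[OF axis_nz] .
  define x0 :: "real^3" where "x0 = vector [1, 0, 1]"
  have x0: "x0 \<in> cone"
    by (simp add: x0_def cone_def qform_def)
  define D1 :: "real^3" where "D1 = vector [z$3, - z$2, z$1]"
  have "bform z D1 = (z$1)\<^sup>2 + (z$3)\<^sup>2 + 2 * (z$2)\<^sup>2"
    by (simp add: bform_def D1_def power2_eq_square)
  also have "\<dots> \<noteq> 0"
    using axis_nz by (auto simp: vec_eq_iff forall_3 add_nonneg_eq_0_iff)
  finally have D1: "bform z D1 \<noteq> 0" .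
  define D2 where "D2 = cross3 z E"
  have D2: "triple D2 z E \<noteq> 0"
    using E by (simp add: triple_def D2_def)
  have "\<forall>\<^sub>F t in at 0. bform z D1 + t * bform z D2 \<noteq> 0 \<and> triple D1 z E + t * triple D2 z E \<noteq> 0"
    using D1 D2 by (intro eventually_conj eventually_affine_nz) auto
  then obtain s where s: "bform z D1 + s * bform z D2 \<noteq> 0" "triple D1 z E + s * triple D2 z E \<noteq> 0"
    using eventually_happens'[OF at_neq_bot] by blast
  define D3 where "D3 = D1 + s *\<^sub>R D2"
  have D3: "bform z D3 \<noteq> 0" "triple D3 z E \<noteq> 0"
    using s by (simp_all add: D3_def)

  have "\<forall>\<^sub>F t in at 0. bform z D3 + t * bform z N \<noteq> 0 \<and> triple D3 z E + t * triple N z E \<noteq> 0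
      \<and> D3 \<bullet> N + t * (N \<bullet> N) \<noteq> 0"
    using D3 N by (intro eventually_conj eventually_affine_nz) auto
  then obtain r where r: "bform z D3 + r * bform z N \<noteq> 0" "triple D3 z E + r * triple N z E \<noteq> 0"
      "D3 \<bullet> N + r * (N \<bullet> N) \<noteq> 0"
    using eventually_happens'[OF at_neq_bot] by blast
  define D where "D = D3 + r *\<^sub>R N"
  have D: "bform z D \<noteq> 0" "triple D z E \<noteq> 0" "D \<bullet> N \<noteq> 0"
    using r by (simp_all add: D_def inner_add_left)
  have "\<forall>\<^sub>F t in at 0. x0 + t *\<^sub>R D \<in> cone \<and> bform z x0 + t * bform z D \<noteq> 0
      \<and> triple x0 z E + t * triple D z E \<noteq> 0 \<and> x0 \<bullet> N + t * (D \<bullet> N) \<noteq> 0"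
    using D x0 by (intro eventually_conj eventually_affine_nz eventually_cone) auto
  then obtain t where t: "x0 + t *\<^sub>R D \<in> cone" "bform z x0 + t * bform z D \<noteq> 0"
      "triple x0 z E + t * triple D z E \<noteq> 0" "x0 \<bullet> N + t * (D \<bullet> N) \<noteq> 0"
    using eventually_happens'[OF at_neq_bot] by blast
  have "triple (x0 + t *\<^sub>R D) z E \<noteq> 0"
    using t by simp
  then have "cross3 (x0 + t *\<^sub>R D) z \<noteq> 0"
    by (rule cross3_nz_if_triple)
  then show ?thesis
    using that[of "x0 + t *\<^sub>R D"] t by (simp add: good_def inner_add_left)
qed

lemma eventually_good:
  assumes "good x"
  shows "\<forall>\<^sub>F t in at 0. good (x + t *\<^sub>R D)"
proof -
  have xz: "cross3 x z \<noteq> 0"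
    using assms by (simp add: good_def)
  define E where "E = cross3 x z"

  have E: "triple E x z \<noteq> 0"
    using xz by (simp add: triple_def E_def)
  have "\<forall>\<^sub>F t in at 0. x + t *\<^sub>R D \<in> cone \<and> bform z x + t * bform z D \<noteq> 0
      \<and> triple E x z + t * triple E D z \<noteq> 0"
    using assms E by (intro eventually_conj eventually_affine_nz eventually_cone)
      (auto simp: good_def)
  then show ?thesis
  proof eventually_elim
    case (elim t)
    then have "triple E (x + t *\<^sub>R D) z \<noteq> 0" by simp
    then have "cross3 (x + t *\<^sub>R D) z \<noteq> 0"
      by (rule cross3_nz_if_triple)
    then show ?case
      using elim by (simp add: good_def)
  qed
qed

text \<open>Independence at \<open>P\<close> gives motions dual to the edges; for nearby positions the matrix of the
  edges against these motions stays close to the identity.\<close>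

lemma eventually_prescribable:
  assumes fin: "finite E" and presc: "prescribable P E"
  shows "\<forall>\<^sub>F t in at 0. prescribable (P(a := P a + t *\<^sub>R D)) E"
proof -
  obtain Y where Y:
    "\<And>e f. e \<in> E \<Longrightarrow> f \<in> E \<Longrightarrow> length_change P e (Y f) = (if e = f then 1 else 0)"
    using dual_motions[OF fin] presc prescribable_iff_independent_at[OF fin] by blast
  let ?P = "\<lambda>t. P(a := P a + t *\<^sub>R D)"
  have P: "((\<lambda>t. ?P t x) \<longlongrightarrow> P x) (at 0)" for x
    by (cases "x = a") (auto simp: tendsto_add_multiple)
  have A: "((\<lambda>t. A n (f t)) \<longlongrightarrow> A n y) (at 0)" if "(f \<longlongrightarrow> y) (at 0)" for n f and y :: "real^3"
    using that linear_A linear_conv_bounded_linear bounded_linear.tendsto by blast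
  have "((\<lambda>t. length_change (?P t) e (Y f)) \<longlongrightarrow> length_change P e (Y f)) (at 0)" for e f
  proof (cases e)
    case (fields u n w)
    show ?thesis
      unfolding fields length_change_simp by (intro tendsto_triple tendsto_const A P)
  qed
  then have "\<forall>\<^sub>F t in at 0. dist (length_change (?P t) e (Y f)) (length_change P e (Y f))
      < 1 / (card E + 1)" for e f
    by (rule tendstoD) simp
  then have "\<forall>\<^sub>F t in at 0. \<forall>e\<in>E. \<forall>f\<in>E.
      dist (length_change (?P t) e (Y f)) (length_change P e (Y f)) < 1 / (card E + 1)"
    using fin by (intro eventually_ball_finite ballI) auto
  then show ?thesis
  proof eventually_elim
    case (elim t)
    have "independent_at (?P t) E"
      unfolding independent_at_def
    proof (intro allI impI)
      fix c assume *: "\<forall>X. (\<Sum>e\<in>E. c e * length_change (?P t) e X) = 0"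
      show "\<forall>e\<in>E. c e = 0"
        by (rule diagonally_dominant_independent[OF fin,
              where M = "\<lambda>e f. length_change (?P t) e (Y f)"])
          (use elim Y * in \<open>auto simp: dist_real_def\<close>)
    qed
    then show ?case
      using prescribable_iff_independent_at[OF fin] by blast
  qed
qed

text \<open>Moving \<open>P a\<close> in the direction of the normal vector, transported by \<open>A (- n)\<close>, changes the pairing
  with the normal at a nonzero rate.\<close>

lemma move_vertex_off_plane:
  assumes fin: "finite E" and presc: "prescribable P E" and good: "\<And>x. good (P x)" and N: "N \<noteq> 0"
  obtains p where "good p" "prescribable (P(a := p)) E" "A n p \<bullet> N \<noteq> 0"
proof -
  define D where "D = A (- n) N"
  have "\<forall>\<^sub>F t in at 0. good (P a + t *\<^sub>R D) \<and> prescribable (P(a := P a + t *\<^sub>R D)) E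
      \<and> A n (P a) \<bullet> N + t * (N \<bullet> N) \<noteq> 0"
    using N by (intro eventually_conj eventually_affine_nz eventually_good good
        eventually_prescribable fin presc) auto
  then obtain t where "good (P a + t *\<^sub>R D)" "prescribable (P(a := P a + t *\<^sub>R D)) E"
      "A n (P a) \<bullet> N + t * (N \<bullet> N) \<noteq> 0"
    using eventually_happens'[OF at_neq_bot] by blast
  then show ?thesis
    using that[of "P a + t *\<^sub>R D"] by (simp add: D_def inner_add_left)
qed

lemma move_vertex_off_line:
  assumes fin: "finite E" and presc: "prescribable P E" and good: "\<And>x. good (P x)" and Q: "Q \<noteq> 0"
  obtains p where "good p" "prescribable (P(a := p)) E" "cross3 (A n p) Q \<noteq> 0"
proof -
  obtain S where "cross3 Q S \<noteq> 0"
    using not_parallel_exists[OF Q] .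
  then obtain p where p: "good p" "prescribable (P(a := p)) E" "A n p \<bullet> cross3 Q S \<noteq> 0"
    using move_vertex_off_plane[OF fin presc good] by blast
  then have "triple (A n p) Q S \<noteq> 0"
    by (simp add: triple_def)
  then show ?thesis
    using that p cross3_nz_if_triple by blast
qed

section \<open>The star of a vertex\<close>

definition star :: "'v \<Rightarrow> 'v gain_edge set \<Rightarrow> 'v gain_edge set" where
  "star v E = {e\<in>E. v \<in> ends e}"

definition far :: "'v \<Rightarrow> 'v gain_edge \<Rightarrow> 'v" where
  "far v e = (case e of (u, n, w) \<Rightarrow> if u = v then w else u)"

definition shift :: "'v \<Rightarrow> 'v gain_edge \<Rightarrow> int" where
  "shift v e = (case e of (u, n, w) \<Rightarrow> if u = v then n else - n)"

lemma ends_far: "v \<in> ends e \<Longrightarrow> ends e = {v, far v e}"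
  by (cases e) (auto simp: far_def)

lemma length_change_star:
  "v \<in> ends e \<Longrightarrow> length_change P e X = length_change P (v, shift v e, far v e) X"
proof (cases e)
  case (fields u n w)
  assume "v \<in> ends e"
  then have "v = u \<or> w = v \<and> u \<noteq> v" using fields by auto
  then show ?thesis
    using length_change_reverse[of P u n w X] unfolding fields far_def shift_def by auto
qed

lemma A_uminus_eq: "A m = A n \<longleftrightarrow> A (- m) = A (- n)"
proof -
  have "A (- m) = A (- n)" if "A m = A n" for m n
  proof
    fix x
    have "A (- m) (A m (A (- n) x)) = A (- m) (A n (A (- n) x))"
      by (simp only: that)
    then show "A (- m) x = A (- n) x" by simp
  qed
  from this[of m n] this[of "- m" "- n"] show ?thesis
    unfolding minus_minus by blast
qed

lemma potential_insert: "potential (insert e F) \<theta> \<longleftrightarrow> potential {e} \<theta> \<and> potential F \<theta>"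
  unfolding potential_def by simp

lemma potential_Un: "potential (E \<union> F) \<theta> \<longleftrightarrow> potential E \<theta> \<and> potential F \<theta>"
  unfolding potential_def ball_Un ..

lemma potential_subset: "potential F \<theta> \<Longrightarrow> F' \<subseteq> F \<Longrightarrow> potential F' \<theta>"
  unfolding potential_def by blast

lemma potential_star:
  assumes "v \<in> ends e"
  shows "potential {e} \<theta> \<longleftrightarrow> A (shift v e) = A (\<theta> (far v e) - \<theta> v)"
proof (cases e)
  case (fields u n w)
  then show ?thesis
    using assms A_uminus_eq[of n "\<theta> v - \<theta> u"]
    by (auto simp: potential_def far_def shift_def)
qed

text \<open>Relative to \<open>v\<close>, an edge is anchored at the image of its far end; a loop acts like an edge
  to the axis.\<close>

definition anchor :: "'v \<Rightarrow> ('v \<Rightarrow> real^3) \<Rightarrow> 'v gain_edge \<Rightarrow> real^3" where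
  "anchor v P e = (if far v e = v then z else A (shift v e) (P (far v e)))"

definition anchor_motion :: "'v \<Rightarrow> ('v \<Rightarrow> real^3) \<Rightarrow> 'v gain_edge \<Rightarrow> real^3" where
  "anchor_motion v X e = (if far v e = v then 0 else A (shift v e) (X (far v e)))"

lemma anchor_upd [simp]: "anchor v (P(v := p)) e = anchor v P e"
  by (simp add: anchor_def)

lemma anchor_motion_upd [simp]: "anchor_motion v (X(v := x)) e = anchor_motion v X e"
  by (simp add: anchor_motion_def)

lemma anchor_nz: "(\<And>x. good (P x)) \<Longrightarrow> anchor v P e \<noteq> 0"
  by (simp add: anchor_def axis_nz good_nz)

text \<open>Both terms of the length change of a loop are brought to the velocity \<open>X v\<close>; the loop identity then
  leaves only the component along \<open>z\<close>.\<close>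

lemma length_change_loop:
  "length_change P (v, n, v) X = \<kappa> n * bform z (P v) * triple (X v) (P v) z"
proof -
  have "length_change P (v, n, v) X
      = triple (X v) (P v) (A n (P v)) - triple (X v) (A (- n) (P v)) (P v)"
    by (simp add: triple_A_move)
  also have "\<dots> = triple (X v) (P v) (A n (P v) + A (- n) (P v))"
    using triple_swap'[of "X v" "A (- n) (P v)" "P v"] by simp
  finally show ?thesis
    unfolding loop_identity by simp
qed

lemma length_change_anchor:
  assumes v: "v \<in> ends e" and good: "good (P v)" and loop: "far v e = v \<Longrightarrow> A (shift v e) \<noteq> id"
  obtains k where "k \<noteq> 0"
    "\<And>X. length_change P e X = k * triple (X v - anchor_motion v X e) (P v) (anchor v P e)"
proof (cases "far v e = v")
  case True
  have "length_change P e X = (\<kappa> (shift v e) * bform z (P v)) * triple (X v) (P v) z" for X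
    unfolding length_change_star[OF v] True by (rule length_change_loop)
  then show ?thesis
    using that[of "\<kappa> (shift v e) * bform z (P v)"] True good \<kappa>_nz[OF loop]
    by (simp add: anchor_def anchor_motion_def good_def)
next
  case False
  then show ?thesis
    using that[of 1] by (simp add: length_change_star[OF v] anchor_def anchor_motion_def)
qed

lemma sparse_loop:
  assumes "sparse E" "e \<in> star v E" "far v e = v"
  shows "A (shift v e) \<noteq> id"
proof
  assume id: "A (shift v e) = id"
  have e: "e \<in> E" "v \<in> ends e"
    using assms(2) by (simp_all add: star_def)
  have ends: "ends e = {v}"
    using ends_far[OF e(2)] assms(3) by simp
  have "A 0 = id" by auto
  then have "potential {e} (\<lambda>_. 0)"
    unfolding potential_star[OF e(2)] using id by simp
  then show False
    using sparseD_potential[OF assms(1), of "{e}"] e(1) ends by simp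
qed

text \<open>Two loops at one vertex violate the bound for all edge sets, two parallel edges with the same gain
  the bound for edge sets with a potential.\<close>

lemma sparse_parallel:
  assumes "sparse E" "e \<in> star v E" "f \<in> star v E" "e \<noteq> f" "far v e = far v f"
  shows "far v e \<noteq> v" "A (shift v e) \<noteq> A (shift v f)"
proof -
  have ef: "{e, f} \<subseteq> E" "v \<in> ends e" "v \<in> ends f"
    using assms by (auto simp: star_def)
  have touched: "touched {e, f} = {v, far v e}"
    using ends_far[OF ef(2)] ends_far[OF ef(3)] assms(5) by simp
  show nv: "far v e \<noteq> v"
    using sparseD[OF assms(1) ef(1)] assms(4) unfolding touched by auto
  show "A (shift v e) \<noteq> A (shift v f)"
  proof
    assume eq: "A (shift v e) = A (shift v f)"
    let ?\<theta> = "\<lambda>x. if x = v then 0 else shift v e"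
    have "potential {e} ?\<theta>" "potential {f} ?\<theta>"
      unfolding potential_star[OF ef(2)] potential_star[OF ef(3)]
      using nv nv[unfolded assms(5)] eq[symmetric] by simp_all
    then have "potential {e, f} ?\<theta>"
      by (subst potential_insert) simp
    then show False
      using sparseD_potential[OF assms(1) ef(1)] assms(4) nv unfolding touched by auto
  qed
qed

section \<open>Adding a vertex\<close>

lemma finite_star [simp]: "finite E \<Longrightarrow> finite (star v E)"
  by (simp add: star_def)

lemma not_touched_diff_star: "v \<notin> touched (E - star v E)"
  by (auto simp: touched_def star_def)

lemma touched_diff_star: "touched (E - star v E) \<subseteq> touched E - {v}"
  using not_touched_diff_star[of v E] touched_mono[of "E - star v E" E] by blast

lemma far_touched: "e \<in> star v E \<Longrightarrow> far v e \<in> touched E"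
  using ends_far[of v e] ends_subset_touched[of e E] by (simp add: star_def)

text \<open>The edges away from \<open>v\<close> do not see the new position \<open>p\<close>, and the factors by which
  the edges at \<open>v\<close> differ from their anchored form can be absorbed in the prescribed values.\<close>

lemma prescribable_extend:
  assumes sparse: "sparse E" and p: "good p"
    and solve: "\<And>b. \<exists>X x. (\<forall>e\<in>E - star v E. length_change P e X = b e) \<and>
      (\<forall>e\<in>star v E. triple (x - anchor_motion v X e) p (anchor v P e) = b e)"
  shows "prescribable (P(v := p)) E"
  unfolding prescribable_def
proof
  fix b
  let ?P = "P(v := p)"
  have "\<exists>k. k \<noteq> 0 \<and> (\<forall>X. length_change ?P e X
      = k * triple (X v - anchor_motion v X e) p (anchor v P e))" if "e \<in> star v E" for e
  proof -
    have v: "v \<in> ends e"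
      using that by (simp add: star_def)
    have gp: "good (?P v)"
      using p by simp
    show ?thesis
      by (rule length_change_anchor[of v e ?P, OF v gp sparse_loop[OF sparse that]]) auto
  qed
  then obtain k where k: "\<And>e. e \<in> star v E \<Longrightarrow> k e \<noteq> 0"
    "\<And>e X. e \<in> star v E \<Longrightarrow>
      length_change ?P e X = k e * triple (X v - anchor_motion v X e) p (anchor v P e)"
    by metis
  obtain X x where X: "\<And>e. e \<in> E - star v E \<Longrightarrow> length_change P e X = b e"
    "\<And>e. e \<in> star v E \<Longrightarrow> triple (x - anchor_motion v X e) p (anchor v P e) = b e / k e"
    using solve[of "\<lambda>e. if e \<in> star v E then b e / k e else b e"] by auto
  show "\<exists>X. \<forall>e\<in>E. length_change ?P e X = b e"
  proof (intro exI[of _ "X(v := x)"] ballI)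
    fix e assume e: "e \<in> E"
    show "length_change ?P e (X(v := x)) = b e"
    proof (cases "e \<in> star v E")
      case True
      then show ?thesis
        using k X(2) by simp
    next
      case False
      then have "v \<notin> ends e"
        using e by (simp add: star_def)
      then have "length_change ?P e (X(v := x)) = length_change P e X"
        by (intro length_change_cong) auto
      then show ?thesis
        using X(1) e False by simp
    qed
  qed
qed

text \<open>Off the plane of the two anchors, the edges at \<open>v\<close> impose independent conditions on the
  velocity of \<open>v\<close>, whatever the velocities of the other vertices are.\<close>

lemma prescribable_add_vertex_two_edges:
  assumes sparse: "sparse E" and presc: "prescribable P (E - star v E)"
    and star: "star v E \<subseteq> {e1, e2}"
    and anchors: "anchor v P e1 = Q1" "e1 \<noteq> e2 \<Longrightarrow> anchor v P e2 = Q2"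
    and Q: "cross3 Q1 Q2 \<noteq> 0"
  obtains p where "good p" "prescribable (P(v := p)) E"
proof -
  obtain p where p: "good p" "p \<bullet> cross3 Q1 Q2 \<noteq> 0"
    using exists_good[OF Q] .
  have nz: "triple p Q1 Q2 \<noteq> 0"
    using p by (simp add: triple_def)
  have "prescribable (P(v := p)) E"
  proof (rule prescribable_extend[OF sparse p(1)])
    fix b
    obtain X where X: "\<forall>e\<in>E - star v E. length_change P e X = b e"
      using presc by (auto simp: prescribable_def)
    obtain x where x: "triple x p Q1 = b e1 + triple (anchor_motion v X e1) p Q1"
      "triple x p Q2 = b e2 + triple (anchor_motion v X e2) p Q2"
      using prescribe_two_triples[OF nz] .
    show "\<exists>X x. (\<forall>e\<in>E - star v E. length_change P e X = b e) \<and>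
      (\<forall>e\<in>star v E. triple (x - anchor_motion v X e) p (anchor v P e) = b e)"
    proof (intro exI conjI ballI)
      fix e assume "e \<in> star v E"
      then have "e = e1 \<or> e1 \<noteq> e2 \<and> e = e2"
        using star by auto
      then show "triple (x - anchor_motion v X e) p (anchor v P e) = b e"
        using x anchors by auto
    qed (use X in auto)
  qed
  with p that show ?thesis by blast
qed

text \<open>The edge that replaces the path through \<open>v\<close> formed by \<open>e1\<close> and \<open>e2\<close>. When \<open>e2\<close> is a loop at
  \<open>v\<close>, any nontrivial loop does, because all of them give the same length condition up to a
  factor.\<close>

definition bridge :: "'v \<Rightarrow> 'v gain_edge \<Rightarrow> 'v gain_edge \<Rightarrow> 'v gain_edge" where
  "bridge v e1 e2 =
     (if far v e2 = v then (far v e1, 1, far v e1)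
      else (far v e1, shift v e2 - shift v e1, far v e2))"

lemma ends_bridge: "ends (bridge v e1 e2) = {far v e1} \<union> ({far v e2} - {v})" if "far v e1 \<noteq> v"
  using that by (auto simp: bridge_def)

lemma length_change_bridge:
  assumes e1: "far v e1 \<noteq> v" and good: "\<And>x. good (P x)"
  obtains \<mu> where "\<mu> \<noteq> 0" "\<And>X. length_change P (bridge v e1 e2) X
    = \<mu> * triple (anchor_motion v X e1 - anchor_motion v X e2) (anchor v P e1) (anchor v P e2)"
proof (cases "far v e2 = v")
  case True
  let ?a = "far v e1" and ?n = "shift v e1"
  have "length_change P (bridge v e1 e2) X = (\<kappa> 1 * bform z (P ?a)) *
      triple (anchor_motion v X e1 - anchor_motion v X e2) (anchor v P e1) (anchor v P e2)" for X
  proof -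
    have "triple (X ?a) (P ?a) z = triple (A ?n (X ?a)) (A ?n (P ?a)) (A ?n z)"
      by (rule triple_A[symmetric])
    then show ?thesis
      using True e1 length_change_loop[of P ?a 1 X]
      by (simp add: bridge_def anchor_def anchor_motion_def del: length_change_simp)
  qed
  then show ?thesis
    using that[of "\<kappa> 1 * bform z (P ?a)"] good[of ?a] \<kappa>_nz[OF A_1] by (simp add: good_def)
next
  case False
  let ?a = "far v e1" and ?n = "shift v e1" and ?c = "far v e2" and ?k = "shift v e2"
  have move: "A ?n (A (?k - ?n) x) = A ?k x" for x
    by (simp flip: A_add)
  have "length_change P (bridge v e1 e2) X = 1 *
      triple (anchor_motion v X e1 - anchor_motion v X e2) (anchor v P e1) (anchor v P e2)" for X
  proof -
    have "length_change P (bridge v e1 e2) X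
        = triple (A ?n (X ?a - A (?k - ?n) (X ?c))) (A ?n (P ?a)) (A ?n (A (?k - ?n) (P ?c)))"
      using False by (simp only: bridge_def if_False length_change_simp triple_A)
    then show ?thesis
      using False e1 by (simp add: anchor_def anchor_motion_def move)
  qed
  then show ?thesis
    using that[of 1] by simp
qed

text \<open>With \<open>v\<close> on the line through the anchors of \<open>e1\<close> and \<open>e2\<close>, prescribing the lengths of both
  edges amounts to prescribing the length of the bridge and one condition on the velocity of
  \<open>v\<close>.\<close>

lemma prescribable_replace_bridge:
  assumes sparse: "sparse E" and good: "\<And>x. good (P x)"
    and star: "star v E = {e1, e2, e3}" and e1: "far v e1 \<noteq> v"
    and new: "bridge v e1 e2 \<notin> E - star v E"
    and presc: "prescribable P (insert (bridge v e1 e2) (E - star v E))"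
    and indep: "triple (anchor v P e1) (anchor v P e2) (anchor v P e3) \<noteq> 0"
  obtains p where "good p" "prescribable (P(v := p)) E"
proof -
  define Q1 Q2 Q3 where Q: "Q1 = anchor v P e1" "Q2 = anchor v P e2" "Q3 = anchor v P e3"
  have "good Q1"
    using e1 good by (simp add: Q anchor_def)
  \<comment> \<open>For small \<open>t\<close> the vector stays good even when \<open>Q2\<close> is the axis.\<close>
  then have "\<forall>\<^sub>F t in at 0. good (Q1 + t *\<^sub>R Q2) \<and> 0 + t * 1 \<noteq> 0"
    by (intro eventually_conj eventually_good eventually_affine_nz) auto
  then obtain t where t: "good (Q1 + t *\<^sub>R Q2)" "t \<noteq> 0"
    using eventually_happens'[OF at_neq_bot] by auto
  define p where "p = Q1 + t *\<^sub>R Q2"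
  have "triple p Q1 Q3 = - t * triple Q1 Q2 Q3"
    using triple_swap[of Q2 Q1 Q3] by (simp add: p_def)
  then have nz: "triple p Q1 Q3 \<noteq> 0"
    using t indep by (simp add: Q)
  obtain \<mu> where \<mu>: "\<mu> \<noteq> 0" "\<And>X. length_change P (bridge v e1 e2) X
      = \<mu> * triple (anchor_motion v X e1 - anchor_motion v X e2) Q1 Q2"
    by (rule length_change_bridge[where P = P and v = v and ?e2.0 = e2, OF e1 good, folded Q],
        rule that)
  have "prescribable (P(v := p)) E"
  proof (rule prescribable_extend[OF sparse])
    show "good p" using t by (simp add: p_def)
    fix b
    define b' where
      "b' e = (if e = bridge v e1 e2 then \<mu> * (b e2 + b e1 / t) else b e)" for e
    obtain X where X: "\<forall>e\<in>insert (bridge v e1 e2) (E - star v E). length_change P e X = b' e"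
      using presc by (auto simp: prescribable_def)
    define Y where "Y e = anchor_motion v X e" for e
    have "length_change P (bridge v e1 e2) X = \<mu> * (b e2 + b e1 / t)"
      using X by (simp add: b'_def)
    then have br: "triple (Y e1) Q1 Q2 - triple (Y e2) Q1 Q2 = b e2 + b e1 / t"
      using \<mu> by (simp add: Y_def)
    obtain x where x: "triple x p Q1 = b e1 + triple (Y e1) p Q1"
      "triple x p Q3 = b e3 + triple (Y e3) p Q3"
      using prescribe_two_triples[OF nz] .
    have one: "t * (triple x Q1 Q2 - triple (Y e1) Q1 Q2) = - b e1"
      using x(1) triple_swap'[of x Q2 Q1] triple_swap'[of "Y e1" Q2 Q1]
      by (simp add: p_def algebra_simps)
    then have "triple x Q1 Q2 - triple (Y e1) Q1 Q2 = - b e1 / t"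
      using t(2) by (simp add: field_simps)
    then have two: "triple (x - Y e2) p Q2 = b e2"
      using br by (simp add: p_def)
    have old: "\<forall>e\<in>E - star v E. length_change P e X = b e"
      using X new by (auto simp: b'_def)
    show "\<exists>X x. (\<forall>e\<in>E - star v E. length_change P e X = b e) \<and>
        (\<forall>e\<in>star v E. triple (x - anchor_motion v X e) p (anchor v P e) = b e)"
      by (intro exI[of _ X] exI[of _ x]) (use old x two in \<open>simp add: star Y_def Q\<close>)
  qed
  then show ?thesis
    using that t by (simp add: p_def)
qed

text \<open>If the rotation by \<open>\<pi>\<close> relates two edges from \<open>v\<close> to \<open>a\<close>, then a loop at \<open>v\<close> and these edges
  have dependent anchors. Instead the parallelogram law turns them into a loop at \<open>a\<close>.\<close>

lemma prescribable_half_turn: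
  assumes sparse: "sparse E" and good: "\<And>x. good (P x)"
    and star: "star v E = {e1, e2, e3}"
    and far: "far v e1 = a" "far v e2 = a" "far v e3 = v" "a \<noteq> v"
    and c: "c \<noteq> 0" "\<And>y. A (shift v e2 - shift v e1) y = - y + (c * bform z y) *\<^sub>R z"
    and new: "(a, 1, a) \<notin> E - star v E"
    and presc: "prescribable P (insert (a, 1, a) (E - star v E))"
  obtains p where "good p" "prescribable (P(v := p)) E"
proof -
  let ?n = "shift v e1" and ?k = "shift v e2"
  define m where "m = ?k - ?n"
  define Q1 Q2 where Q: "Q1 = A ?n (P a)" "Q2 = A ?k (P a)"
  have k: "A ?k y = A ?n (A m y)" for y
    by (simp add: m_def flip: A_add)
  have anchors: "anchor v P e1 = Q1" "anchor v P e2 = Q2" "anchor v P e3 = z"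
    using far by (simp_all add: anchor_def Q)
  have Q2: "Q2 = - Q1 + (c * bform z (P a)) *\<^sub>R z"
    unfolding Q k by (simp add: m_def c(2))
  have "cross3 Q1 z \<noteq> 0"
    using good[of a] unfolding Q cross3_A_axis by (simp add: good_def)
  then obtain p where p: "good p" "p \<bullet> cross3 Q1 z \<noteq> 0"
    using exists_good by blast
  then have nz: "triple p Q1 z \<noteq> 0"
    by (simp add: triple_def)
  have inv: "A (- m) y = - y + (c * bform z y) *\<^sub>R z" for y
  proof -
    have "A m (- y + (c * bform z y) *\<^sub>R z) = y"
      unfolding A_linear A_axis by (simp add: m_def c(2))
    then have "A (- m) (A m (- y + (c * bform z y) *\<^sub>R z)) = A (- m) y" by simp
    then show ?thesis by (simp only: A_cancel)
  qed
  have "A (- ?n) p + A (- ?k) p = A (- ?n) (p + A (- m) p)"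
  proof -
    have "A (- ?k) p = A (- ?n) (A (- m) p)"
      by (simp add: m_def flip: A_add)
    then show ?thesis by simp
  qed
  also have "\<dots> = (c * bform z p) *\<^sub>R z"
    unfolding inv by simp
  finally have sum: "A (- ?n) p + A (- ?k) p = (c * bform z p) *\<^sub>R z" .
  have lp: "c * bform z p \<noteq> 0" and la: "\<kappa> 1 * bform z (P a) \<noteq> 0"
    using p c(1) good[of a] \<kappa>_nz[OF A_1] by (simp_all add: good_def)
  have "prescribable (P(v := p)) E"
  proof (rule prescribable_extend[OF sparse p(1)])
    fix b
    define T where "T = (- b e1 - b e2 + c * bform z (P a) * b e3) / (c * bform z p)"
    define b' where
      "b' e = (if e = (a, 1, a) then - (\<kappa> 1 * bform z (P a)) * T else b e)" for e
    obtain X where X: "\<forall>e\<in>insert (a, 1, a) (E - star v E). length_change P e X = b' e"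
      using presc by (auto simp: prescribable_def)
    have "length_change P (a, 1, a) X = - (\<kappa> 1 * bform z (P a)) * T"
      using X by (simp add: b'_def del: length_change_simp)
    then have T: "triple (X a) z (P a) = T"
      using la triple_swap'[of "X a" "P a" z] by (simp only: length_change_loop) simp
    have "triple (A ?n (X a)) p Q1 + triple (A ?k (X a)) p Q2
        = triple (X a) (A (- ?n) p + A (- ?k) p) (P a)"
      by (simp add: Q triple_A_move)
    also have "\<dots> = - b e1 - b e2 + c * bform z (P a) * b e3"
      unfolding sum using lp by (simp add: T T_def)
    finally have law: "triple (A ?n (X a)) p Q1 + triple (A ?k (X a)) p Q2
        = - b e1 - b e2 + c * bform z (P a) * b e3" .
    obtain x where x: "triple x p Q1 = b e1 + triple (A ?n (X a)) p Q1" "triple x p z = b e3"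
      using prescribe_two_triples[OF nz] .
    have "triple x p Q2 = - triple x p Q1 + c * bform z (P a) * b e3"
      unfolding Q2 by (simp add: x(2))
    then have two: "triple x p Q2 = b e2 + triple (A ?k (X a)) p Q2"
      using law x(1) by simp
    have old: "\<forall>e\<in>E - star v E. length_change P e X = b e"
      using X new by (auto simp: b'_def simp del: length_change_simp)
    have motion: "anchor_motion v X e1 = A ?n (X a)" "anchor_motion v X e2 = A ?k (X a)"
      "anchor_motion v X e3 = 0"
      using far by (simp_all add: anchor_motion_def)
    show "\<exists>X x. (\<forall>e\<in>E - star v E. length_change P e X = b e) \<and>
        (\<forall>e\<in>star v E. triple (x - anchor_motion v X e) p (anchor v P e) = b e)"
      by (intro exI[of _ X] exI[of _ x] conjI old)
        (use x two in \<open>simp add: star motion anchors\<close>)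
  qed
  then show ?thesis
    using that p by blast
qed

section \<open>General position of anchors\<close>

lemma cross3_orbit: "good x \<Longrightarrow> A m \<noteq> A n \<Longrightarrow> cross3 (A m x) (A n x) \<noteq> 0"
proof -
  assume x: "good x" and "A m \<noteq> A n"
  then have "A (n - m) \<noteq> id"
    using A_eq_A_iff by blast
  from good_not_eigenvector[OF x this] have "cross3 (A m x) (A m (A (n - m) x)) \<noteq> 0"
    by (simp add: cross3_A_eq_0_iff)
  then show ?thesis
    by (simp flip: A_add)
qed

lemma cross3_nz_commute: "cross3 x y \<noteq> 0 \<longleftrightarrow> cross3 y x \<noteq> 0"
  using cross_skew[of x y] neg_equal_0_iff_equal[of "cross3 y x"] by argo

lemma move_to_two_anchors:
  assumes fin: "finite E'" and presc: "prescribable P E'" and good: "\<And>x. good (P x)"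
    and sparse: "sparse E" and e: "e1 \<in> star v E" "e2 \<in> star v E" "e1 \<noteq> e2"
  obtains P' where "\<And>x. good (P' x)" "prescribable P' E'"
    "cross3 (anchor v P' e1) (anchor v P' e2) \<noteq> 0"
proof (cases "far v e1 = far v e2")
  case True
  note par = sparse_parallel[OF sparse e True]
  have "cross3 (anchor v P e1) (anchor v P e2) \<noteq> 0"
    using par True cross3_orbit[OF good par(2)] by (simp add: anchor_def)
  then show ?thesis using that good presc by blast
next
  case False
  show ?thesis
  proof (cases "far v e1 = v \<or> far v e2 = v")
    case True
    have "cross3 (A n (P x)) z \<noteq> 0" for n x
      using good[of x] by (simp add: cross3_A_axis good_def)
    then have "cross3 (anchor v P e1) (anchor v P e2) \<noteq> 0"
      using True False cross3_nz_commute by (auto simp: anchor_def)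
    then show ?thesis using that good presc by blast
  next
    case nonloop: False
    obtain p where p: "good p" "prescribable (P(far v e1 := p)) E'"
      "cross3 (A (shift v e1) p) (anchor v P e2) \<noteq> 0"
      using move_vertex_off_line[OF fin presc good anchor_nz[OF good]] .
    show ?thesis
    proof (rule that)
      show "good ((P(far v e1 := p)) x)" for x using p good by simp
      show "prescribable (P(far v e1 := p)) E'" by (rule p)
      show "cross3 (anchor v (P(far v e1 := p)) e1) (anchor v (P(far v e1 := p)) e2) \<noteq> 0"
        using p(3) nonloop False by (simp add: anchor_def)
    qed
  qed
qed

lemma move_one_anchor:
  assumes fin: "finite E'" and presc: "prescribable P E'" and good: "\<And>x. good (P x)"
    and far: "far v e1 \<noteq> v" "far v e1 \<noteq> far v e2" "far v e1 \<noteq> far v e3"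
    and nonpar: "cross3 (anchor v P e2) (anchor v P e3) \<noteq> 0"
  obtains P' where "\<And>x. good (P' x)" "prescribable P' E'"
    "triple (anchor v P' e1) (anchor v P' e2) (anchor v P' e3) \<noteq> 0"
proof -
  obtain p where p: "good p" "prescribable (P(far v e1 := p)) E'"
    "A (shift v e1) p \<bullet> cross3 (anchor v P e2) (anchor v P e3) \<noteq> 0"
    using move_vertex_off_plane[OF fin presc good nonpar] .
  show ?thesis
  proof (rule that)
    show "good ((P(far v e1 := p)) x)" for x using p good by simp
    show "prescribable (P(far v e1 := p)) E'" by (rule p)
    have "anchor v (P(far v e1 := p)) e2 = anchor v P e2"
      "anchor v (P(far v e1 := p)) e3 = anchor v P e3"
      using far by (simp_all add: anchor_def)
    then show "triple (anchor v (P(far v e1 := p)) e1) (anchor v (P(far v e1 := p)) e2)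
        (anchor v (P(far v e1 := p)) e3) \<noteq> 0"
      using p(3) far by (simp add: triple_def) (simp add: anchor_def)
  qed
qed

text \<open>Anchors over the same far end are in general position automatically, because they are different
  points of one orbit; otherwise some far end carries a single anchor and can be moved. The only
  exception is a loop together with two edges to the same vertex.\<close>

lemma move_to_three_anchors:
  assumes fin: "finite E'" and presc: "prescribable P E'" and good: "\<And>x. good (P x)"
    and sparse: "sparse E" and e: "e1 \<in> star v E" "e2 \<in> star v E" "e3 \<in> star v E"
    and dist: "e1 \<noteq> e2" "e1 \<noteq> e3" "e2 \<noteq> e3"
    and nonloop: "far v e1 \<noteq> v" "far v e2 \<noteq> v"
    and not_half_turn: "\<And>x. far v e3 = v \<Longrightarrow> far v e1 = far v e2 \<Longrightarrow> good x \<Longrightarrow>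
      triple (A (shift v e1) x) (A (shift v e2) x) z \<noteq> 0"
  obtains P' where "\<And>x. good (P' x)" "prescribable P' E'"
    "triple (anchor v P' e1) (anchor v P' e2) (anchor v P' e3) \<noteq> 0"
proof (cases "far v e1 = far v e2")
  case eq12: True
  note par12 = sparse_parallel(2)[OF sparse e(1,2) dist(1) eq12]
  show ?thesis
  proof (cases "far v e3 = far v e2")
    case True
    have "A (shift v e1) \<noteq> A (shift v e3)" "A (shift v e2) \<noteq> A (shift v e3)"
      using sparse_parallel(2)[OF sparse e(1,3) dist(2)] sparse_parallel(2)[OF sparse e(2,3) dist(3)]
        eq12 True by auto
    from three_orbit_points_independent[OF good par12 this]
    have "triple (anchor v P e1) (anchor v P e2) (anchor v P e3) \<noteq> 0"
      using nonloop eq12 True by (simp add: anchor_def)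
    then show ?thesis using that good presc by blast
  next
    case ne3: False
    show ?thesis
    proof (cases "far v e3 = v")
      case True
      then have "triple (anchor v P e1) (anchor v P e2) (anchor v P e3) \<noteq> 0"
        using not_half_turn[OF True eq12 good] nonloop eq12 by (simp add: anchor_def)
      then show ?thesis using that good presc by blast
    next
      case False
      have "cross3 (anchor v P e1) (anchor v P e2) \<noteq> 0"
        using cross3_orbit[OF good par12] nonloop eq12 by (simp add: anchor_def)
      from move_one_anchor[OF fin presc good False _ ne3 this] eq12 ne3
      obtain P' where "\<And>x. good (P' x)" "prescribable P' E'"
        "triple (anchor v P' e3) (anchor v P' e1) (anchor v P' e2) \<noteq> 0"
        by metis
      then show ?thesis
        using that triple_rotate by metis
    qed
  qed
next
  case ne12: False
  show ?thesis
  proof (cases "far v e1 = far v e3")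
    case True
    obtain P1 where P1: "\<And>x. good (P1 x)" "prescribable P1 E'"
      "cross3 (anchor v P1 e3) (anchor v P1 e1) \<noteq> 0"
      using move_to_two_anchors[OF fin presc good sparse e(3,1)] dist(2) by metis
    from move_one_anchor[OF fin P1(2,1) nonloop(2) _ _ P1(3)] ne12 True
    obtain P' where "\<And>x. good (P' x)" "prescribable P' E'"
      "triple (anchor v P' e2) (anchor v P' e3) (anchor v P' e1) \<noteq> 0"
      by metis
    then show ?thesis
      using that triple_rotate by metis
  next
    case False
    obtain P1 where P1: "\<And>x. good (P1 x)" "prescribable P1 E'"
      "cross3 (anchor v P1 e2) (anchor v P1 e3) \<noteq> 0"
      using move_to_two_anchors[OF fin presc good sparse e(2,3) dist(3)] by metis
    from move_one_anchor[OF fin P1(2,1) nonloop(1) ne12 False P1(3)] that show ?thesis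
      by metis
  qed
qed

section \<open>Blocked bridges\<close>

text \<open>An edge set that attains its bound and still contains the ends of \<open>e\<close>, so that adding \<open>e\<close> would
  exceed the bound. The second case requires that the potential extends to \<open>e\<close>.\<close>

definition blocks :: "'v gain_edge set \<Rightarrow> 'v gain_edge \<Rightarrow> bool" where
  "blocks F e \<longleftrightarrow> F \<noteq> {} \<and> ends e \<subseteq> touched F \<and>
     (card F + 1 = 2 * card (touched F) \<or>
      (\<exists>\<theta>. potential (insert e F) \<theta>) \<and> card F + 3 = 2 * card (touched F))"

lemma not_potential_loop: "A n \<noteq> id \<Longrightarrow> (u, n, u) \<in> F \<Longrightarrow> \<not> potential F \<theta>"
  using potentialD[of F \<theta> u n u] by auto

text \<open>If \<open>e\<close> already belongs to \<open>E\<close>, then the set \<open>{e}\<close> blocks it: in a set of edges a second copy of \<open>e\<close>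
  would be invisible, although it violates sparsity.\<close>

lemma sparse_insert_or_blocked:
  assumes fin: "finite E" and sparse: "sparse E" and loop: "\<And>u n. e = (u, n, u) \<Longrightarrow> A n \<noteq> id"
  shows "e \<notin> E \<and> sparse (insert e E) \<or> (\<exists>F\<subseteq>E. blocks F e)"
proof (cases "e \<in> E")
  case True
  obtain u n w where e: "e = (u, n, w)" by (rule prod_cases3)
  have "blocks {e} e"
  proof (cases "u = w")
    case False
    have "potential {e} (\<lambda>x. if x = w then n else 0)"
      using False by (simp add: e potential_def)
    then show ?thesis
      using False by (auto simp: blocks_def e)
  qed (simp add: blocks_def e)
  then show ?thesis
    using True by blast
next
  case new: False
  show ?thesis
  proof (cases "sparse (insert e E)")
    case False
    then have "\<exists>F'\<subseteq>insert e E. F' \<noteq> {} \<and> \<not> (card F' + 1 \<le> 2 * card (touched F') \<and>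
        ((\<exists>\<theta>. potential F' \<theta>) \<longrightarrow> card F' + 3 \<le> 2 * card (touched F')))"
      unfolding sparse_def by blast
    then obtain F' where F': "F' \<subseteq> insert e E" "F' \<noteq> {}"
      and viol: "2 * card (touched F') < card F' + 1 \<or>
        (\<exists>\<theta>. potential F' \<theta>) \<and> 2 * card (touched F') < card F' + 3"
      unfolding not_le[symmetric] by blast
    have "e \<in> F'"
    proof (rule ccontr)
      assume "e \<notin> F'"
      then have "F' \<subseteq> E" using F' by blast
      then show False
        using viol sparseD[OF sparse _ F'(2)] sparseD_potential[OF sparse _ F'(2)]
        unfolding not_le[symmetric] by blast
    qed
    define F where "F = F' - {e}"
    have F: "F \<subseteq> E" "F' = insert e F" "e \<notin> F"
      using F' \<open>e \<in> F'\<close> by (auto simp: F_def)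
    have finF: "finite F"
      using F(1) fin finite_subset by blast
    have card: "card F' = card F + 1"
      using F finF by simp
    have le: "card (touched F) \<le> card (touched F')"
      unfolding F(2) using finF by (intro card_mono touched_mono) auto
    obtain u n w where e: "e = (u, n, w)" by (rule prod_cases3)
    have "F \<noteq> {}"
    proof
      assume "F = {}"
      then have F'e: "F' = {e}" using F by simp
      have "u \<noteq> w" if pot: "potential F' \<theta>" for \<theta>
      proof
        assume "u = w"
        then show False
          using pot not_potential_loop[OF loop, of u n u F' \<theta>] by (simp add: e F'e)
      qed
      then show False
        using viol by (cases "u = w") (auto simp: F'e e)
    qed
    have eq: "ends e \<subseteq> touched F" if "card (touched F) = card (touched F')"
    proof -
      have "touched F = touched F'"
        by (rule card_subset_eq) (use F(2) finF that in auto)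
      then show ?thesis
        using F(2) by auto
    qed
    have "blocks F e"
      using viol
    proof
      assume "2 * card (touched F') < card F' + 1"
      then have "card F + 1 = 2 * card (touched F)" "card (touched F) = card (touched F')"
        using sparseD[OF sparse F(1) \<open>F \<noteq> {}\<close>] le card by auto
      then show ?thesis
        using eq \<open>F \<noteq> {}\<close> by (simp add: blocks_def)
    next
      assume "(\<exists>\<theta>. potential F' \<theta>) \<and> 2 * card (touched F') < card F' + 3"
      then obtain \<theta> where \<theta>: "potential F' \<theta>" and less: "2 * card (touched F') < card F' + 3"
        by blast
      have "potential F \<theta>"
        using \<theta> F(2) potential_subset by blast
      then have "card F + 3 = 2 * card (touched F)" "card (touched F) = card (touched F')"
        using sparseD_potential[OF sparse F(1) \<open>F \<noteq> {}\<close>] le less card by force+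
      then show ?thesis
        using eq \<open>F \<noteq> {}\<close> \<theta> F(2) by (auto simp: blocks_def)
    qed
    then show ?thesis
      using F(1) by blast
  qed (use new in blast)
qed

definition axial :: "real^3 \<Rightarrow> bool" where
  "axial C \<longleftrightarrow> (\<exists>c. C = c *\<^sub>R z)"

lemma axial_if_fixed: "A n C = C \<Longrightarrow> A n \<noteq> id \<Longrightarrow> axial C"
proof -
  assume "A n C = C" "A n \<noteq> id"
  then have "cross3 z C = 0"
    using fixed_vector cross3_nz_commute by blast
  then show ?thesis
    using parallel_if_cross3_eq_0[OF _ axis_nz] by (metis axial_def)
qed

text \<open>The motions of a blocking set are trivial with a parameter \<open>C\<close>, which is also the velocity
  of both anchors, up to multiples of the anchors themselves. The flag \<open>g\<close> tells that the set is
  tight as an unbalanced set.\<close>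

definition rigid_block ::
    "'v \<Rightarrow> ('v \<Rightarrow> real^3) \<Rightarrow> 'v gain_edge \<Rightarrow> 'v gain_edge \<Rightarrow> 'v gain_edge set
      \<Rightarrow> ('v \<Rightarrow> int) \<Rightarrow> bool \<Rightarrow> bool" where
  "rigid_block v P e1 e2 F \<theta> g \<longleftrightarrow>
     far v e1 \<in> touched F \<and> (far v e2 \<noteq> v \<longrightarrow> far v e2 \<in> touched F) \<and>
     (\<forall>X. (\<forall>e\<in>F. length_change P e X = 0) \<longrightarrow>
       (\<exists>C. (g \<longrightarrow> axial C) \<and> (\<forall>a\<in>touched F. \<exists>\<rho>. X a = A (- \<theta> a) C + \<rho> *\<^sub>R P a) \<and>
         (\<exists>\<rho>. anchor_motion v X e1 = C + \<rho> *\<^sub>R anchor v P e1) \<and>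
         (\<exists>\<rho>. anchor_motion v X e2 = C + \<rho> *\<^sub>R anchor v P e2))) \<and>
     (\<not> g \<longrightarrow> potential F \<theta> \<and> far v e2 \<noteq> v \<and>
       A (\<theta> (far v e1)) = A (shift v e1) \<and> A (\<theta> (far v e2)) = A (shift v e2))"

text \<open>A tight set has no other motions than the trivial ones. The potential is normalised so that it takes
  the gain of \<open>e1\<close> at its far end; then \<open>C\<close> is the velocity seen from \<open>v\<close>. Only the unbalanced case is
  possible when \<open>e2\<close> is a loop, since the bridge is then a loop with nontrivial gain.\<close>

lemma rigid_block_exists:
  assumes fin: "finite F" and presc: "prescribable P F" and good: "\<And>x. good (P x)"
    and e1: "far v e1 \<noteq> v" and blocks: "blocks F (bridge v e1 e2)"
  obtains \<theta> g where "rigid_block v P e1 e2 F \<theta> g"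
proof -
  let ?a = "far v e1" and ?c = "far v e2"
  have nz: "P x \<noteq> 0" for x
    using good good_nz by blast
  have ne: "F \<noteq> {}"
    using blocks by (simp add: blocks_def)
  have touch: "?a \<in> touched F" "?c \<noteq> v \<longrightarrow> ?c \<in> touched F"
    using blocks ends_bridge[OF e1] by (auto simp: blocks_def)
  show ?thesis
  proof (cases "card F + 1 = 2 * card (touched F)")
    case True
    have "\<exists>C. (True \<longrightarrow> axial C) \<and> (\<forall>a\<in>touched F. \<exists>\<rho>. X a = A (- 0) C + \<rho> *\<^sub>R P a) \<and>
        (\<exists>\<rho>. anchor_motion v X e1 = C + \<rho> *\<^sub>R anchor v P e1) \<and>
        (\<exists>\<rho>. anchor_motion v X e2 = C + \<rho> *\<^sub>R anchor v P e2)"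
      if X: "\<forall>e\<in>F. length_change P e X = 0" for X
    proof -
      have "\<exists>b r. \<forall>a\<in>touched F. X a = A (- 0) (\<Sum>k\<in>{()}. b k *\<^sub>R z) + r a *\<^sub>R P a"
        by (rule motion_trivial_if_tight[OF fin _ ne presc, where K = "{()}" and D = "\<lambda>_. z"
              and \<theta> = "\<lambda>_. 0" and X = X])
          (use nz axis_nz X True in \<open>auto simp: preserves_lengths_axis\<close>)
      then obtain c r where cr: "\<forall>a\<in>touched F. X a = c *\<^sub>R z + r a *\<^sub>R P a"
        by auto
      have "\<exists>\<rho>. anchor_motion v X e = c *\<^sub>R z + \<rho> *\<^sub>R anchor v P e"
        if "far v e \<noteq> v \<longrightarrow> far v e \<in> touched F" for e
      proof (cases "far v e = v")
        case True
        then show ?thesis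
          by (intro exI[of _ "- c"]) (simp add: anchor_motion_def anchor_def)
      next
        case False
        then show ?thesis
          using cr that
          by (intro exI[of _ "r (far v e)"]) (simp add: anchor_motion_def anchor_def)
      qed
      then show ?thesis
        using cr touch by (intro exI[of _ "c *\<^sub>R z"]) (auto simp: axial_def)
    qed
    then have "rigid_block v P e1 e2 F (\<lambda>_. 0) True"
      unfolding rigid_block_def using touch by blast
    then show ?thesis by (rule that)
  next
    case False
    then obtain \<theta>0 where \<theta>0: "potential (insert (bridge v e1 e2) F) \<theta>0"
      and tight: "card F + 3 = 2 * card (touched F)"
      using blocks by (auto simp: blocks_def)
    have c: "?c \<noteq> v"
    proof
      assume "?c = v"
      then have "(?a, 1, ?a) \<in> insert (bridge v e1 e2) F"
        by (simp add: bridge_def)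
      from not_potential_loop[OF A_1 this, of \<theta>0] \<theta>0 show False
        by contradiction
    qed
    define \<theta> where "\<theta> x = \<theta>0 x - \<theta>0 ?a + shift v e1" for x
    have pot: "potential F \<theta>"
    proof -
      have "\<theta> x - \<theta> y = \<theta>0 x - \<theta>0 y" for x y
        by (simp add: \<theta>_def)
      then show ?thesis
        using potential_subset[OF \<theta>0 subset_insertI] by (simp add: potential_def)
    qed
    have a1: "\<theta> ?a = shift v e1"
      by (simp add: \<theta>_def)
    have "A (shift v e2 - shift v e1) = A (\<theta>0 ?c - \<theta>0 ?a)"
      using \<theta>0 c potentialD[of _ \<theta>0 ?a "shift v e2 - shift v e1" ?c] by (simp add: bridge_def)
    then have c1: "A (\<theta> ?c) = A (shift v e2)"
    proof -
      assume eq: "A (shift v e2 - shift v e1) = A (\<theta>0 ?c - \<theta>0 ?a)"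
      have "A (\<theta> ?c) x = A (shift v e2) x" for x
        using A_add[of "\<theta>0 ?c - \<theta>0 ?a" "shift v e1" x]
          A_add[of "shift v e2 - shift v e1" "shift v e1" x] eq by (simp add: \<theta>_def)
      then show ?thesis by (rule ext)
    qed
    have anchored: "\<exists>\<rho>. anchor_motion v X e = C + \<rho> *\<^sub>R anchor v P e"
      if "far v e \<noteq> v" "A (\<theta> (far v e)) = A (shift v e)"
        "X (far v e) = A (- \<theta> (far v e)) C + \<rho> *\<^sub>R P (far v e)" for e X C \<rho>
    proof -
      have "A (shift v e) (A (- \<theta> (far v e)) C) = C"
        unfolding that(2)[symmetric] by (rule A_cancel)
      then show ?thesis
        using that by (intro exI[of _ \<rho>]) (simp add: anchor_motion_def anchor_def)
    qed
    have "\<exists>C. (False \<longrightarrow> axial C) \<and> (\<forall>a\<in>touched F. \<exists>\<rho>. X a = A (- \<theta> a) C + \<rho> *\<^sub>R P a) \<and>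
        (\<exists>\<rho>. anchor_motion v X e1 = C + \<rho> *\<^sub>R anchor v P e1) \<and>
        (\<exists>\<rho>. anchor_motion v X e2 = C + \<rho> *\<^sub>R anchor v P e2)"
      if X: "\<forall>e\<in>F. length_change P e X = 0" for X
    proof -
      have "\<exists>b r. \<forall>a\<in>touched F.
          X a = A (- \<theta> a) (\<Sum>k\<in>(UNIV :: 3 set). b k *\<^sub>R axis k 1) + r a *\<^sub>R P a"
        by (rule motion_trivial_if_tight[OF fin _ ne presc, where K = "UNIV :: 3 set"
              and D = "\<lambda>k. axis k 1" and \<theta> = \<theta> and X = X])
          (use nz X tight pot in \<open>auto simp: preserves_lengths_potential sum_axis vec_eq_iff\<close>)
      then obtain b r where cr: "\<forall>a\<in>touched F.
          X a = A (- \<theta> a) (\<Sum>k\<in>(UNIV :: 3 set). b k *\<^sub>R axis k 1) + r a *\<^sub>R P a"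
        by blast
      define C where "C = (\<Sum>k\<in>(UNIV :: 3 set). b k *\<^sub>R axis k (1::real))"
      have XC: "X a = A (- \<theta> a) C + r a *\<^sub>R P a" if "a \<in> touched F" for a
        using cr that by (simp add: C_def)
      have "\<exists>\<rho>. anchor_motion v X e1 = C + \<rho> *\<^sub>R anchor v P e1"
        using anchored[of e1 X C "r ?a"] e1 XC[OF touch(1)] a1 by simp
      moreover have "\<exists>\<rho>. anchor_motion v X e2 = C + \<rho> *\<^sub>R anchor v P e2"
        using anchored[of e2 X C "r ?c"] c c1 XC touch(2) by simp
      ultimately show ?thesis
        using XC by blast
    qed
    then have "rigid_block v P e1 e2 F \<theta> False"
      unfolding rigid_block_def using touch pot c a1 c1 by auto
    then show ?thesis by (rule that)
  qed
qed

lemma rigid_block_motion: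
  assumes "rigid_block v P e1 e2 F \<theta> g" "\<forall>e\<in>F. length_change P e X = 0"
  obtains C \<rho>1 \<rho>2 where "g \<longrightarrow> axial C" "\<forall>a\<in>touched F. \<exists>\<rho>. X a = A (- \<theta> a) C + \<rho> *\<^sub>R P a"
    "anchor_motion v X e1 = C + \<rho>1 *\<^sub>R anchor v P e1"
    "anchor_motion v X e2 = C + \<rho>2 *\<^sub>R anchor v P e2"
  using assms unfolding rigid_block_def by blast

lemma rigid_block_touched:
  assumes "rigid_block v P e1 e2 F \<theta> g"
  shows "far v e1 \<in> touched F" "far v e2 \<noteq> v \<Longrightarrow> far v e2 \<in> touched F"
  using assms unfolding rigid_block_def by blast+

lemma rigid_block_potential:
  assumes "rigid_block v P e1 e2 F \<theta> g" "\<not> g"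
  shows "potential F \<theta>" "far v e2 \<noteq> v" "A (\<theta> (far v e1)) = A (shift v e1)"
    "A (\<theta> (far v e2)) = A (shift v e2)"
  using assms unfolding rigid_block_def by blast+

lemma potential_cong:
  assumes "\<And>a. a \<in> touched F \<Longrightarrow> A (\<theta> a) = A (\<theta>' a)" "potential F \<theta>"
  shows "potential F \<theta>'"
  unfolding potential_def
proof clarify
  fix u n w assume e: "(u, n, w) \<in> F"
  have "u \<in> touched F" "w \<in> touched F"
    using ends_subset_touched[OF e] by auto
  then have "A (\<theta> w) = A (\<theta>' w)" "A (- \<theta> u) = A (- \<theta>' u)"
    using assms(1) A_uminus_eq by auto
  then have "A (\<theta> w - \<theta> u) x = A (\<theta>' w - \<theta>' u) x" for x
    using A_add[of "\<theta> w" "- \<theta> u" x] A_add[of "\<theta>' w" "- \<theta>' u" x] by simp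
  then show "A n = A (\<theta>' w - \<theta>' u)"
    using potentialD[OF assms(2) e] by auto
qed

text \<open>Several sets with trivial motions and a common parameter \<open>C\<close>. If the potentials disagree at a
  shared vertex, then \<open>C - A n C\<close> is a multiple of a good vector for some \<open>A n \<noteq> id\<close>; as \<open>A n\<close>
  preserves the pairing with the axis, the multiple is zero, and \<open>C\<close> lies on the axis.\<close>

lemma card_union_of_blocks:
  fixes B :: "('v gain_edge set \<times> ('v \<Rightarrow> int)) set"
  assumes fin: "finite B" "\<And>x. x \<in> B \<Longrightarrow> finite (fst x)" and good: "\<And>x. good (P x)"
    and F: "F = \<Union>(fst ` B)"
    and motion: "\<And>X. (\<And>e. e \<in> F \<Longrightarrow> length_change P e X = 0) \<Longrightarrow> \<exists>C. (g \<longrightarrow> axial C) \<and>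
      (\<forall>x\<in>B. \<forall>a\<in>touched (fst x). \<exists>\<rho>. X a = A (- snd x a) C + \<rho> *\<^sub>R P a)"
  shows "2 * card (touched F) \<le> card F + 1 \<or>
    \<not> g \<and> 2 * card (touched F) \<le> card F + 3 \<and>
      (\<exists>\<eta>. \<forall>x\<in>B. \<forall>a\<in>touched (fst x). A (snd x a) = A (\<eta> a))"
proof -
  have finF: "finite F"
    using fin by (auto simp: F)
  have touched: "touched F = (\<Union>x\<in>B. touched (fst x))"
    unfolding F touched_def by blast
  show ?thesis
  proof (cases "g \<or> (\<exists>x\<in>B. \<exists>y\<in>B. \<exists>a\<in>touched (fst x) \<inter> touched (fst y). A (snd x a) \<noteq> A (snd y a))")
    case True
    have "2 * card (touched F) \<le> card F + card {()}"
    proof (rule card_ge_if_motions_trivial[OF finF, where \<theta> = "\<lambda>_. 0" and D = "\<lambda>_. z" and P = P])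
      fix X assume "\<And>e. e \<in> F \<Longrightarrow> length_change P e X = 0"
      from motion[OF this] obtain C where gC: "g \<longrightarrow> axial C"
        and C: "\<forall>x\<in>B. \<forall>a\<in>touched (fst x). \<exists>\<rho>. X a = A (- snd x a) C + \<rho> *\<^sub>R P a"
        by blast
      have "axial C"
      proof (cases g)
        case False
        then obtain x y a where B: "x \<in> B" "y \<in> B"
          and a: "a \<in> touched (fst x)" "a \<in> touched (fst y)" and ne: "A (snd x a) \<noteq> A (snd y a)"
          using True by blast
        define m n where "m = snd x a" and "n = snd y a"
        obtain \<rho>1 \<rho>2 where "X a = A (- m) C + \<rho>1 *\<^sub>R P a" "X a = A (- n) C + \<rho>2 *\<^sub>R P a"
          using C B a unfolding m_def n_def by blast
        then have eq: "A (- m) C - A (- n) C = (\<rho>2 - \<rho>1) *\<^sub>R P a"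
          by (simp add: algebra_simps)
        then have "bform z (A (- m) C - A (- n) C) = (\<rho>2 - \<rho>1) * bform z (P a)"
          by (simp only: bform_linear)
        then have "\<rho>2 = \<rho>1"
          using good[of a] by (simp add: good_def)
        then have "A (- m) C = A (- n) C"
          using eq by simp
        then have "A n (A (- m) C) = A n (A (- n) C)"
          by (rule arg_cong)
        then have "A (n - m) C = C"
          using A_add[of n "- m" C] by simp
        moreover have "A (n - m) \<noteq> id"
          using ne A_eq_A_iff[of m n] by (simp add: m_def n_def)
        ultimately show ?thesis
          by (rule axial_if_fixed)
      qed (use gC in blast)
      then obtain c where c: "C = c *\<^sub>R z"
        unfolding axial_def by blast
      have "\<exists>\<rho>. X a = c *\<^sub>R z + \<rho> *\<^sub>R P a" if a: "a \<in> touched F" for a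
      proof -
        obtain x where "x \<in> B" "a \<in> touched (fst x)"
          using a unfolding touched by blast
        then have "\<exists>\<rho>. X a = A (- snd x a) C + \<rho> *\<^sub>R P a"
          using C by blast
        then show ?thesis
          by (simp add: c)
      qed
      then obtain r where "\<forall>a\<in>touched F. X a = c *\<^sub>R z + r a *\<^sub>R P a"
        by metis
      then show "\<exists>b r. \<forall>a\<in>touched F. X a = A (- 0) (\<Sum>k\<in>{()}. b k *\<^sub>R z) + r a *\<^sub>R P a"
        by (intro exI[of _ "\<lambda>_. c"] exI[of _ r]) simp
    qed simp
    then show ?thesis by simp
  next
    case False
    define choice where "choice a = (SOME x. x \<in> B \<and> a \<in> touched (fst x))" for a
    define \<eta> where "\<eta> a = snd (choice a) a" for a
    have \<eta>: "A (snd x a) = A (\<eta> a)" if x: "x \<in> B" "a \<in> touched (fst x)" for x a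
    proof -
      have "choice a \<in> B \<and> a \<in> touched (fst (choice a))"
        unfolding choice_def by (rule someI[of _ x]) (use x in simp)
      then show ?thesis
        using False x unfolding \<eta>_def by blast
    qed
    have "2 * card (touched F) \<le> card F + card (UNIV :: 3 set)"
    proof (rule card_ge_if_motions_trivial[OF finF, where \<theta> = \<eta> and D = "\<lambda>k. axis k 1" and P = P])
      fix X assume "\<And>e. e \<in> F \<Longrightarrow> length_change P e X = 0"
      from motion[OF this] obtain C where
        C: "\<forall>x\<in>B. \<forall>a\<in>touched (fst x). \<exists>\<rho>. X a = A (- snd x a) C + \<rho> *\<^sub>R P a"
        by blast
      have "\<exists>\<rho>. X a = A (- \<eta> a) C + \<rho> *\<^sub>R P a" if a: "a \<in> touched F" for a
      proof -
        obtain x where x: "x \<in> B" "a \<in> touched (fst x)"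
          using a unfolding touched by blast
        then have "A (- snd x a) = A (- \<eta> a)"
          using \<eta> A_uminus_eq by blast
        then show ?thesis
          using C x by metis
      qed
      then obtain r where "\<forall>a\<in>touched F. X a = A (- \<eta> a) C + r a *\<^sub>R P a"
        by metis
      then show "\<exists>b r. \<forall>a\<in>touched F.
          X a = A (- \<eta> a) (\<Sum>k\<in>(UNIV :: 3 set). b k *\<^sub>R axis k 1) + r a *\<^sub>R P a"
        by (intro exI[of _ "\<lambda>k. C $ k"] exI[of _ r]) (simp add: sum_axis)
    qed simp
    then show ?thesis
      using False \<eta> by auto
  qed
qed

lemma independent_triple_combination:
  assumes "triple x y w \<noteq> 0" "\<alpha> *\<^sub>R x + \<beta> *\<^sub>R y + \<gamma> *\<^sub>R w = 0"
  shows "\<alpha> = 0" "\<beta> = 0" "\<gamma> = 0"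
proof -
  have "triple (\<alpha> *\<^sub>R x + \<beta> *\<^sub>R y + \<gamma> *\<^sub>R w) y w = 0" "triple x (\<alpha> *\<^sub>R x + \<beta> *\<^sub>R y + \<gamma> *\<^sub>R w) w = 0"
    "triple x y (\<alpha> *\<^sub>R x + \<beta> *\<^sub>R y + \<gamma> *\<^sub>R w) = 0"
    unfolding assms(2) by simp_all
  moreover have "triple y y w = 0" "triple w y w = 0"
    by simp_all
  ultimately show "\<alpha> = 0" "\<beta> = 0" "\<gamma> = 0"
    using assms(1) by simp_all
qed

text \<open>The differences of the parameters of the three blocks are multiples of the three anchors, so
  independence of the anchors makes them equal. Hence the union of the blocks has few motions and
  many edges, and together with the three edges at \<open>v\<close> it violates sparsity.\<close>

lemma three_blocks_contradiction:
  assumes fin: "finite E" and sparse: "sparse E" and good: "\<And>x. good (P x)"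
    and star: "star v E = {e1, e2, e3}" and dist: "e1 \<noteq> e2" "e1 \<noteq> e3" "e2 \<noteq> e3"
    and nonloop: "far v e1 \<noteq> v" "far v e2 \<noteq> v"
    and indep: "triple (anchor v P e1) (anchor v P e2) (anchor v P e3) \<noteq> 0"
    and sub: "F12 \<subseteq> E - star v E" "F13 \<subseteq> E - star v E" "F23 \<subseteq> E - star v E"
    and b12: "rigid_block v P e1 e2 F12 \<theta>12 g12" and b13: "rigid_block v P e1 e3 F13 \<theta>13 g13"
    and b23: "rigid_block v P e2 e3 F23 \<theta>23 g23"
  shows False
proof -
  define F where "F = F12 \<union> F13 \<union> F23"
  define B where "B = {(F12, \<theta>12), (F13, \<theta>13), (F23, \<theta>23)}"
  define g where "g \<longleftrightarrow> g12 \<or> g13 \<or> g23"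
  have F_sub: "F \<subseteq> E - star v E"
    using sub by (auto simp: F_def)
  have finF: "finite F"
    using F_sub fin finite_subset by blast
  have vF: "v \<notin> touched F"
    using not_touched_diff_star[of v E] touched_mono[OF F_sub] by (rule contra_subsetD[rotated])
  have tri: "2 * card (touched F) \<le> card F + 1 \<or>
      \<not> g \<and> 2 * card (touched F) \<le> card F + 3 \<and>
        (\<exists>\<eta>. \<forall>x\<in>B. \<forall>a\<in>touched (fst x). A (snd x a) = A (\<eta> a))"
  proof (rule card_union_of_blocks)
    show "finite B" "F = \<Union>(fst ` B)"
      by (auto simp: B_def F_def)
    show "finite (fst x)" if "x \<in> B" for x
      using that finF by (auto simp: B_def F_def)
    show "good (P x)" for x by (rule good)
    fix X assume X: "\<And>e. e \<in> F \<Longrightarrow> length_change P e X = 0"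
    let ?Q1 = "anchor v P e1" and ?Q2 = "anchor v P e2" and ?Q3 = "anchor v P e3"
    let ?Y = "anchor_motion v X"
    have zero: "\<forall>e\<in>F12. length_change P e X = 0" "\<forall>e\<in>F13. length_change P e X = 0"
      "\<forall>e\<in>F23. length_change P e X = 0"
      using X by (simp_all add: F_def)
    obtain C12 r1 r2 where
      m12: "g12 \<longrightarrow> axial C12" "\<forall>a\<in>touched F12. \<exists>\<rho>. X a = A (- \<theta>12 a) C12 + \<rho> *\<^sub>R P a"
        "?Y e1 = C12 + r1 *\<^sub>R ?Q1" "?Y e2 = C12 + r2 *\<^sub>R ?Q2"
      by (rule rigid_block_motion[OF b12 zero(1)])
    obtain C13 r1' r3 where
      m13: "g13 \<longrightarrow> axial C13" "\<forall>a\<in>touched F13. \<exists>\<rho>. X a = A (- \<theta>13 a) C13 + \<rho> *\<^sub>R P a"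
        "?Y e1 = C13 + r1' *\<^sub>R ?Q1" "?Y e3 = C13 + r3 *\<^sub>R ?Q3"
      by (rule rigid_block_motion[OF b13 zero(2)])
    obtain C23 r2' r3' where
      m23: "g23 \<longrightarrow> axial C23" "\<forall>a\<in>touched F23. \<exists>\<rho>. X a = A (- \<theta>23 a) C23 + \<rho> *\<^sub>R P a"
        "?Y e2 = C23 + r2' *\<^sub>R ?Q2" "?Y e3 = C23 + r3' *\<^sub>R ?Q3"
      by (rule rigid_block_motion[OF b23 zero(3)])
    have d1: "C12 - C13 = (r1' - r1) *\<^sub>R ?Q1"
      using m12(3) m13(3) by (simp add: algebra_simps)
    have d2: "C12 - C23 = (r2' - r2) *\<^sub>R ?Q2"
      using m12(4) m23(3) by (simp add: algebra_simps)
    have d3: "C13 - C23 = (r3' - r3) *\<^sub>R ?Q3"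
      using m13(4) m23(4) by (simp add: algebra_simps)
    have "(r1' - r1) *\<^sub>R ?Q1 + (r2 - r2') *\<^sub>R ?Q2 + (r3' - r3) *\<^sub>R ?Q3
        = (C12 - C13) - (C12 - C23) + (C13 - C23)"
      unfolding d1 d2 d3 by (simp add: algebra_simps)
    also have "\<dots> = 0" by simp
    finally have "r1' - r1 = 0" "r3' - r3 = 0"
      using independent_triple_combination[OF indep] by blast+
    then have "C12 = C13" "C23 = C13"
      using d1 d3 by simp_all
    then show "\<exists>C. (g \<longrightarrow> axial C) \<and>
        (\<forall>x\<in>B. \<forall>a\<in>touched (fst x). \<exists>\<rho>. X a = A (- snd x a) C + \<rho> *\<^sub>R P a)"
      using m12(1,2) m13(1,2) m23(1,2) by (intro exI[of _ C13]) (auto simp: B_def g_def)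
  qed
  let ?F = "F \<union> star v E"
  have sub': "?F \<subseteq> E"
    using F_sub by (auto simp: star_def)
  have ne: "?F \<noteq> {}"
    by (simp add: star)
  have disj: "F \<inter> star v E = {}"
    using F_sub by blast
  have card: "card ?F = card F + 3"
    using card_Un_disjoint[OF finF finite_star[OF fin] disj] dist by (simp add: star)
  have far: "far v e1 \<in> touched F" "far v e2 \<in> touched F" "far v e3 \<noteq> v \<Longrightarrow> far v e3 \<in> touched F"
    using rigid_block_touched[OF b12] rigid_block_touched[OF b13] nonloop
    by (simp_all add: F_def)
  have v: "v \<in> ends e" if "e \<in> star v E" for e
    using that by (simp add: star_def)
  have "touched ?F \<subseteq> insert v (touched F)"
    using far ends_far[OF v] by (auto simp: touched_def[of "star v E"] star)
  then have le: "card (touched ?F) \<le> card (touched F) + 1"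
    using card_mono[of "insert v (touched F)" "touched (F \<union> star v E)"] finF vF by simp
  from tri show False
  proof
    assume "2 * card (touched F) \<le> card F + 1"
    then show False
      using sparseD[OF sparse sub' ne] card le by simp
  next
    assume *: "\<not> g \<and> 2 * card (touched F) \<le> card F + 3 \<and>
        (\<exists>\<eta>. \<forall>x\<in>B. \<forall>a\<in>touched (fst x). A (snd x a) = A (\<eta> a))"
    then obtain \<eta> where \<eta>: "\<forall>x\<in>B. \<forall>a\<in>touched (fst x). A (snd x a) = A (\<eta> a)"
      by blast
    define \<eta>' where "\<eta>' = \<eta>(v := 0)"
    have \<eta>': "A (\<theta> a) = A (\<eta>' a)" if B: "(F', \<theta>) \<in> B" "a \<in> touched F'" for F' \<theta> a
    proof -
      have "a \<noteq> v"
        using B vF by (auto simp: B_def F_def)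
      then show ?thesis
        using bspec[OF \<eta> B(1)] B(2) by (simp add: \<eta>'_def)
    qed
    have g: "\<not> g12" "\<not> g13" "\<not> g23"
      using * by (simp_all add: g_def)
    note p12 = rigid_block_potential[OF b12 g(1)] rigid_block_touched[OF b12]
    note p13 = rigid_block_potential[OF b13 g(2)] rigid_block_touched[OF b13]
    note p23 = rigid_block_potential[OF b23 g(3)]
    have "potential F12 \<eta>'"
      by (rule potential_cong[OF _ p12(1)], rule \<eta>') (simp_all add: B_def)
    moreover have "potential F13 \<eta>'"
      by (rule potential_cong[OF _ p13(1)], rule \<eta>') (simp_all add: B_def)
    moreover have "potential F23 \<eta>'"
      by (rule potential_cong[OF _ p23(1)], rule \<eta>') (simp_all add: B_def)
    ultimately have pF: "potential F \<eta>'"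
      by (simp add: F_def potential_Un)
    have v0: "\<eta>' v = 0"
      by (simp add: \<eta>'_def)
    have m: "(F12, \<theta>12) \<in> B" "(F13, \<theta>13) \<in> B"
      by (simp_all add: B_def)
    have "A (shift v e) = A (\<eta>' (far v e))" if "e \<in> star v E" for e
      using that p12(3,4) p13(4) \<eta>'[OF m(1) p12(5)] \<eta>'[OF m(1) p12(6)[OF p12(2)]]
        \<eta>'[OF m(2) p13(6)[OF p13(2)]] by (auto simp: star)
    then have "potential {e} \<eta>'" if "e \<in> star v E" for e
      using that by (subst potential_star[OF v[OF that]]) (simp add: v0)
    then have "potential (star v E) \<eta>'"
      unfolding potential_def by blast
    then have "potential ?F \<eta>'"
      using pF by (simp add: potential_Un)
    then show False
      using sparseD_potential[OF sparse sub' ne, of \<eta>'] card le * by simp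
  qed
qed

section \<open>Sparse gain graphs are independent in some position\<close>

lemma double_count_stars:
  assumes "finite E"
  shows "(\<Sum>v\<in>touched E. card (star v E)) \<le> 2 * card E"
proof -
  have "(\<Sum>v\<in>touched E. card (star v E)) = (\<Sum>v\<in>touched E. \<Sum>e\<in>E. if v \<in> ends e then 1 else 0)"
    by (simp only: star_def card_eq_sum sum.inter_filter[OF assms])
  also have "\<dots> = (\<Sum>e\<in>E. \<Sum>v\<in>touched E. if v \<in> ends e then 1 else 0)"
    by (rule sum.swap)
  also have "\<dots> = (\<Sum>e\<in>E. card (ends e))"
  proof (rule sum.cong)
    fix e assume "e \<in> E"
    then have "ends e = {v\<in>touched E. v \<in> ends e}"
      using ends_subset_touched by blast
    then show "(\<Sum>v\<in>touched E. if v \<in> ends e then 1 else 0) = card (ends e)"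
      using sum.inter_filter[OF finite_touched[OF assms], of "\<lambda>_. 1 :: nat" "\<lambda>v. v \<in> ends e"]
      by (simp only: card_eq_sum)
  qed simp
  also have "\<dots> \<le> (\<Sum>e\<in>E. 2)"
  proof (rule sum_mono)
    fix e :: "'v gain_edge"
    show "card (ends e) \<le> 2"
      by (simp add: ends_def card_insert_if)
  qed
  finally show ?thesis by simp
qed

text \<open>The average of the degrees is less than four.\<close>

lemma low_degree_vertex:
  assumes "finite E" "sparse E" "E \<noteq> {}"
  obtains v where "v \<in> touched E" "card (star v E) \<le> 3"
proof -
  have "\<exists>v\<in>touched E. card (star v E) \<le> 3"
  proof (rule ccontr)
    assume "\<not> ?thesis"
    then have "(\<Sum>v\<in>touched E. 4) \<le> (\<Sum>v\<in>touched E. card (star v E))"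
      by (intro sum_mono) auto
    then have "4 * card (touched E) \<le> 2 * card E"
      using double_count_stars[OF assms(1)] by simp
    then show False
      using sparseD[OF assms(2) subset_refl assms(3)] by simp
  qed
  then show ?thesis using that by blast
qed

text \<open>At most one of the edges is a loop, and it can be listed last.\<close>

lemma order_star:
  assumes sparse: "sparse E" and card: "card (star v E) = 3"
  obtains e1 e2 e3 where "star v E = {e1, e2, e3}" "e1 \<noteq> e2" "e1 \<noteq> e3" "e2 \<noteq> e3"
    "far v e1 \<noteq> v" "far v e2 \<noteq> v"
proof -
  obtain f1 f2 f3 where f: "star v E = {f1, f2, f3}" "f1 \<noteq> f2" "f1 \<noteq> f3" "f2 \<noteq> f3"
    using card by (auto simp: card_3_iff)
  have one: "far v e \<noteq> v \<or> far v e' \<noteq> v" if "e \<in> star v E" "e' \<in> star v E" "e \<noteq> e'" for e e'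
    using sparse_parallel(1)[OF sparse that] by auto
  consider "far v f1 = v" | "far v f2 = v" | "far v f1 \<noteq> v" "far v f2 \<noteq> v"
    by blast
  then show ?thesis
  proof cases
    case 1
    then show ?thesis
      using that[of f2 f3 f1] one[of f1 f2] one[of f1 f3] f by (simp add: insert_commute)
  next
    case 2
    then show ?thesis
      using that[of f1 f3 f2] one[of f2 f1] one[of f2 f3] f by (simp add: insert_commute)
  next
    case 3
    then show ?thesis
      using that[of f1 f2 f3] f by blast
  qed
qed

text \<open>A blocking set of a loop is tight as an unbalanced set; three more edges on one more vertex are too
  many.\<close>

lemma blocks_loop_contradiction:
  assumes fin: "finite E" and sparse: "sparse E"
    and star: "star v E = {e1, e2, e3}" and dist: "e1 \<noteq> e2" "e1 \<noteq> e3" "e2 \<noteq> e3"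
    and far: "far v e1 = a" "far v e2 = a" "far v e3 = v"
    and F: "F \<subseteq> E - star v E" and blocks: "blocks F (a, 1, a)"
  shows False
proof -
  have finF: "finite F"
    using F fin finite_subset by blast
  have tight: "card F + 1 = 2 * card (touched F)" and a: "a \<in> touched F"
    using blocks not_potential_loop[OF A_1, of a "insert (a, 1, a) F"] by (auto simp: blocks_def)
  let ?F = "F \<union> star v E"
  have sub': "?F \<subseteq> E" and disj: "F \<inter> star v E = {}"
    using F by (auto simp: star_def)
  have card: "card ?F = card F + 3"
    using card_Un_disjoint[OF finF finite_star[OF fin] disj] dist by (simp add: star)
  have v: "v \<in> ends e" if "e \<in> star v E" for e
    using that by (simp add: star_def)
  have "touched ?F \<subseteq> insert v (touched F)"
    using far a ends_far[OF v] by (auto simp: touched_def[of "star v E"] star)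
  then have "card (touched ?F) \<le> card (insert v (touched F))"
    using finF by (intro card_mono) auto
  also have "\<dots> \<le> card (touched F) + 1"
    using finF by (simp add: card_insert_if)
  finally show False
    using sparseD[OF sparse sub'] card tight by (simp add: star)
qed

text \<open>Induction on the number of vertices, removing a vertex \<open>v\<close> with at most three edges. Three edges
  impose one condition more than the two-dimensional velocity of \<open>v\<close> can satisfy, and a bridge between
  two far ends takes up this condition; the counting argument for the blocks shows that one of the
  three bridges can be added.\<close>

theorem prescribable_if_sparse:
  fixes E :: "'v gain_edge set"
  assumes "finite E" "sparse E"
  shows "\<exists>P. (\<forall>x. good (P x)) \<and> prescribable P E"
  using assms
proof (induction "card (touched E)" arbitrary: E rule: less_induct)
  case less
  note fin = \<open>finite E\<close> and sparse = \<open>sparse E\<close>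
  show ?case
  proof (cases "E = {}")
    case True
    obtain x where "good x"
      using exists_good[OF axis_nz] by blast
    then show ?thesis
      by (intro exI[of _ "\<lambda>_. x"]) (simp add: True prescribable_def)
  next
    case False
    obtain v where v: "v \<in> touched E" "card (star v E) \<le> 3"
      using low_degree_vertex[OF fin sparse False] .
    define E0 where "E0 = E - star v E"
    have fin0: "finite E0" and sparse0: "sparse E0"
      using fin sparse_subset[OF sparse] by (auto simp: E0_def)
    have smaller: "card (touched E') < card (touched E)" if "touched E' \<subseteq> touched E - {v}"
      for E' :: "'v gain_edge set"
      using that v(1) fin by (intro psubset_card_mono) auto
    have IH: "\<exists>P. (\<forall>x. good (P x)) \<and> prescribable P E'"
      if "finite E'" "sparse E'" "touched E' \<subseteq> touched E - {v}" for E'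
      using less.hyps[OF smaller] that by blast
    obtain P0 where P0: "\<And>x. good (P0 x)" "prescribable P0 E0"
      using IH[OF fin0 sparse0 touched_diff_star[of E v, folded E0_def]] by blast
    have "star v E \<noteq> {}"
      using v(1) unfolding star_def touched_def by blast
    then have "card (star v E) \<noteq> 0"
      using fin by simp
    then consider "card (star v E) = 1" | "card (star v E) = 2" | "card (star v E) = 3"
      using v(2) by linarith
    then show ?thesis
    proof cases
      case 1
      then obtain e where e: "star v E = {e}"
        by (auto simp: card_1_singleton_iff)
      obtain Q where Q: "cross3 (anchor v P0 e) Q \<noteq> 0"
        using not_parallel_exists[OF anchor_nz[OF P0(1)]] .
      obtain p where "good p" "prescribable (P0(v := p)) E"
        by (rule prescribable_add_vertex_two_edges[OF sparse P0(2)[unfolded E0_def], of e e _ Q])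
          (use e Q in auto)
      then show ?thesis
        by (intro exI[of _ "P0(v := p)"]) (simp add: P0(1))
    next
      case 2
      then obtain e1 e2 where e: "star v E = {e1, e2}" "e1 \<noteq> e2"
        by (auto simp: card_2_iff)
      obtain P where P: "\<And>x. good (P x)" "prescribable P E0"
        "cross3 (anchor v P e1) (anchor v P e2) \<noteq> 0"
        by (rule move_to_two_anchors[OF fin0 P0(2,1) sparse, of e1 v e2]) (use e in auto)
      obtain p where "good p" "prescribable (P(v := p)) E"
        by (rule prescribable_add_vertex_two_edges[OF sparse P(2)[unfolded E0_def], of e1 e2])
          (use e P in auto)
      then show ?thesis
        by (intro exI[of _ "P(v := p)"]) (simp add: P(1))
    next
      case 3
      obtain e1 e2 e3 where star: "star v E = {e1, e2, e3}"
        and dist: "e1 \<noteq> e2" "e1 \<noteq> e3" "e2 \<noteq> e3" and far: "far v e1 \<noteq> v" "far v e2 \<noteq> v"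
        using order_star[OF sparse 3] .
      have in_star: "e1 \<in> star v E" "e2 \<in> star v E" "e3 \<in> star v E"
        by (simp_all add: star)
      have far_E: "far v e \<in> touched E" if "e \<in> star v E" for e
        using far_touched[OF that] .
      show ?thesis
      proof (cases "far v e3 = v \<and> far v e1 = far v e2 \<and>
          (\<exists>x. good x \<and> triple (A (shift v e1) x) (A (shift v e2) x) z = 0)")
        case True
        define a m where "a = far v e1" and "m = shift v e2 - shift v e1"
        obtain x where x: "good x" "triple (A (shift v e1) x) (A (shift v e2) x) z = 0"
          using True by blast
        have "A (shift v e1) (A m x) = A (shift v e2) x"
          by (simp add: m_def flip: A_add)
        then have "triple (A (shift v e1) x) (A (shift v e1) (A m x)) (A (shift v e1) z) = 0"
          using x(2) by (simp only: A_axis)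
        then have dep: "triple z x (A m x) = 0"
          using triple_rotate[of z x "A m x"] by (simp only: triple_A)
        have "A m \<noteq> id"
          using sparse_parallel(2)[OF sparse in_star(1,2) dist(1)] True
            A_eq_A_iff[of "shift v e1" "shift v e2"] unfolding m_def by blast
        then obtain c where c: "c \<noteq> 0" "\<And>y. A m y = - y + (c * bform z y) *\<^sub>R z"
          by (rule half_turn[OF x(1) _ dep]) blast
        have fars: "far v e1 = a" "far v e2 = a" "far v e3 = v" "a \<noteq> v"
          using True far(1) unfolding a_def by simp_all
        have no_block: "\<not> blocks F (a, 1, a)" if "F \<subseteq> E0" for F
          using blocks_loop_contradiction[OF fin sparse star dist fars(1-3) that[unfolded E0_def]]
          by blast
        have "A n \<noteq> id" if "(a, 1, a) = (u, n, u)" for u n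
          using that A_1 by blast
        note dich = sparse_insert_or_blocked[OF fin0 sparse0 this]
        have new: "(a, 1, a) \<notin> E0 \<and> sparse (insert (a, 1, a) E0)"
          by (rule disjE[OF dich]) (use no_block in blast)+
        have sub: "touched (insert (a, 1, a) E0) \<subseteq> touched E - {v}"
          using touched_diff_star[of E v] far(1) far_E[OF in_star(1)] by (auto simp: E0_def a_def)
        have "finite (insert (a, 1, a) E0)"
          using fin0 by simp
        from IH[OF this conjunct2[OF new] sub]
        obtain P where P: "\<And>x. good (P x)" "prescribable P (insert (a, 1, a) E0)"
          by blast
        obtain p where "good p" "prescribable (P(v := p)) E"
          by (rule prescribable_half_turn[OF sparse P(1) star fars c(1) c(2)[unfolded m_def]
                conjunct1[OF new, unfolded E0_def] P(2)[unfolded E0_def]]) blast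
        then show ?thesis
          by (intro exI[of _ "P(v := p)"]) (simp add: P(1))
      next
        case False
        \<comment> \<open>The anchors do not involve the position of \<open>v\<close>, so this applies with and without a bridge.\<close>
        have pos: "\<exists>P. (\<forall>x. good (P x)) \<and> prescribable P E' \<and>
            triple (anchor v P e1) (anchor v P e2) (anchor v P e3) \<noteq> 0"
          if E': "finite E'" "\<forall>x. good (P x)" "prescribable P E'" for E' P
          by (rule move_to_three_anchors[OF E'(1) E'(3) _ sparse in_star dist far])
            (use E' False in auto)
        have bridged: ?thesis
          if ord: "star v E = {f1, f2, f3}" "f1 \<noteq> f2" "f1 \<noteq> f3" "f2 \<noteq> f3" "far v f1 \<noteq> v"
            and new: "bridge v f1 f2 \<notin> E0" "sparse (insert (bridge v f1 f2) E0)"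
            and perm: "\<And>P. triple (anchor v P e1) (anchor v P e2) (anchor v P e3) \<noteq> 0 \<Longrightarrow>
              triple (anchor v P f1) (anchor v P f2) (anchor v P f3) \<noteq> 0"
          for f1 f2 f3
        proof -
          have finb: "finite (insert (bridge v f1 f2) E0)"
            using fin0 by simp
          have sub: "touched (insert (bridge v f1 f2) E0) \<subseteq> touched E - {v}"
            using touched_diff_star[of E v] ends_bridge[OF ord(5), of f2] ord(1,5)
              far_E[of f1] far_E[of f2] by (auto simp: E0_def)
          obtain P' where P': "\<forall>x. good (P' x)" "prescribable P' (insert (bridge v f1 f2) E0)"
            using IH[OF finb new(2) sub] by blast
          obtain P where P: "\<And>x. good (P x)" "prescribable P (insert (bridge v f1 f2) E0)"
            "triple (anchor v P e1) (anchor v P e2) (anchor v P e3) \<noteq> 0"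
            using pos[OF finb P'] by blast
          obtain p where "good p" "prescribable (P(v := p)) E"
            by (rule prescribable_replace_bridge[OF sparse P(1) ord(1,5) new(1)[unfolded E0_def]
                  P(2)[unfolded E0_def] perm[OF P(3)]]) blast
          then show ?thesis
            by (intro exI[of _ "P(v := p)"]) (simp add: P(1))
        qed
        have proper: "A n \<noteq> id" if "bridge v f1 f2 = (u, n, u)" "f1 \<in> star v E" "f2 \<in> star v E"
          "f1 \<noteq> f2" for f1 f2 u n
        proof (cases "far v f2 = v")
          case True
          then show ?thesis
            using that(1) A_1 by (auto simp: bridge_def)
        next
          case False
          then have n: "n = shift v f2 - shift v f1" "far v f1 = far v f2"
            using that(1) by (auto simp: bridge_def)
          then show ?thesis
            using sparse_parallel(2)[OF sparse that(2-4)] A_eq_A_iff[of "shift v f1" "shift v f2"]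
            by simp
        qed
        have dichotomy: "bridge v f1 f2 \<notin> E0 \<and> sparse (insert (bridge v f1 f2) E0) \<or>
            (\<exists>F\<subseteq>E0. blocks F (bridge v f1 f2))"
          if "f1 \<in> star v E" "f2 \<in> star v E" "f1 \<noteq> f2" for f1 f2
          by (rule sparse_insert_or_blocked[OF fin0 sparse0]) (rule proper[OF _ that])
        show ?thesis
        proof (rule ccontr)
          assume no: "\<not> ?thesis"
          have swap: "triple x w y \<noteq> 0" "triple y w x \<noteq> 0" if "triple x y w \<noteq> 0" for x y w
            using that triple_swap'[of x w y] triple_rotate[of x y w] by auto
          have star13: "star v E = {e1, e3, e2}" and star23: "star v E = {e2, e3, e1}"
            by (auto simp: star)
          have "\<not> (bridge v e1 e2 \<notin> E0 \<and> sparse (insert (bridge v e1 e2) E0))"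
            using bridged[OF star dist far(1)] no by blast
          then obtain F12 where F12: "F12 \<subseteq> E0" "blocks F12 (bridge v e1 e2)"
            using dichotomy[OF in_star(1,2) dist(1)] by blast
          have "\<not> (bridge v e1 e3 \<notin> E0 \<and> sparse (insert (bridge v e1 e3) E0))"
            using bridged[OF star13 dist(2,1) dist(3)[symmetric] far(1) _ _ swap(1)] no by blast
          then obtain F13 where F13: "F13 \<subseteq> E0" "blocks F13 (bridge v e1 e3)"
            using dichotomy[OF in_star(1,3) dist(2)] by blast
          have "\<not> (bridge v e2 e3 \<notin> E0 \<and> sparse (insert (bridge v e2 e3) E0))"
            using bridged[OF star23 dist(3) dist(1)[symmetric] dist(2)[symmetric] far(2) _ _ swap(2)]
              no by blast
          then obtain F23 where F23: "F23 \<subseteq> E0" "blocks F23 (bridge v e2 e3)"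
            using dichotomy[OF in_star(2,3) dist(3)] by blast
          obtain P where P: "\<And>x. good (P x)" "prescribable P E0"
            "triple (anchor v P e1) (anchor v P e2) (anchor v P e3) \<noteq> 0"
            using pos[OF fin0 _ P0(2)] P0(1) by blast
          have fins: "finite F12" "finite F13" "finite F23"
            using F12(1) F13(1) F23(1) finite_subset[OF _ fin0] by simp_all
          have pres: "prescribable P F12" "prescribable P F13" "prescribable P F23"
            using F12(1) F13(1) F23(1) prescribable_subset[OF P(2)] by simp_all
          obtain \<theta>12 g12 where b12: "rigid_block v P e1 e2 F12 \<theta>12 g12"
            using rigid_block_exists[OF fins(1) pres(1) P(1) far(1) F12(2)] .
          obtain \<theta>13 g13 where b13: "rigid_block v P e1 e3 F13 \<theta>13 g13"
            using rigid_block_exists[OF fins(2) pres(2) P(1) far(1) F13(2)] .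
          obtain \<theta>23 g23 where b23: "rigid_block v P e2 e3 F23 \<theta>23 g23"
            using rigid_block_exists[OF fins(3) pres(3) P(1) far(2) F23(2)] .
          show False
            by (rule three_blocks_contradiction[OF fin sparse P(1) star dist far P(3)
                  F12(1)[unfolded E0_def] F13(1)[unfolded E0_def] F23(1)[unfolded E0_def] b12 b13 b23])
        qed
      qed
    qed
  qed
qed

end

section \<open>Geodesics of the upper half-plane\<close>

lemma second_order_ode_unique:
  fixes u v :: "real \<Rightarrow> real"
  assumes u: "\<And>t. (u has_real_derivative v t) (at t)"
    and v: "\<And>t. (v has_real_derivative u t) (at t)"
  shows "u t = u 0 * cosh t + v 0 * sinh t" "v t = u 0 * sinh t + v 0 * cosh t"
proof -
  have "((\<lambda>t. u t * cosh t - v t * sinh t) has_real_derivative 0) (at t)" for t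
    by (auto intro!: derivative_eq_intros u v)
  then have a: "u t * cosh t - v t * sinh t = u 0" for t
    using DERIV_isconst_all[of "\<lambda>t. u t * cosh t - v t * sinh t" t 0] by simp
  have "((\<lambda>t. v t * cosh t - u t * sinh t) has_real_derivative 0) (at t)" for t
    by (auto intro!: derivative_eq_intros u v)
  then have b: "v t * cosh t - u t * sinh t = v 0" for t
    using DERIV_isconst_all[of "\<lambda>t. v t * cosh t - u t * sinh t" t 0] by simp
  have c: "(cosh t)\<^sup>2 - (sinh t)\<^sup>2 = 1"
    by (simp add: cosh_square_eq)
  have "u t * ((cosh t)\<^sup>2 - (sinh t)\<^sup>2)
      = (u t * cosh t - v t * sinh t) * cosh t + (v t * cosh t - u t * sinh t) * sinh t"
    by (simp add: algebra_simps power2_eq_square)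
  then show "u t = u 0 * cosh t + v 0 * sinh t"
    unfolding a b c by simp
  have "v t * ((cosh t)\<^sup>2 - (sinh t)\<^sup>2)
      = (u t * cosh t - v t * sinh t) * sinh t + (v t * cosh t - u t * sinh t) * cosh t"
    by (simp add: algebra_simps power2_eq_square)
  then show "v t = u 0 * sinh t + v 0 * cosh t"
    unfolding a b c by simp
qed

text \<open>Along a unit-speed geodesic \<open>x + i y\<close>, the functions \<open>1 / y\<close> and \<open>x / y\<close>, which are
  coordinates of the hyperboloid model, satisfy \<open>u'' = u\<close>.\<close>

lemma unit_speed_geodesic_equations:
  assumes "unit_speed_geodesic \<gamma>"
  obtains a b where
    "\<And>t. 1 / Im (\<gamma> t) = cosh t / Im (\<gamma> 0) + a * sinh t"
    "\<And>t. Re (\<gamma> t) / Im (\<gamma> t) = Re (\<gamma> 0) / Im (\<gamma> 0) * cosh t + b * sinh t"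
    "(b / Im (\<gamma> 0) - Re (\<gamma> 0) / Im (\<gamma> 0) * a)\<^sup>2 + a\<^sup>2 = (1 / Im (\<gamma> 0))\<^sup>2"
proof -
  obtain \<gamma>' where range: "range \<gamma> \<subseteq> upper_half_plane"
    and d1: "\<And>t. (\<gamma> has_vector_derivative \<gamma>' t) (at t)"
    and unit: "\<And>t. hyp_norm (\<gamma> t) (\<gamma>' t) = 1"
    and d2: "\<And>t. (\<gamma>' has_vector_derivative Complex (2 * Re (\<gamma>' t) * Im (\<gamma>' t) / Im (\<gamma> t))
        (((Im (\<gamma>' t))\<^sup>2 - (Re (\<gamma>' t))\<^sup>2) / Im (\<gamma> t))) (at t)"
    using assms unfolding unit_speed_geodesic_def by blast
  define x y x' y' where "x t = Re (\<gamma> t)" "y t = Im (\<gamma> t)" "x' t = Re (\<gamma>' t)" "y' t = Im (\<gamma>' t)" for t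
  note defs = this
  have pos: "y t > 0" for t
    using range by (auto simp: upper_half_plane_def defs)
  have nz: "y t \<noteq> 0" for t
    using pos[of t] by simp
  have speed: "(x' t)\<^sup>2 + (y' t)\<^sup>2 = (y t)\<^sup>2" for t
    using unit[of t] nz[of t] by (simp add: hyp_norm_def defs real_sqrt_eq_1_iff)
  have dx: "(x has_real_derivative x' t) (at t)" and dy: "(y has_real_derivative y' t) (at t)" for t
    using d1[of t] unfolding has_vector_derivative_complex_iff defs by simp_all
  have dx': "(x' has_real_derivative 2 * x' t * y' t / y t) (at t)"
    and dy': "(y' has_real_derivative ((y' t)\<^sup>2 - (x' t)\<^sup>2) / y t) (at t)" for t
    using d2[of t] unfolding has_vector_derivative_complex_iff defs by simp_all
  have u: "((\<lambda>t. 1 / y t) has_real_derivative - y' t / (y t)\<^sup>2) (at t)" for t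
    using nz by (auto intro!: derivative_eq_intros dy simp: power2_eq_square)
  have u': "((\<lambda>t. - y' t / (y t)\<^sup>2) has_real_derivative 1 / y t) (at t)" for t
  proof -
    have "((\<lambda>t. - y' t / (y t)\<^sup>2) has_real_derivative ((x' t)\<^sup>2 + (y' t)\<^sup>2) / (y t)^3) (at t)"
      using nz by (auto intro!: derivative_eq_intros dy dy'
          simp: field_simps power2_eq_square power3_eq_cube power4_eq_xxxx)
    moreover have "((x' t)\<^sup>2 + (y' t)\<^sup>2) / (y t)^3 = 1 / y t"
      unfolding speed using nz[of t] by (simp add: power2_eq_square power3_eq_cube)
    ultimately show ?thesis by simp
  qed
  define w' where "w' t = x' t / y t - x t * y' t / (y t)\<^sup>2" for t
  have w: "((\<lambda>t. x t / y t) has_real_derivative w' t) (at t)" for t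
    unfolding w'_def using nz
    by (auto intro!: derivative_eq_intros dx dy simp: field_simps power2_eq_square)
  have w': "(w' has_real_derivative x t / y t) (at t)" for t
  proof -
    have "((\<lambda>t. x' t / y t) has_real_derivative x' t * y' t / (y t)\<^sup>2) (at t)"
      using nz by (auto intro!: derivative_eq_intros dy dx' simp: field_simps power2_eq_square)
    moreover have "((\<lambda>t. x t * (- y' t / (y t)\<^sup>2)) has_real_derivative
        x' t * (- y' t / (y t)\<^sup>2) + 1 / y t * x t) (at t)"
      by (rule DERIV_mult[OF dx u'])
    ultimately have "((\<lambda>t. x' t / y t + x t * (- y' t / (y t)\<^sup>2)) has_real_derivative
        x' t * y' t / (y t)\<^sup>2 + (x' t * (- y' t / (y t)\<^sup>2) + 1 / y t * x t)) (at t)"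
      by (rule DERIV_add)
    moreover have "w' = (\<lambda>t. x' t / y t + x t * (- y' t / (y t)\<^sup>2))"
      by (auto simp: w'_def)
    ultimately show ?thesis by simp
  qed
  show ?thesis
  proof (rule that)
    show "1 / Im (\<gamma> t) = cosh t / Im (\<gamma> 0) + (- y' 0 / (y 0)\<^sup>2) * sinh t" for t
      using second_order_ode_unique(1)[OF u u', of t] by (simp add: defs)
    show "Re (\<gamma> t) / Im (\<gamma> t) = Re (\<gamma> 0) / Im (\<gamma> 0) * cosh t + w' 0 * sinh t" for t
      using second_order_ode_unique(1)[OF w w', of t] by (simp add: defs)
    have "w' 0 / y 0 - x 0 / y 0 * (- y' 0 / (y 0)\<^sup>2) = x' 0 / (y 0)\<^sup>2"
      using nz[of 0] by (simp add: w'_def field_simps power2_eq_square)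
    moreover have "(x' 0 / (y 0)\<^sup>2)\<^sup>2 + (- y' 0 / (y 0)\<^sup>2)\<^sup>2 = (1 / y 0)\<^sup>2"
    proof -
      have "(x' 0 / (y 0)\<^sup>2)\<^sup>2 + (- y' 0 / (y 0)\<^sup>2)\<^sup>2 = ((x' 0)\<^sup>2 + (y' 0)\<^sup>2) / ((y 0)\<^sup>2)\<^sup>2"
        by (simp add: power_divide add_divide_distrib)
      then show ?thesis
        unfolding speed using nz[of 0] by (simp add: power_divide power2_eq_square)
    qed
    ultimately show "(w' 0 / Im (\<gamma> 0) - Re (\<gamma> 0) / Im (\<gamma> 0) * (- y' 0 / (y 0)\<^sup>2))\<^sup>2
        + (- y' 0 / (y 0)\<^sup>2)\<^sup>2 = (1 / Im (\<gamma> 0))\<^sup>2"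
      by (simp add: defs)
  qed
qed

definition cosh_dist :: "complex \<Rightarrow> complex \<Rightarrow> real" where
  "cosh_dist P Q = ((Re Q - Re P)\<^sup>2 + (Im P)\<^sup>2 + (Im Q)\<^sup>2) / (2 * Im P * Im Q)"

lemma cosh_dist_gt_1:
  assumes "P \<in> upper_half_plane" "Q \<in> upper_half_plane" "P \<noteq> Q"
  shows "cosh_dist P Q > 1"
proof -
  have pos: "Im P > 0" "Im Q > 0"
    using assms by (auto simp: upper_half_plane_def)
  have "(Re Q - Re P)\<^sup>2 + (Im Q - Im P)\<^sup>2 > 0"
    using assms(3) by (auto simp: sum_power2_gt_zero_iff complex_eq_iff)
  then have "2 * Im P * Im Q < (Re Q - Re P)\<^sup>2 + (Im P)\<^sup>2 + (Im Q)\<^sup>2"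
    by (simp add: power2_eq_square algebra_simps)
  then show ?thesis
    using pos by (simp add: cosh_dist_def)
qed

text \<open>With \<open>C = cosh t\<close> and \<open>S = sinh t\<close>, the time at which a geodesic of unit speed reaches a point depends
  only on its two end points, not on its initial velocity.\<close>

lemma geodesic_time:
  fixes u0 w0 u1 w1 a b C S :: real
  assumes u: "u1 = u0 * C + a * S" and w: "w1 = w0 * C + b * S"
    and unit: "(b * u0 - w0 * a)\<^sup>2 + a\<^sup>2 = u0\<^sup>2" and CS: "C\<^sup>2 - S\<^sup>2 = 1"
  shows "2 * u0 * u1 * C = (w1 * u0 - w0 * u1)\<^sup>2 + u0\<^sup>2 + u1\<^sup>2"
proof -
  have "w1 * u0 - w0 * u1 = (b * u0 - w0 * a) * S"
    unfolding u w by (simp add: algebra_simps)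
  moreover have "u1 - u0 * C = a * S"
    unfolding u by simp
  ultimately have "(w1 * u0 - w0 * u1)\<^sup>2 + (u1 - u0 * C)\<^sup>2 = ((b * u0 - w0 * a)\<^sup>2 + a\<^sup>2) * S\<^sup>2"
    by (simp only: power_mult_distrib distrib_right)
  also have "\<dots> = u0\<^sup>2 * (C\<^sup>2 - 1)"
    unfolding unit using CS by simp
  finally show ?thesis
    by (simp add: power2_eq_square algebra_simps)
qed

text \<open>The time of arrival is determined by the end points. The coordinates at that time and at time \<open>0\<close> then
  determine the two coordinate functions of the hyperboloid model.\<close>

lemma unit_speed_geodesic_unique:
  assumes \<gamma>1: "unit_speed_geodesic \<gamma>1" "\<gamma>1 0 = P" "\<gamma>1 t1 = Q" "t1 > 0"
    and \<gamma>2: "unit_speed_geodesic \<gamma>2" "\<gamma>2 0 = P" "\<gamma>2 t2 = Q" "t2 > 0"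
  shows "\<gamma>1 = \<gamma>2"
proof -
  have upper: "Im (\<gamma> t) > 0" if "unit_speed_geodesic \<gamma>" for \<gamma> t
    using that by (auto simp: unit_speed_geodesic_def upper_half_plane_def)
  have pos: "Im P > 0" "Im Q > 0"
    using upper[OF \<gamma>1(1)] \<gamma>1 by auto
  have CS: "(cosh t)\<^sup>2 - (sinh t)\<^sup>2 = 1" for t :: real
    by (simp add: cosh_square_eq)
  obtain a1 b1 where 1:
    "\<And>t. 1 / Im (\<gamma>1 t) = cosh t / Im P + a1 * sinh t"
    "\<And>t. Re (\<gamma>1 t) / Im (\<gamma>1 t) = Re P / Im P * cosh t + b1 * sinh t"
    "(b1 / Im P - Re P / Im P * a1)\<^sup>2 + a1\<^sup>2 = (1 / Im P)\<^sup>2"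
    using unit_speed_geodesic_equations[OF \<gamma>1(1)] unfolding \<gamma>1(2) by blast
  obtain a2 b2 where 2:
    "\<And>t. 1 / Im (\<gamma>2 t) = cosh t / Im P + a2 * sinh t"
    "\<And>t. Re (\<gamma>2 t) / Im (\<gamma>2 t) = Re P / Im P * cosh t + b2 * sinh t"
    "(b2 / Im P - Re P / Im P * a2)\<^sup>2 + a2\<^sup>2 = (1 / Im P)\<^sup>2"
    using unit_speed_geodesic_equations[OF \<gamma>2(1)] unfolding \<gamma>2(2) by blast
  have "2 * (1 / Im P) * (1 / Im Q) * cosh t1
      = (Re Q / Im Q * (1 / Im P) - Re P / Im P * (1 / Im Q))\<^sup>2 + (1 / Im P)\<^sup>2 + (1 / Im Q)\<^sup>2"
    by (rule geodesic_time[OF _ _ _ CS[of t1], where a = a1 and b = b1])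
      (use 1(1,2)[of t1] 1(3) \<gamma>1(3) pos in auto)
  moreover have "2 * (1 / Im P) * (1 / Im Q) * cosh t2
      = (Re Q / Im Q * (1 / Im P) - Re P / Im P * (1 / Im Q))\<^sup>2 + (1 / Im P)\<^sup>2 + (1 / Im Q)\<^sup>2"
    by (rule geodesic_time[OF _ _ _ CS[of t2], where a = a2 and b = b2])
      (use 2(1,2)[of t2] 2(3) \<gamma>2(3) pos in auto)
  ultimately have "2 * (1 / Im P) * (1 / Im Q) * cosh t1 = 2 * (1 / Im P) * (1 / Im Q) * cosh t2"
    by (rule trans_sym)
  moreover have "2 * (1 / Im P) * (1 / Im Q) \<noteq> 0"
    using pos by simp
  ultimately have "cosh t1 = cosh t2"
    by (rule mult_left_cancel[THEN iffD1, rotated])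
  then have t: "t1 = t2"
    using \<gamma>1(4) \<gamma>2(4) by simp
  have s: "sinh t1 \<noteq> 0"
    using \<gamma>1(4) by simp
  have "a1 * sinh t1 = a2 * sinh t1" "b1 * sinh t1 = b2 * sinh t1"
    using 1(1,2)[of t1] 2(1,2)[of t1] \<gamma>1(3) \<gamma>2(3) t by auto
  then have eq: "a1 = a2" "b1 = b2"
    using s by simp_all
  show ?thesis
  proof
    fix t
    have "1 / Im (\<gamma>1 t) = 1 / Im (\<gamma>2 t)"
      "Re (\<gamma>1 t) / Im (\<gamma>1 t) = Re (\<gamma>2 t) / Im (\<gamma>2 t)"
      unfolding 1 2 eq by simp_all
    then show "\<gamma>1 t = \<gamma>2 t"
      using upper[OF \<gamma>1(1), of t] upper[OF \<gamma>2(1), of t] by (simp add: complex_eq_iff)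
  qed
qed

text \<open>The unit speed condition amounts to a conservation law, since the Wronskian of \<open>u\<close> and \<open>w\<close> and the
  difference of the squares of \<open>u\<close> and its derivative are constant.\<close>

lemma geodesic_from_hyperboloid:
  fixes u0 w0 a b :: real
  assumes u0: "u0 > 0" and unit: "(b * u0 - w0 * a)\<^sup>2 + a\<^sup>2 = u0\<^sup>2"
  defines "u \<equiv> \<lambda>t. u0 * cosh t + a * sinh t" and "w \<equiv> \<lambda>t. w0 * cosh t + b * sinh t"
  defines "\<gamma> \<equiv> \<lambda>t. Complex (w t / u t) (1 / u t)"
  shows "unit_speed_geodesic \<gamma>"
    "vector_derivative \<gamma> (at 0) = Complex ((b * u0 - w0 * a) / u0\<^sup>2) (- a / u0\<^sup>2)"
proof -
  define k where "k = b * u0 - w0 * a"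
  define u' where "u' t = u0 * sinh t + a * cosh t" for t
  define w' where "w' t = w0 * sinh t + b * cosh t" for t
  have CS: "(cosh t)\<^sup>2 - (sinh t)\<^sup>2 = 1" for t :: real
    by (simp add: cosh_square_eq)
  have pos: "u t > 0" for t
  proof -
    have "a\<^sup>2 \<le> u0\<^sup>2"
      unfolding unit[symmetric] by simp
    then have a: "\<bar>a\<bar> \<le> u0"
      using u0 by (simp add: abs_le_square_iff[symmetric])
    have "\<bar>sinh t\<bar>\<^sup>2 < (cosh t)\<^sup>2"
      unfolding power2_abs using CS[of t] by linarith
    then have s: "\<bar>sinh t\<bar> < cosh t"
      by (rule power2_less_imp_less) (rule cosh_real_nonneg)
    have "\<bar>a * sinh t\<bar> \<le> u0 * \<bar>sinh t\<bar>"
      unfolding abs_mult using a by (intro mult_right_mono) auto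
    also have "\<dots> < u0 * cosh t"
      using u0 s by simp
    finally show ?thesis
      by (simp add: u_def abs_less_iff)
  qed
  have nz: "u t \<noteq> 0" for t
    using pos[of t] by simp
  have du: "(u has_real_derivative u' t) (at t)" and du': "(u' has_real_derivative u t) (at t)"
    and dw: "(w has_real_derivative w' t) (at t)" for t
    unfolding u_def w_def u'_def w'_def by (auto intro!: derivative_eq_intros)
  have wronskian: "w' t * u t - w t * u' t = k" for t
  proof -
    have "w' t * u t - w t * u' t = k * ((cosh t)\<^sup>2 - (sinh t)\<^sup>2)"
      unfolding u_def w_def u'_def w'_def k_def by (simp add: algebra_simps power2_eq_square)
    then show ?thesis unfolding CS by simp
  qed
  have speed: "k\<^sup>2 + (u' t)\<^sup>2 = (u t)\<^sup>2" for t
  proof -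
    have "(u t)\<^sup>2 - (u' t)\<^sup>2 = (u0\<^sup>2 - a\<^sup>2) * ((cosh t)\<^sup>2 - (sinh t)\<^sup>2)"
      unfolding u_def u'_def by (simp add: algebra_simps power2_eq_square)
    then show ?thesis
      using unit unfolding CS k_def by simp
  qed
  define \<gamma>' where "\<gamma>' t = Complex (k / (u t)\<^sup>2) (- u' t / (u t)\<^sup>2)" for t
  have d1: "(\<gamma> has_vector_derivative \<gamma>' t) (at t)" for t
  proof -
    have "((\<lambda>t. w t / u t) has_real_derivative (w' t * u t - w t * u' t) / (u t * u t)) (at t)"
      using nz by (auto intro!: derivative_eq_intros du dw)
    moreover have "((\<lambda>t. 1 / u t) has_real_derivative - u' t / (u t)\<^sup>2) (at t)"
      using nz by (auto intro!: derivative_eq_intros du simp: power2_eq_square)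
    ultimately show ?thesis
      unfolding has_vector_derivative_complex_iff \<gamma>_def \<gamma>'_def wronskian
      by (simp add: power2_eq_square)
  qed
  have d2: "(\<gamma>' has_vector_derivative Complex (2 * Re (\<gamma>' t) * Im (\<gamma>' t) / Im (\<gamma> t))
        (((Im (\<gamma>' t))\<^sup>2 - (Re (\<gamma>' t))\<^sup>2) / Im (\<gamma> t))) (at t)" for t
  proof -
    have a1: "((\<lambda>t. k / (u t)\<^sup>2) has_real_derivative - 2 * k * u' t / (u t)^3) (at t)"
      using nz by (auto intro!: derivative_eq_intros du
          simp: field_simps power2_eq_square power3_eq_cube power4_eq_xxxx)
    have e1: "- 2 * k * u' t / (u t)^3 = 2 * Re (\<gamma>' t) * Im (\<gamma>' t) / Im (\<gamma> t)"
      using nz[of t] by (simp add: \<gamma>_def \<gamma>'_def field_simps power2_eq_square power3_eq_cube)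
    have a2: "((\<lambda>t. - u' t / (u t)\<^sup>2) has_real_derivative
        (2 * (u' t)\<^sup>2 - (u t)\<^sup>2) / (u t)^3) (at t)"
      using nz by (auto intro!: derivative_eq_intros du du'
          simp: field_simps power2_eq_square power3_eq_cube power4_eq_xxxx)
    have e2: "(2 * (u' t)\<^sup>2 - (u t)\<^sup>2) / (u t)^3
        = ((Im (\<gamma>' t))\<^sup>2 - (Re (\<gamma>' t))\<^sup>2) / Im (\<gamma> t)"
    proof -
      have "((Im (\<gamma>' t))\<^sup>2 - (Re (\<gamma>' t))\<^sup>2) / Im (\<gamma> t) = ((u' t)\<^sup>2 - k\<^sup>2) / (u t)^3"
        using nz[of t] by (simp add: \<gamma>_def \<gamma>'_def power2_eq_square power3_eq_cube field_simps)
      then show ?thesis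
        unfolding speed[of t, symmetric] by simp
    qed
    have re: "(\<lambda>t. Re (\<gamma>' t)) = (\<lambda>t. k / (u t)\<^sup>2)" and im: "(\<lambda>t. Im (\<gamma>' t)) = (\<lambda>t. - u' t / (u t)\<^sup>2)"
      by (simp_all add: \<gamma>'_def)
    show ?thesis
      unfolding has_vector_derivative_complex_iff complex.sel re im
      using a1[unfolded e1] a2[unfolded e2] by (rule conjI)
  qed
  have unit': "hyp_norm (\<gamma> t) (\<gamma>' t) = 1" for t
  proof -
    have "((k / (u t)\<^sup>2)\<^sup>2 + (- u' t / (u t)\<^sup>2)\<^sup>2) / (1 / u t)\<^sup>2 = (k\<^sup>2 + (u' t)\<^sup>2) / (u t)\<^sup>2"
      using nz[of t] by (simp add: power2_eq_square field_simps)
    then show ?thesis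
      unfolding hyp_norm_def \<gamma>_def \<gamma>'_def complex.sel using nz[of t] speed[of t]
      by (simp only: div_self power_eq_0_iff real_sqrt_one simp_thms)
  qed
  have "range \<gamma> \<subseteq> upper_half_plane"
    using pos by (auto simp: upper_half_plane_def \<gamma>_def)
  then show "unit_speed_geodesic \<gamma>"
    unfolding unit_speed_geodesic_def using d1 d2 unit' by blast
  show "vector_derivative \<gamma> (at 0) = Complex ((b * u0 - w0 * a) / u0\<^sup>2) (- a / u0\<^sup>2)"
    using vector_derivative_at[OF d1[of 0]] by (simp add: \<gamma>'_def k_def u_def u'_def)
qed

lemma geodesic_direction_eq:
  assumes P: "P \<in> upper_half_plane" and Q: "Q \<in> upper_half_plane" and ne: "P \<noteq> Q"
  shows "geodesic_direction P Q = (1 / (2 * Im Q * sqrt ((cosh_dist P Q)\<^sup>2 - 1))) *\<^sub>R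
    Complex (2 * (Re Q - Re P) * Im P) ((Re Q - Re P)\<^sup>2 + (Im Q)\<^sup>2 - (Im P)\<^sup>2)"
proof -
  have pos: "Im P > 0" "Im Q > 0"
    using P Q by (auto simp: upper_half_plane_def)
  define C where "C = cosh_dist P Q"
  have C: "C > 1"
    unfolding C_def by (rule cosh_dist_gt_1[OF assms])
  define T where "T = arcosh C"
  have T: "cosh T = C" "T > 0"
    using C arcosh_nonneg_real[of C] arcosh_eq_0_iff_real[of C] by (auto simp: T_def less_le)
  define S where "S = sinh T"
  have S: "S > 0" "C\<^sup>2 - S\<^sup>2 = 1"
    using T cosh_square_eq[of T] by (auto simp: S_def)
  have S_sqrt: "S = sqrt (C\<^sup>2 - 1)"
    using S by (metis add_diff_cancel_left' diff_add_cancel diff_diff_eq2 less_le real_sqrt_unique)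
  define u0 w0 u1 w1 where "u0 = 1 / Im P" "w0 = Re P / Im P" "u1 = 1 / Im Q" "w1 = Re Q / Im Q"
  note defs = this
  have u0: "u0 > 0"
    using pos by (simp add: defs)
  have D: "w1 * u0 - w0 * u1 = (Re Q - Re P) * u0 * u1"
    by (simp add: defs algebra_simps diff_divide_distrib)
  have C_eq: "2 * u0 * u1 * C = (w1 * u0 - w0 * u1)\<^sup>2 + u0\<^sup>2 + u1\<^sup>2"
  proof -
    have "2 * u0 * u1 * C = (u0 * u1)\<^sup>2 * ((Re Q - Re P)\<^sup>2 + (Im P)\<^sup>2 + (Im Q)\<^sup>2)"
      using pos by (simp add: defs C_def cosh_dist_def power2_eq_square field_simps)
    also have "\<dots> = ((Re Q - Re P) * u0 * u1)\<^sup>2 + (u0 * u1)\<^sup>2 * (Im Q)\<^sup>2 + (u0 * u1)\<^sup>2 * (Im P)\<^sup>2"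
      by (simp add: algebra_simps power2_eq_square)
    also have "(u0 * u1)\<^sup>2 * (Im Q)\<^sup>2 = u0\<^sup>2"
      using pos by (simp add: defs power2_eq_square)
    also have "(u0 * u1)\<^sup>2 * (Im P)\<^sup>2 = u1\<^sup>2"
      using pos by (simp add: defs power2_eq_square)
    finally show ?thesis
      unfolding D .
  qed
  define a b where "a = (u1 - u0 * C) / S" "b = (w1 - w0 * C) / S"
  note ab = this
  have k: "b * u0 - w0 * a = (w1 * u0 - w0 * u1) / S"
    using S(1) by (simp add: ab field_simps)
  have "(b * u0 - w0 * a)\<^sup>2 + a\<^sup>2 = ((w1 * u0 - w0 * u1)\<^sup>2 + (u1 - u0 * C)\<^sup>2) / S\<^sup>2"
    unfolding k by (simp add: ab power_divide add_divide_distrib)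
  also have "(w1 * u0 - w0 * u1)\<^sup>2 + (u1 - u0 * C)\<^sup>2 = u0\<^sup>2 * S\<^sup>2"
  proof -
    have "u0\<^sup>2 * S\<^sup>2 = u0\<^sup>2 * (C\<^sup>2 - 1)"
      using S(2) by simp
    then show ?thesis
      using C_eq by (simp add: power2_eq_square algebra_simps)
  qed
  finally have unit: "(b * u0 - w0 * a)\<^sup>2 + a\<^sup>2 = u0\<^sup>2"
    using S(1) by simp
  define \<gamma> where
    "\<gamma> t = Complex ((w0 * cosh t + b * sinh t) / (u0 * cosh t + a * sinh t))
       (1 / (u0 * cosh t + a * sinh t))" for t
  have \<gamma>: "unit_speed_geodesic \<gamma>"
      "vector_derivative \<gamma> (at 0) = Complex ((b * u0 - w0 * a) / u0\<^sup>2) (- a / u0\<^sup>2)"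
    using geodesic_from_hyperboloid[OF u0 unit] unfolding \<gamma>_def by blast+
  have \<gamma>0: "\<gamma> 0 = P"
    using pos by (simp add: \<gamma>_def defs complex_eq_iff)
  have "u0 * cosh T + a * sinh T = u1" "w0 * cosh T + b * sinh T = w1"
    using S(1) by (simp_all add: ab T flip: S_def)
  then have \<gamma>T: "\<gamma> T = Q"
    using pos by (simp add: \<gamma>_def defs complex_eq_iff)
  have "geodesic_through P Q = \<gamma>"
    unfolding geodesic_through_def
  proof (rule the_equality)
    show "unit_speed_geodesic \<gamma> \<and> \<gamma> 0 = P \<and> (\<exists>t>0. \<gamma> t = Q)"
      using \<gamma> \<gamma>0 \<gamma>T T by blast
    show "\<gamma>1 = \<gamma>" if "unit_speed_geodesic \<gamma>1 \<and> \<gamma>1 0 = P \<and> (\<exists>t>0. \<gamma>1 t = Q)" for \<gamma>1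
      using that unit_speed_geodesic_unique[OF _ _ _ _ \<gamma>(1) \<gamma>0 \<gamma>T T(2)] by blast
  qed
  then have dir: "geodesic_direction P Q = Complex ((b * u0 - w0 * a) / u0\<^sup>2) (- a / u0\<^sup>2)"
    using ne \<gamma>(2) by (simp add: geodesic_direction_def)
  have "(b * u0 - w0 * a) / u0\<^sup>2 = 1 / (2 * Im Q * S) * (2 * (Re Q - Re P) * Im P)"
    unfolding k D using pos S(1) by (simp add: defs field_simps power2_eq_square)
  moreover have "- a / u0\<^sup>2 = 1 / (2 * Im Q * S) * ((Re Q - Re P)\<^sup>2 + (Im Q)\<^sup>2 - (Im P)\<^sup>2)"
  proof -
    have "2 * u1 * (u0 * C - u1) = ((Re Q - Re P) * u0 * u1)\<^sup>2 + u0\<^sup>2 - u1\<^sup>2"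
      using C_eq unfolding D by (simp add: algebra_simps power2_eq_square)
    also have "\<dots> = (u0 * u1)\<^sup>2 * ((Re Q - Re P)\<^sup>2 + (Im Q)\<^sup>2 - (Im P)\<^sup>2)"
      using pos by (simp add: defs field_simps power2_eq_square)
    also have "\<dots> = 2 * u1 * (u0\<^sup>2 * u1 * ((Re Q - Re P)\<^sup>2 + (Im Q)\<^sup>2 - (Im P)\<^sup>2) / 2)"
      by (simp only: power2_eq_square times_divide_eq_right) (simp add: algebra_simps)
    finally have "(2 * u1) * (u0 * C - u1)
        = (2 * u1) * (u0\<^sup>2 * u1 * ((Re Q - Re P)\<^sup>2 + (Im Q)\<^sup>2 - (Im P)\<^sup>2) / 2)" .
    moreover have "2 * u1 \<noteq> 0"
      using pos by (simp add: defs)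
    ultimately have "u0 * C - u1 = u0\<^sup>2 * u1 * ((Re Q - Re P)\<^sup>2 + (Im Q)\<^sup>2 - (Im P)\<^sup>2) / 2"
      by (rule mult_left_cancel[THEN iffD1, rotated])
    moreover have "- a / u0\<^sup>2 = (u0 * C - u1) / (S * u0\<^sup>2)"
      by (simp add: ab minus_divide_left)
    ultimately have "- a / u0\<^sup>2
        = (u0\<^sup>2 * u1 * ((Re Q - Re P)\<^sup>2 + (Im Q)\<^sup>2 - (Im P)\<^sup>2) / 2) / (S * u0\<^sup>2)"
      by (simp only:)
    also have "\<dots> = u1 * ((Re Q - Re P)\<^sup>2 + (Im Q)\<^sup>2 - (Im P)\<^sup>2) / (2 * S)"
      using u0 by simp
    finally show ?thesis
      using pos by (simp add: defs)
  qed
  ultimately show ?thesis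
    unfolding dir S_sqrt[unfolded C_def, symmetric] by (simp add: complex_eq_iff)
qed

section \<open>The linear model\<close>

text \<open>The isometry onto the hyperboloid \<open>qform = 1\<close>. It turns Moebius transformations into linear maps.\<close>

definition hyperboloid :: "complex \<Rightarrow> real^3" where
  "hyperboloid P = vector [((Re P)\<^sup>2 + (Im P)\<^sup>2) / Im P, Re P / Im P, 1 / Im P]"

text \<open>The value at \<open>P\<close> of the Killing field that belongs to \<open>X\<close>, divided by \<open>(Im P)\<^sup>2\<close>,
  because directions are paired with it by the Euclidean inner product instead of the hyperbolic
  one.\<close>

definition velocity :: "complex \<Rightarrow> real^3 \<Rightarrow> complex" where
  "velocity P X = (1 / Im P) *\<^sub>R Complex
     ((- X$1 + 2 * Re P * X$2 + ((Im P)\<^sup>2 - (Re P)\<^sup>2) * X$3) / (2 * Im P)) (X$2 - Re P * X$3)"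

lemma velocity_surj:
  assumes "P \<in> upper_half_plane"
  obtains X where "velocity P X = m"
proof
  have "Im P > 0"
    using assms by (simp add: upper_half_plane_def)
  then show "velocity P (vector [2 * Re P * Im P * Im m - 2 * (Im P)\<^sup>2 * Re m, Im P * Im m, 0]) = m"
    by (simp add: velocity_def complex_eq_iff field_simps power2_eq_square)
qed

lemma bform_hyperboloid:
  assumes "P \<in> upper_half_plane" "Q \<in> upper_half_plane"
  shows "bform (hyperboloid P) (hyperboloid Q) = 2 * cosh_dist P Q"
proof -
  have "Im P \<noteq> 0" "Im Q \<noteq> 0"
    using assms by (auto simp: upper_half_plane_def)
  then show ?thesis
    by (simp add: bform_def hyperboloid_def cosh_dist_def field_simps power2_eq_square)
qed

lemma hyperboloid_in_cone:
  assumes "P \<in> upper_half_plane"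
  shows "qform (hyperboloid P) = 1" "hyperboloid P \<in> cone"
proof -
  have "Im P > 0"
    using assms by (simp add: upper_half_plane_def)
  then show "qform (hyperboloid P) = 1"
    by (simp add: qform_def hyperboloid_def field_simps power2_eq_square)
  then show "hyperboloid P \<in> cone"
    using \<open>Im P > 0\<close> by (simp add: cone_def hyperboloid_def)
qed

lemma cone_hyperboloid:
  assumes "x \<in> cone"
  obtains P s where "P \<in> upper_half_plane" "s > 0" "x = s *\<^sub>R hyperboloid P"
proof -
  have q: "qform x > 0" "x$3 > 0"
    using assms by (auto simp: cone_def)
  define s where "s = sqrt (qform x)"
  have s: "s > 0" "s * s = x$1 * x$3 - x$2 * x$2"
    using q by (simp_all add: s_def) (simp add: qform_def power2_eq_square)
  define P where "P = Complex (x$2 / x$3) (s / x$3)"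
  have x: "x = s *\<^sub>R hyperboloid P"
    unfolding vec_eq_iff forall_3 hyperboloid_def P_def using s q
    by (simp add: field_simps power2_eq_square)
  have "P \<in> upper_half_plane"
    using s(1) q(2) by (simp add: P_def upper_half_plane_def)
  then show ?thesis
    using s(1) x by (rule that)
qed

text \<open>The cross product of two points of the hyperboloid represents the direction from one to the other,
  with length the hyperbolic sine of the distance.\<close>

lemma geodesic_direction_velocity:
  assumes P: "P \<in> upper_half_plane" and Q: "Q \<in> upper_half_plane"
  shows "geodesic_direction P Q \<bullet> velocity P X
    = triple X (hyperboloid P) (hyperboloid Q) / (2 * sqrt ((cosh_dist P Q)\<^sup>2 - 1))"
proof (cases "P = Q")
  case True
  then show ?thesis by (simp add: geodesic_direction_def)
next
  case False
  have pos: "Im P > 0" "Im Q > 0"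
    using P Q by (auto simp: upper_half_plane_def)
  define S where "S = sqrt ((cosh_dist P Q)\<^sup>2 - 1)"
  have "S > 0"
    using cosh_dist_gt_1[OF P Q False] by (simp add: S_def power_strict_mono[of 1 _ 2, simplified])
  then show ?thesis
    unfolding geodesic_direction_eq[OF P Q False] S_def[symmetric] using pos
    by (simp add: velocity_def inner_complex_def triple_component hyperboloid_def field_simps
        power2_eq_square)
qed

section \<open>Cyclic subgroups of PSL(2,R) in the linear model\<close>

text \<open>The action \<open>S \<mapsto> M S M\<^sup>T\<close> on symmetric matrices, where \<open>x\<close> stands for the symmetric matrix with
  rows \<open>(x$1, x$2)\<close> and \<open>(x$2, x$3)\<close>.\<close>

definition rho :: "real^2^2 \<Rightarrow> real^3 \<Rightarrow> real^3" where
  "rho M x = vector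
     [(M$1$1)\<^sup>2 * x$1 + 2 * M$1$1 * M$1$2 * x$2 + (M$1$2)\<^sup>2 * x$3,
      M$1$1 * M$2$1 * x$1 + (M$1$1 * M$2$2 + M$1$2 * M$2$1) * x$2 + M$1$2 * M$2$2 * x$3,
      (M$2$1)\<^sup>2 * x$1 + 2 * M$2$1 * M$2$2 * x$2 + (M$2$2)\<^sup>2 * x$3]"

lemma rho_component:
  "rho M x $ 1 = (M$1$1)\<^sup>2 * x$1 + 2 * M$1$1 * M$1$2 * x$2 + (M$1$2)\<^sup>2 * x$3"
  "rho M x $ 2 = M$1$1 * M$2$1 * x$1 + (M$1$1 * M$2$2 + M$1$2 * M$2$1) * x$2 + M$1$2 * M$2$2 * x$3"
  "rho M x $ 3 = (M$2$1)\<^sup>2 * x$1 + 2 * M$2$1 * M$2$2 * x$2 + (M$2$2)\<^sup>2 * x$3"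
  by (simp_all add: rho_def)

lemma linear_rho: "linear (rho M)"
  by (rule linearI) (simp_all add: vec_eq_iff forall_3 rho_component algebra_simps)

lemma matrix_mult_component_2:
  fixes M N :: "real^2^2"
  shows "(M ** N)$i$j = M$i$1 * N$1$j + M$i$2 * N$2$j"
  by (simp add: matrix_matrix_mult_def sum_2)

lemma rho_mult: "rho (M ** N) x = rho M (rho N x)"
  unfolding vec_eq_iff forall_3 rho_component matrix_mult_component_2
  by (simp add: algebra_simps power2_eq_square)

lemma rho_one: "rho (mat 1) x = x"
  by (simp add: vec_eq_iff forall_3 rho_component mat_def)

lemma rho_uminus: "rho (- M) x = rho M x"
  by (simp add: vec_eq_iff forall_3 rho_component)

lemma rho_det:
  fixes M :: "real^2^2"
  shows "triple (rho M x) (rho M y) (rho M w) = (det M)^3 * triple x y w"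
  unfolding triple_component rho_component det_2
  by (simp add: algebra_simps power2_eq_square power3_eq_cube)

lemma qform_rho: "qform (rho M x) = (det M)\<^sup>2 * qform x"
  unfolding qform_def rho_component det_2 by (simp add: algebra_simps power2_eq_square)

lemma cone_rho:
  assumes "det M = 1" "x \<in> cone"
  shows "rho M x \<in> cone"
proof -
  have x: "qform x > 0" "x$3 > 0"
    using assms by (auto simp: cone_def)
  have "x$1 * x$3 > (x$2)\<^sup>2"
    using x(1) by (simp add: qform_def)
  then have "x$1 * x$3 > 0"
    by (rule le_less_trans[OF zero_le_power2])
  then have x1: "x$1 > 0"
    using x(2) by (simp add: zero_less_mult_iff)
  have "x$1 * rho M x $ 3 = (M$2$1 * x$1 + M$2$2 * x$2)\<^sup>2 + (M$2$2)\<^sup>2 * qform x"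
    by (simp add: rho_component qform_def power2_eq_square algebra_simps)
  also have "\<dots> > 0"
  proof (cases "M$2$2 = 0")
    case True
    then have "M$2$1 \<noteq> 0"
      using assms(1) by (auto simp: det_2)
    then show ?thesis
      using True x1 by simp
  next
    case False
    then show ?thesis
      using x(1) by (simp add: add_nonneg_pos)
  qed
  finally have "rho M x $ 3 > 0"
    using x1 by (simp add: zero_less_mult_iff)
  then show ?thesis
    using x assms(1) by (simp add: cone_def qform_rho)
qed

lemma rho_eq_id_iff:
  assumes "det M = 1"
  shows "rho M = id \<longleftrightarrow> M = mat 1 \<or> M = - mat 1"
proof
  assume id: "rho M = id"
  have "rho M (axis 1 1) = axis 1 1" "rho M (axis 3 1) = axis 3 1"
    by (simp_all add: id)
  then have e: "(M$1$1)\<^sup>2 = 1" "M$2$1 = 0" "M$1$2 = 0"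
    unfolding vec_eq_iff forall_3 rho_component by (simp_all add: axis_def)
  then have "M$1$1 = 1 \<or> M$1$1 = - 1" "M$1$1 * M$2$2 = 1"
    using assms by (simp_all add: power2_eq_1_iff det_2)
  then show "M = mat 1 \<or> M = - mat 1"
    using e by (auto simp: vec_eq_iff forall_2 mat_def)
next
  assume "M = mat 1 \<or> M = - mat 1"
  then show "rho M = id"
    using rho_one rho_uminus by (auto simp: fun_eq_iff)
qed

definition adjugate :: "real^2^2 \<Rightarrow> real^2^2" where
  "adjugate M = vector [vector [M$2$2, - M$1$2], vector [- M$2$1, M$1$1]]"

lemma adjugate_component [simp]:
  "adjugate M $1$1 = M$2$2" "adjugate M $1$2 = - M$1$2"
  "adjugate M $2$1 = - M$2$1" "adjugate M $2$2 = M$1$1"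
  by (simp_all add: adjugate_def)

lemma inv_SL2: "M \<in> carrier SL2 \<Longrightarrow> inv\<^bsub>SL2\<^esub> M = adjugate M"
proof (rule group.inv_equality[OF group_SL2])
  assume M: "M \<in> carrier SL2"
  then show "adjugate M \<in> carrier SL2"
    by (simp add: SL2_def det_2 mult.commute)
  have "adjugate M ** M = mat 1"
    using M unfolding vec_eq_iff forall_2 matrix_mult_component_2
    by (simp add: SL2_def det_2 mat_def algebra_simps)
  then show "adjugate M \<otimes>\<^bsub>SL2\<^esub> M = \<one>\<^bsub>SL2\<^esub>"
    by (simp add: SL2_def)
qed

text \<open>The fixed vector of a matrix and of everything that commutes with it: it represents the
  quadratic equation for the fixed points of the Moebius transformation.\<close>

definition axis_of :: "real^2^2 \<Rightarrow> real^3" where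
  "axis_of M = vector [- 2 * M$1$2, M$1$1 - M$2$2, 2 * M$2$1]"

text \<open>All powers of \<open>M\<close> lie in the algebra spanned by \<open>M\<close> and the identity (Cayley-Hamilton), which makes
  their common axis and the loop identity a matter of polynomial identities in \<open>p\<close> and \<open>q\<close>.\<close>

definition pencil :: "real^2^2 \<Rightarrow> real \<Rightarrow> real \<Rightarrow> real^2^2" where
  "pencil M p q = p *\<^sub>R M + q *\<^sub>R mat 1"

lemma pencil_component [simp]:
  "pencil M p q $1$1 = p * M$1$1 + q" "pencil M p q $1$2 = p * M$1$2"
  "pencil M p q $2$1 = p * M$2$1" "pencil M p q $2$2 = p * M$2$2 + q"
  by (simp_all add: pencil_def mat_def)

lemma rho_axis: "rho (pencil M p q) (axis_of M) = det (pencil M p q) *\<^sub>R axis_of M"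
  unfolding vec_eq_iff forall_3 rho_component vector_scaleR_component axis_of_def det_2
    pencil_component
  by (simp add: algebra_simps power2_eq_square)

lemma rho_loop_identity:
  "rho (pencil M p q) x + rho (adjugate (pencil M p q)) x
    = (((pencil M p q)$1$1 + (pencil M p q)$2$2)\<^sup>2 - 2 * det (pencil M p q)) *\<^sub>R x
      + (p\<^sup>2 / 2 * bform (axis_of M) x) *\<^sub>R axis_of M"
  unfolding vec_eq_iff forall_3 vector_add_component vector_scaleR_component rho_component
    adjugate_component pencil_component bform_def axis_of_def det_2
  by (simp add: algebra_simps power2_eq_square)

text \<open>\<open>M S M\<^sup>T = S\<close> says that \<open>M\<close> commutes with \<open>S J\<close>, where \<open>J\<close> is the rotation by a right angle.\<close>

lemma rho_fixed_vector:
  assumes det: "det (pencil M p q) = 1" and p: "p \<noteq> 0" and fixed: "rho (pencil M p q) x = x"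
  shows "cross3 x (axis_of M) = 0"
proof -
  define a b c d where "a = (pencil M p q)$1$1" "b = (pencil M p q)$1$2"
    "c = (pencil M p q)$2$1" "d = (pencil M p q)$2$2"
  note abcd = this
  have D: "a * d - b * c = 1"
    using det by (simp only: det_2 abcd)
  have f: "a\<^sup>2 * x$1 + 2 * a * b * x$2 + b\<^sup>2 * x$3 = x$1"
    "a * c * x$1 + (a * d + b * c) * x$2 + b * d * x$3 = x$2"
    "c\<^sup>2 * x$1 + 2 * c * d * x$2 + d\<^sup>2 * x$3 = x$3"
    using fixed unfolding vec_eq_iff forall_3 rho_component abcd by simp_all
  have "(a\<^sup>2 * x$1 + 2 * a * b * x$2 + b\<^sup>2 * x$3) * d
      - (a * c * x$1 + (a * d + b * c) * x$2 + b * d * x$3) * b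
      = (a * d - b * c) * (a * x$1 + b * x$2)"
    by (simp add: power2_eq_square algebra_simps)
  then have 1: "(a - d) * x$1 + 2 * b * x$2 = 0"
    unfolding f D by (simp add: algebra_simps)
  have "(a * c * x$1 + (a * d + b * c) * x$2 + b * d * x$3) * a
      - (a\<^sup>2 * x$1 + 2 * a * b * x$2 + b\<^sup>2 * x$3) * c
      = (a * d - b * c) * (a * x$2 + b * x$3)"
    by (simp add: power2_eq_square algebra_simps)
  then have 2: "c * x$1 + b * x$3 = 0"
    unfolding f D by (simp add: algebra_simps)
  have "(c\<^sup>2 * x$1 + 2 * c * d * x$2 + d\<^sup>2 * x$3) * a
      - (a * c * x$1 + (a * d + b * c) * x$2 + b * d * x$3) * c
      = (a * d - b * c) * (c * x$2 + d * x$3)"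
    by (simp add: power2_eq_square algebra_simps)
  then have 3: "2 * c * x$2 + (d - a) * x$3 = 0"
    unfolding f D by (simp add: algebra_simps)
  have e: "a - d = p * (M$1$1 - M$2$2)" "b = p * M$1$2" "c = p * M$2$1"
    by (simp_all add: abcd algebra_simps)
  have "p * ((M$1$1 - M$2$2) * x$1 + 2 * M$1$2 * x$2) = 0"
    using 1 unfolding e by (simp add: algebra_simps)
  moreover have "p * (M$2$1 * x$1 + M$1$2 * x$3) = 0"
    using 2 unfolding e by (simp add: algebra_simps)
  moreover have "p * (2 * M$2$1 * x$2 - (M$1$1 - M$2$2) * x$3) = 0"
  proof -
    have da: "d - a = - (p * (M$1$1 - M$2$2))" using e(1) by simp
    show ?thesis
      using 3 unfolding da e(3) by (simp add: algebra_simps)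
  qed
  ultimately have
    "(M$1$1 - M$2$2) * x$1 + 2 * M$1$2 * x$2 = 0" "M$2$1 * x$1 + M$1$2 * x$3 = 0"
    "2 * M$2$1 * x$2 - (M$1$1 - M$2$2) * x$3 = 0"
    using p by simp_all
  then show ?thesis
    unfolding vec_eq_iff forall_3 cross_components axis_of_def
    by (simp add: algebra_simps)
qed

definition matrix_power :: "real^2^2 \<Rightarrow> int \<Rightarrow> real^2^2" where
  "matrix_power M n = M [^]\<^bsub>SL2\<^esub> n"

lemma pencil_mult:
  assumes "det M = 1"
  shows "pencil M p q ** pencil M r s = pencil M (p * r * (M$1$1 + M$2$2) + p * s + q * r) (q * s - p * r)"
proof -
  have d: "M$1$1 * M$2$2 = 1 + M$1$2 * M$2$1"
    using assms by (simp add: det_2)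
  have "p * r * (M$1$1 * M$2$2) = p * r + p * r * (M$1$2 * M$2$1)"
    unfolding d by (simp add: algebra_simps)
  then show ?thesis
    unfolding vec_eq_iff forall_2 matrix_mult_component_2 pencil_component
    by (simp add: algebra_simps)
qed

lemma adjugate_pencil: "adjugate (pencil M p q) = pencil M (- p) (q + p * (M$1$1 + M$2$2))"
  by (simp add: vec_eq_iff forall_2 algebra_simps)

lemma matrix_power_pencil:
  assumes M: "det M = 1"
  shows "det (matrix_power M n) = 1" "\<exists>p q. matrix_power M n = pencil M p q"
proof -
  interpret SL2: group SL2 by (rule group_SL2)
  have MS: "M \<in> carrier SL2"
    using M by (simp add: SL2_def)
  let ?C = "{N. det N = 1 \<and> (\<exists>p q. N = pencil M p q)}"
  have "subgroup ?C SL2"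
  proof (rule SL2.subgroupI)
    show "?C \<subseteq> carrier SL2" by (auto simp: SL2_def)
    have "M = pencil M 1 0" by (simp add: pencil_def)
    then show "?C \<noteq> {}" using M by blast
    show "inv\<^bsub>SL2\<^esub> N \<in> ?C" if N: "N \<in> ?C" for N
    proof -
      have NS: "N \<in> carrier SL2" using N by (simp add: SL2_def)
      then have "det (adjugate N) = 1"
        using SL2.inv_closed[OF NS] unfolding inv_SL2[OF NS] by (simp add: SL2_def)
      moreover obtain p q where "N = pencil M p q"
        using N by blast
      then have "adjugate N = pencil M (- p) (q + p * (M$1$1 + M$2$2))"
        by (simp only: adjugate_pencil)
      ultimately show ?thesis
        unfolding inv_SL2[OF NS] by blast
    qed
    show "N \<otimes>\<^bsub>SL2\<^esub> N' \<in> ?C" if N: "N \<in> ?C" "N' \<in> ?C" for N N'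
    proof -
      obtain p q r s where "N = pencil M p q" "N' = pencil M r s"
        using N by blast
      then have "N ** N' = pencil M (p * r * (M$1$1 + M$2$2) + p * s + q * r) (q * s - p * r)"
        by (simp only: pencil_mult[OF M])
      moreover have "det (N ** N') = 1"
        using N by (simp add: det_mul)
      moreover have "N \<otimes>\<^bsub>SL2\<^esub> N' = N ** N'"
        by (simp add: SL2_def)
      ultimately show ?thesis
        by (simp only: mem_Collect_eq) blast
    qed
  qed
  moreover have "M \<in> ?C"
  proof -
    have "M = pencil M 1 0" by (simp add: pencil_def)
    then show ?thesis using M by blast
  qed
  ultimately have "matrix_power M n \<in> ?C"
    unfolding matrix_power_def by (rule SL2.subgroup_int_pow_closed)
  then show "det (matrix_power M n) = 1" "\<exists>p q. matrix_power M n = pencil M p q"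
    by auto
qed

lemma axial_action_rho:
  assumes M: "det M = 1" "M \<noteq> mat 1" "M \<noteq> - mat 1"
  obtains \<tau> \<kappa> where "axial_action (\<lambda>n. rho (matrix_power M n)) (axis_of M) \<tau> \<kappa>"
proof -
  interpret SL2: group SL2 by (rule group_SL2)
  have MS: "M \<in> carrier SL2"
    using M by (simp add: SL2_def)
  have det: "det (matrix_power M n) = 1" for n
    by (rule matrix_power_pencil(1)[OF M(1)])
  obtain p q where pq: "\<And>n. matrix_power M n = pencil M (p n) (q n)"
    using matrix_power_pencil(2)[OF M(1)] by metis
  have det': "det (pencil M (p n) (q n)) = 1" for n
    using det[of n] by (simp add: pq)
  have neg: "matrix_power M (- n) = adjugate (matrix_power M n)" for n
    using SL2.int_pow_neg[OF MS, of n] inv_SL2[OF SL2.int_pow_closed[OF MS, of n]]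
    by (simp add: matrix_power_def)
  define \<tau> where "\<tau> n = ((pencil M (p n) (q n))$1$1 + (pencil M (p n) (q n))$2$2)\<^sup>2 - 2" for n
  have p0: "p n \<noteq> 0" if "rho (matrix_power M n) \<noteq> id" for n
  proof
    assume "p n = 0"
    then have m: "matrix_power M n = q n *\<^sub>R mat 1"
      by (simp add: pq pencil_def)
    then have "q n * q n = 1"
      using det[of n] by (simp add: det_2 mat_def)
    then have "q n = 1 \<or> q n = - 1"
      by (simp flip: power2_eq_square add: power2_eq_1_iff)
    then have "matrix_power M n = mat 1 \<or> matrix_power M n = - mat 1"
      using m by auto
    then show False
      using that rho_eq_id_iff[OF det] by blast
  qed
  have "axial_action (\<lambda>n. rho (matrix_power M n)) (axis_of M) \<tau> (\<lambda>n. (p n)\<^sup>2 / 2)"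
  proof (rule axial_action.intro)
    show "linear (rho (matrix_power M n))" for n
      by (rule linear_rho)
    show "rho (matrix_power M (m + n)) x = rho (matrix_power M m) (rho (matrix_power M n) x)" for m n x
    proof -
      have "matrix_power M (m + n) = matrix_power M m ** matrix_power M n"
        using SL2.int_pow_mult[OF MS, of m n] by (simp add: matrix_power_def) (simp add: SL2_def)
      then show ?thesis by (simp add: rho_mult)
    qed
    show "rho (matrix_power M 0) x = x" for x
      by (simp add: matrix_power_def) (simp add: SL2_def rho_one)
    show "triple (rho (matrix_power M n) x) (rho (matrix_power M n) y) (rho (matrix_power M n) w)
        = triple x y w" for n x y w
      by (simp add: rho_det det)
    show "qform (rho (matrix_power M n) x) = qform x" for n x
      by (simp add: qform_rho det)
    show "rho (matrix_power M n) x \<in> cone" if "x \<in> cone" for n x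
      by (rule cone_rho[OF det that])
    show "rho (matrix_power M n) (axis_of M) = axis_of M" for n
      unfolding pq rho_axis det' by simp
    show "axis_of M \<noteq> 0"
    proof
      assume "axis_of M = 0"
      then have "M$1$2 = 0" "M$2$1 = 0" "M$1$1 = M$2$2"
        by (simp_all add: vec_eq_iff forall_3 axis_of_def)
      moreover then have "M$1$1 * M$1$1 = 1"
        using M(1) by (simp add: det_2)
      then have "M$1$1 = 1 \<or> M$1$1 = - 1"
        by (simp flip: power2_eq_square add: power2_eq_1_iff)
      ultimately show False
        using M(2,3) by (auto simp: vec_eq_iff forall_2 mat_def)
    qed
    show "cross3 x (axis_of M) = 0"
      if "rho (matrix_power M n) x = x" "rho (matrix_power M n) \<noteq> id" for n x
      using rho_fixed_vector[OF det' p0[OF that(2)]] that(1) by (simp add: pq)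
    show "rho (matrix_power M n) x + rho (matrix_power M (- n)) x
        = \<tau> n *\<^sub>R x + ((p n)\<^sup>2 / 2 * bform (axis_of M) x) *\<^sub>R axis_of M" for n x
      unfolding neg unfolding pq rho_loop_identity det' \<tau>_def by simp
    show "(p n)\<^sup>2 / 2 \<noteq> 0" if "rho (matrix_power M n) \<noteq> id" for n
      using p0[OF that] by simp
    have "matrix_power M 1 = M"
      using MS by (simp add: matrix_power_def)
    then show "rho (matrix_power M 1) \<noteq> id"
      using rho_eq_id_iff[OF M(1)] M by simp
  qed
  then show ?thesis by (rule that)
qed

lemma hyperboloid_SL2_act:
  assumes M: "det M = 1" and P: "P \<in> upper_half_plane"
  shows "SL2_act M P \<in> upper_half_plane" "hyperboloid (SL2_act M P) = rho M (hyperboloid P)"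
proof -
  define a b c d where "a = M$1$1" "b = M$1$2" "c = M$2$1" "d = M$2$2"
  note abcd = this
  have D: "a * d - b * c = 1"
    using M by (simp add: det_2 abcd)
  define x y where "x = Re P" "y = Im P"
  note xy = this
  have y: "y > 0"
    using P by (simp add: upper_half_plane_def xy)
  define k where "k = (c * x + d)\<^sup>2 + (c * y)\<^sup>2"
  have "c * x + d \<noteq> 0 \<or> c * y \<noteq> 0"
    using D y by (cases "c = 0") auto
  then have k: "k > 0"
    unfolding k_def by (simp add: sum_power2_gt_zero_iff)
  have act: "SL2_act M P = (of_real a * P + of_real b) / (of_real c * P + of_real d)"
    by (simp add: SL2_act_def moebius_def abcd)
  have re: "Re (SL2_act M P) = ((a * x + b) * (c * x + d) + a * y * (c * y)) / k"
    unfolding act Re_divide by (simp add: k_def xy)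
  have "Im (SL2_act M P) = (a * y * (c * x + d) - (a * x + b) * (c * y)) / k"
    unfolding act Im_divide by (simp add: k_def xy)
  also have "a * y * (c * x + d) - (a * x + b) * (c * y) = (a * d - b * c) * y"
    by (simp add: algebra_simps)
  finally have im: "Im (SL2_act M P) = y / k"
    unfolding D by simp
  show "SL2_act M P \<in> upper_half_plane"
    using im y k by (simp add: upper_half_plane_def)
  have 3: "hyperboloid (SL2_act M P) $ 3 = rho M (hyperboloid P) $ 3"
    using y by (simp add: hyperboloid_def im rho_component k_def flip: xy abcd)
      (simp add: field_simps power2_eq_square)
  have 2: "hyperboloid (SL2_act M P) $ 2 = rho M (hyperboloid P) $ 2"
    using y k by (simp add: hyperboloid_def im re rho_component flip: xy abcd)
      (simp add: field_simps power2_eq_square)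
  have "((a * x + b) * (c * x + d) + a * y * (c * y))\<^sup>2 + ((a * d - b * c) * y)\<^sup>2
      = ((a * x + b)\<^sup>2 + (a * y)\<^sup>2) * k"
    by (simp add: k_def power2_eq_square algebra_simps)
  then have abs: "((a * x + b) * (c * x + d) + a * y * (c * y))\<^sup>2 + y\<^sup>2
      = ((a * x + b)\<^sup>2 + (a * y)\<^sup>2) * k"
    unfolding D by simp
  have "hyperboloid (SL2_act M P) $ 1
      = ((((a * x + b) * (c * x + d) + a * y * (c * y))\<^sup>2 + y\<^sup>2) / k\<^sup>2) / (y / k)"
    by (simp add: hyperboloid_def im re power_divide flip: add_divide_distrib)
  also have "\<dots> = ((a * x + b)\<^sup>2 + (a * y)\<^sup>2) / y"
    unfolding abs using k y by (simp add: power2_eq_square)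
  also have "\<dots> = rho M (hyperboloid P) $ 1"
    using y by (simp add: hyperboloid_def rho_component flip: xy abcd)
      (simp add: field_simps power2_eq_square)
  finally show "hyperboloid (SL2_act M P) = rho M (hyperboloid P)"
    unfolding vec_eq_iff forall_3 using 2 3 by simp
qed

definition PSL2_power :: "real^2^2 \<Rightarrow> int \<Rightarrow> (real^2^2) set" where
  "PSL2_power M n = {mat 1, - mat 1} #>\<^bsub>SL2\<^esub> matrix_power M n"

lemma PSL2_power:
  assumes M: "det M = 1"
  shows "PSL2_power M (m + n) = PSL2_power M m \<otimes>\<^bsub>PSL2\<^esub> PSL2_power M n"
    and "PSL2_power M (- n) = inv\<^bsub>PSL2\<^esub> PSL2_power M n"
    and "PSL2_power M 0 = \<one>\<^bsub>PSL2\<^esub>"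
    and "PSL2_power M n = \<one>\<^bsub>PSL2\<^esub> \<longleftrightarrow> rho (matrix_power M n) = id"
    and "PSL2_act (PSL2_power M n) P = SL2_act (matrix_power M n) P"
    and "PSL2_power M n = ({mat 1, - mat 1} #>\<^bsub>SL2\<^esub> M) [^]\<^bsub>PSL2\<^esub> n"
proof -
  interpret SL2: group SL2 by (rule group_SL2)
  interpret PSL2: group PSL2 by (rule group_PSL2)
  have MS: "M \<in> carrier SL2"
    using M by (simp add: SL2_def)
  have pow: "matrix_power M n \<in> carrier SL2" for n
    unfolding matrix_power_def by (rule SL2.int_pow_closed[OF MS])
  have hom: "(\<lambda>A. {mat 1, - mat 1} #>\<^bsub>SL2\<^esub> A) \<in> hom SL2 PSL2"
    unfolding PSL2_def by (rule normal.r_coset_hom_Mod[OF normal_SL2])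
  interpret h: group_hom SL2 PSL2 "\<lambda>A. {mat 1, - mat 1} #>\<^bsub>SL2\<^esub> A"
    using hom by (intro group_hom.intro group_SL2 group_PSL2 group_hom_axioms.intro)
  show power: "PSL2_power M n = ({mat 1, - mat 1} #>\<^bsub>SL2\<^esub> M) [^]\<^bsub>PSL2\<^esub> n" for n
    unfolding PSL2_power_def matrix_power_def by (rule h.hom_int_pow[OF MS])
  have cM: "({mat 1, - mat 1} #>\<^bsub>SL2\<^esub> M) \<in> carrier PSL2"
    by (rule h.hom_closed[OF MS])
  show "PSL2_power M (m + n) = PSL2_power M m \<otimes>\<^bsub>PSL2\<^esub> PSL2_power M n"
    unfolding power by (rule PSL2.int_pow_mult[OF cM])
  show "PSL2_power M (- n) = inv\<^bsub>PSL2\<^esub> PSL2_power M n"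
    unfolding power by (rule PSL2.int_pow_neg[OF cM])
  show "PSL2_power M 0 = \<one>\<^bsub>PSL2\<^esub>"
    unfolding power by simp
  show "PSL2_act (PSL2_power M n) P = SL2_act (matrix_power M n) P"
    unfolding PSL2_power_def by (rule PSL2_act_coset[OF pow])
  have "PSL2_power M n = {matrix_power M n, - matrix_power M n}"
  proof -
    have "mat 1 ** A = A" "(- mat 1) ** A = - A" for A :: "real^2^2"
      by (simp_all add: vec_eq_iff matrix_matrix_mult_def mat_def sum_2 forall_2)
    then show ?thesis
      by (auto simp: PSL2_power_def r_coset_def SL2_def)
  qed
  then have "PSL2_power M n = \<one>\<^bsub>PSL2\<^esub>
      \<longleftrightarrow> matrix_power M n = mat 1 \<or> matrix_power M n = - mat 1"
    by (auto simp: PSL2_def FactGroup_def doubleton_eq_iff)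
  then show "PSL2_power M n = \<one>\<^bsub>PSL2\<^esub> \<longleftrightarrow> rho (matrix_power M n) = id"
    using rho_eq_id_iff[OF matrix_power_pencil(1)[OF M]] by simp
qed

text \<open>A generator of \<open>\<Gamma>\<close> is a coset of two matrices \<open>M\<close> and \<open>- M\<close>; either of them serves, because both act
  in the same way.\<close>

lemma cyclic_PSL2_generator:
  assumes sub: "subgroup \<Gamma> PSL2" and cyclic: "cyclic_group (PSL2_subgroup \<Gamma>)"
    and nontriv: "\<not> trivial_group (PSL2_subgroup \<Gamma>)"
  obtains M where "det M = 1" "M \<noteq> mat 1" "M \<noteq> - mat 1" "\<Gamma> = range (PSL2_power M)"
proof -
  interpret PSL2: group PSL2 by (rule group_PSL2)
  interpret \<Gamma>: group "PSL2_subgroup \<Gamma>"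
    by (rule subgroup.subgroup_is_group[OF sub group_PSL2])
  obtain g where g: "g \<in> \<Gamma>" "\<Gamma> = range (\<lambda>n::int. g [^]\<^bsub>PSL2_subgroup \<Gamma>\<^esub> n)"
    using cyclic \<Gamma>.cyclic_group by auto
  have pow: "g [^]\<^bsub>PSL2_subgroup \<Gamma>\<^esub> n = g [^]\<^bsub>PSL2\<^esub> n" for n :: int
    using PSL2.int_pow_consistent[OF sub g(1), of n] by simp
  have "g \<in> carrier PSL2"
    using g(1) subgroup.subset[OF sub] by blast
  then obtain M where M: "M \<in> carrier SL2" "g = {mat 1, - mat 1} #>\<^bsub>SL2\<^esub> M"
    by (auto simp: PSL2_def FactGroup_def RCOSETS_def)
  have det: "det M = 1"
    using M(1) by (simp add: SL2_def)
  have \<Gamma>: "\<Gamma> = range (PSL2_power M)"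
  proof -
    have "(\<lambda>n. g [^]\<^bsub>PSL2_subgroup \<Gamma>\<^esub> n) = PSL2_power M"
      by (rule ext) (simp only: pow PSL2_power(6)[OF det] M(2)[symmetric])
    then show ?thesis using g(2) by simp
  qed
  have "rho M \<noteq> id"
  proof
    assume "rho M = id"
    have "matrix_power M 1 = M"
      using group.int_pow_1[OF group_SL2 M(1)] by (simp add: matrix_power_def)
    then have "PSL2_power M 1 = \<one>\<^bsub>PSL2\<^esub>"
      using PSL2_power(4)[OF det, of 1] \<open>rho M = id\<close> by simp
    then have "g = \<one>\<^bsub>PSL2\<^esub>"
      using PSL2_power(6)[OF det, of 1] PSL2.int_pow_1[OF \<open>g \<in> carrier PSL2\<close>] M(2) by simp
    then have "\<Gamma> = {\<one>\<^bsub>PSL2\<^esub>}"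
      using g(2) pow by auto
    then show False
      using nontriv \<Gamma>.trivial_group by auto
  qed
  then show ?thesis
    using that[OF det _ _ \<Gamma>] rho_eq_id_iff[OF det] by blast
qed

section \<open>From balanced subgraphs to potentials\<close>

lemma undirected_walk_verts:
  "undirected_walk H u w v \<Longrightarrow> v \<in> verts H"
  by (induction H u w v rule: undirected_walk.induct) (auto split: if_splits)

lemma undirected_walk_append:
  "undirected_walk H u w v \<Longrightarrow> undirected_walk H v w' x \<Longrightarrow> undirected_walk H u (w @ w') x"
  by (induction H u w v rule: undirected_walk.induct) (auto split: if_splits)

definition reverse_walk :: "('e \<times> bool) list \<Rightarrow> ('e \<times> bool) list" where
  "reverse_walk w = map (\<lambda>(e, forwards). (e, \<not> forwards)) (rev w)"

lemma undirected_walk_edge: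
  assumes "wf_digraph H" "e \<in> arcs H"
  shows "undirected_walk H (tail H e) [(e, True)] (head H e)"
    "undirected_walk H (head H e) [(e, False)] (tail H e)"
  using assms by (auto simp: wf_digraph.tail_in_verts wf_digraph.head_in_verts)

lemma undirected_walk_reverse:
  assumes "wf_digraph H"
  shows "undirected_walk H u w v \<Longrightarrow> undirected_walk H v (reverse_walk w) u"
proof (induction w arbitrary: u)
  case Nil
  then show ?case by (auto simp: reverse_walk_def)
next
  case (Cons a w)
  obtain e f where a: "a = (e, f)" by (cases a)
  have rev: "reverse_walk (a # w) = reverse_walk w @ [(e, \<not> f)]"
    by (simp add: reverse_walk_def a)
  show ?case
  proof (cases f)
    case True
    then have e: "e \<in> arcs H" "tail H e = u" "undirected_walk H (head H e) w v"
      using Cons.prems by (simp_all add: a)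
    then show ?thesis
      unfolding rev using undirected_walk_append[OF Cons.IH[OF e(3)]]
        undirected_walk_edge(2)[OF assms e(1)] True by simp
  next
    case False
    then have e: "e \<in> arcs H" "head H e = u" "undirected_walk H (tail H e) w v"
      using Cons.prems by (simp_all add: a)
    then show ?thesis
      unfolding rev using undirected_walk_append[OF Cons.IH[OF e(3)]]
        undirected_walk_edge(1)[OF assms e(1)] False by simp
  qed
qed

lemma connected_iff_undirected_walk:
  assumes wf: "wf_digraph H"
  shows "Digraph_Component.connected H \<longleftrightarrow>
    verts H \<noteq> {} \<and> (\<forall>u\<in>verts H. \<forall>v\<in>verts H. \<exists>w. undirected_walk H u w v)"
proof -
  have step: "(a, b) \<in> (arcs_ends H)\<^sup>s \<longleftrightarrow>
      (\<exists>e\<in>arcs H. tail H e = a \<and> head H e = b \<or> head H e = a \<and> tail H e = b)" for a b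
    by (auto simp: symcl_def arcs_ends_conv)
  have "(u, v) \<in> rtrancl_on (verts H) ((arcs_ends H)\<^sup>s) \<longleftrightarrow> (\<exists>w. undirected_walk H u w v)"
    if u: "u \<in> verts H" for u v
  proof
    assume "(u, v) \<in> rtrancl_on (verts H) ((arcs_ends H)\<^sup>s)"
    then show "\<exists>w. undirected_walk H u w v"
    proof (induction rule: rtrancl_on_induct)
      case base
      then show ?case
        using u by (intro exI[of _ "[]"]) simp
    next
      case (step b c)
      then obtain w where w: "undirected_walk H u w b" by blast
      obtain e where "e \<in> arcs H" "tail H e = b \<and> head H e = c \<or> head H e = b \<and> tail H e = c"
        using step.hyps \<open>\<And>a b. ((a, b) \<in> (arcs_ends H)\<^sup>s) = _ a b\<close> by blast
      then have "undirected_walk H b [(e, True)] c \<or> undirected_walk H b [(e, False)] c"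
        using undirected_walk_edge[OF wf] by blast
      then show ?case
        using undirected_walk_append[OF w] by blast
    qed
  next
    assume "\<exists>w. undirected_walk H u w v"
    then obtain w where "undirected_walk H u w v" by blast
    then show "(u, v) \<in> rtrancl_on (verts H) ((arcs_ends H)\<^sup>s)"
      using u
    proof (induction w arbitrary: u)
      case Nil
      then show ?case by simp
    next
      case (Cons a w)
      obtain e f where a: "a = (e, f)" by (cases a)
      define x where "x = (if f then head H e else tail H e)"
      have e: "e \<in> arcs H" "(u, x) \<in> (arcs_ends H)\<^sup>s" "undirected_walk H x w v"
        using Cons.prems by (auto simp: a x_def step split: if_splits)
      have "x \<in> verts H"
        using wf e(1) by (simp add: x_def wf_digraph.tail_in_verts wf_digraph.head_in_verts)
      then show ?case
        using Cons.IH[OF e(3)] e(2) Cons.prems(2) by (meson converse_rtrancl_on_into_rtrancl_on)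
    qed
  qed
  then show ?thesis
    unfolding connected_conv by blast
qed

text \<open>The gains are exponents of a generator, chosen once for every arc; the exponent is only determined
  modulo the order of the generator.\<close>

locale cyclic_gain_graph =
  axial_action "\<lambda>n. rho (matrix_power M n)" "axis_of M" \<tau> \<kappa> + fin_digraph G
  for M \<tau> \<kappa> and G :: "('v, 'e) pre_digraph" +
  fixes \<psi> :: "'e \<Rightarrow> (real^2^2) set" and gain :: "'e \<Rightarrow> int"
  assumes det_M: "det M = 1"
    and gain: "e \<in> arcs G \<Longrightarrow> \<psi> e = PSL2_power M (gain e)"
    and parallel: "e \<in> arcs G \<Longrightarrow> f \<in> arcs G \<Longrightarrow> tail G e = tail G f \<Longrightarrow> head G e = head G f \<Longrightarrow>
      \<psi> e = \<psi> f \<Longrightarrow> e = f"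
begin

abbreviation act :: "int \<Rightarrow> real^3 \<Rightarrow> real^3" where
  "act n \<equiv> rho (matrix_power M n)"

definition edge :: "'e \<Rightarrow> 'v gain_edge" where
  "edge e = (tail G e, gain e, head G e)"

lemma inj_edge: "inj_on edge (arcs G)"
  by (rule inj_onI) (use parallel gain in \<open>auto simp: edge_def\<close>)

lemma card_edge: "B \<subseteq> arcs G \<Longrightarrow> card (edge ` B) = card B"
  using inj_edge card_image inj_on_subset by blast

lemma ends_edge: "ends (edge e) = {tail G e, head G e}"
  by (simp add: edge_def)

lemma touched_edge_subset:
  assumes "subgraph H G"
  shows "touched (edge ` arcs H) \<subseteq> verts H"
proof -
  have "wf_digraph H" "tail G = tail H" "head G = head H"
    using assms by (auto simp: subgraph_def compatible_def)
  then show ?thesis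
    by (auto simp: touched_def ends_edge wf_digraph.tail_in_verts wf_digraph.head_in_verts)
qed

lemma finite_subgraph:
  assumes "subgraph H G"
  shows "finite (verts H)" "finite (arcs H)"
  using assms finite_subset[OF _ finite_verts] finite_subset[OF _ finite_arcs]
  by (simp_all add: subgraph_def)

fun walk_sum :: "('e \<times> bool) list \<Rightarrow> int" where
  "walk_sum [] = 0"
| "walk_sum ((e, forwards) # w) = (if forwards then gain e else - gain e) + walk_sum w"

lemma walk_sum_append: "walk_sum (w @ w') = walk_sum w + walk_sum w'"
  by (induction w rule: walk_sum.induct) auto

lemma walk_sum_reverse: "walk_sum (reverse_walk w) = - walk_sum w"
  by (induction w rule: walk_sum.induct) (auto simp: reverse_walk_def walk_sum_append)

lemma walk_gain_walk_sum:
  assumes "arcs H \<subseteq> arcs G" "undirected_walk H u w v"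
  shows "walk_gain \<psi> w = PSL2_power M (walk_sum w)"
  using assms(2)
proof (induction w arbitrary: u)
  case Nil
  then show ?case by (simp add: PSL2_power(3)[OF det_M])
next
  case (Cons a w)
  obtain e f where a: "a = (e, f)" by (cases a)
  have e: "e \<in> arcs G" "walk_gain \<psi> w = PSL2_power M (walk_sum w)"
    using Cons assms(1) by (auto simp: a split: if_splits)
  then show ?case
    by (simp add: a gain PSL2_power(1,2)[OF det_M])
qed

lemma walk_gain_trivial_iff:
  assumes "arcs H \<subseteq> arcs G" "undirected_walk H u w v"
  shows "walk_gain \<psi> w = \<one>\<^bsub>PSL2\<^esub> \<longleftrightarrow> act (walk_sum w) = id"
  unfolding walk_gain_walk_sum[OF assms] by (rule PSL2_power(4)[OF det_M])

lemma act_add_cong: "act m = act m' \<Longrightarrow> act n = act n' \<Longrightarrow> act (m + n) = act (m' + n')"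
  by (rule ext) (simp add: A_add)

lemma walk_sum_potential:
  assumes H: "subgraph H G" and pot: "potential (edge ` arcs H) \<theta>" and w: "undirected_walk H u w v"
  shows "act (walk_sum w) = act (\<theta> v - \<theta> u)"
  using w
proof (induction w arbitrary: u)
  case Nil
  then show ?case by simp
next
  case (Cons a w)
  have ht: "tail H = tail G" "head H = head G"
    using H by (auto simp: subgraph_def compatible_def)
  obtain e f where a: "a = (e, f)" by (cases a)
  have e: "e \<in> arcs H"
    using Cons.prems by (simp add: a)
  have ge: "act (gain e) = act (\<theta> (head G e) - \<theta> (tail G e))"
    using e by (intro potentialD[OF pot]) (auto simp: edge_def)
  then have ge': "act (- gain e) = act (\<theta> (tail G e) - \<theta> (head G e))"
    using A_uminus_eq[of "gain e"] by simp
  show ?case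
  proof (cases f)
    case True
    then have "u = tail G e" "act (walk_sum w) = act (\<theta> v - \<theta> (head G e))"
      using Cons by (simp_all add: a ht)
    then show ?thesis
      using act_add_cong[OF ge] True by (simp add: a)
  next
    case False
    then have "u = head G e" "act (walk_sum w) = act (\<theta> v - \<theta> (tail G e))"
      using Cons by (simp_all add: a ht)
    then show ?thesis
      using act_add_cong[OF ge'] False by (simp add: a)
  qed
qed

text \<open>The gains of walks from a base vertex form a potential, since the difference along an arc is the gain
  of a closed walk.\<close>

lemma potential_if_balanced:
  assumes H: "subgraph H G" and bal: "balanced H \<psi>"
  shows "\<exists>\<theta>. potential (edge ` arcs H) \<theta>"
proof -
  have wf: "wf_digraph H" and sub: "arcs H \<subseteq> arcs G" and ht: "tail H = tail G" "head H = head G"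
    using H by (auto simp: subgraph_def compatible_def)
  have conn: "verts H \<noteq> {}" "\<And>u v. u \<in> verts H \<Longrightarrow> v \<in> verts H \<Longrightarrow> \<exists>w. undirected_walk H u w v"
    using bal connected_iff_undirected_walk[OF wf] by (auto simp: balanced_def)
  obtain r where r: "r \<in> verts H"
    using conn(1) by blast
  obtain W where W: "\<And>v. v \<in> verts H \<Longrightarrow> undirected_walk H r (W v) v"
    using conn(2)[OF r] by metis
  have "act (gain e) = act (walk_sum (W (head G e)) - walk_sum (W (tail G e)))"
    if e: "e \<in> arcs H" for e
  proof -
    have t: "tail H e \<in> verts H" and h: "head H e \<in> verts H"
      using wf e by (simp_all add: wf_digraph.tail_in_verts wf_digraph.head_in_verts)
    let ?w = "W (tail H e) @ [(e, True)] @ reverse_walk (W (head H e))"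
    have w: "undirected_walk H r ?w r"
      using undirected_walk_append[OF W[OF t] undirected_walk_append[OF
        undirected_walk_edge(1)[OF wf e] undirected_walk_reverse[OF wf W[OF h]]]] .
    then have "walk_gain \<psi> ?w = \<one>\<^bsub>PSL2\<^esub>"
      using bal by (simp only: balanced_def)
    then have "act (walk_sum ?w) = id"
      using walk_gain_trivial_iff[OF sub w] by simp
    then have "act (gain e - (walk_sum (W (head G e)) - walk_sum (W (tail G e)))) = id"
      by (simp add: walk_sum_append walk_sum_reverse ht algebra_simps)
    then show ?thesis
      using A_eq_A_iff by metis
  qed
  then show ?thesis
    by (intro exI[of _ "\<lambda>v. walk_sum (W v)"]) (auto simp: potential_def edge_def)
qed

lemma gain_sparse_if_sparse:
  assumes "sparse (edge ` arcs G)"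
  shows "gain_sparse_2_3_1 G \<psi>"
  unfolding gain_sparse_2_3_1_def
proof (intro conjI allI impI)
  show "two_sparse 1 G"
    unfolding two_sparse_def
  proof (intro allI impI, elim conjE)
    fix H assume H: "subgraph H G" "arcs H \<noteq> {}"
    have sub: "arcs H \<subseteq> arcs G"
      using H by (simp add: subgraph_def)
    have "card (edge ` arcs H) + 1 \<le> 2 * card (touched (edge ` arcs H))"
      using assms sub H(2) by (intro sparseD) auto
    moreover have "card (touched (edge ` arcs H)) \<le> card (verts H)"
      using touched_edge_subset[OF H(1)] finite_subgraph(1)[OF H(1)] card_mono by blast
    ultimately show "int (card (arcs H)) \<le> 2 * int (card (verts H)) - 1"
      using card_edge[OF sub] by simp
  qed
  fix H assume "subgraph H G \<and> arcs H \<noteq> {} \<and> balanced H \<psi>"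
  then have H: "subgraph H G" "arcs H \<noteq> {}" "balanced H \<psi>" by blast+
  obtain \<theta> where \<theta>: "potential (edge ` arcs H) \<theta>"
    using potential_if_balanced[OF H(1,3)] by blast
  show "two_sparse 3 H"
    unfolding two_sparse_def
  proof (intro allI impI, elim conjE)
    fix H' assume H': "subgraph H' H" "arcs H' \<noteq> {}"
    have HG: "subgraph H' G"
      using H' H(1) by (auto simp: subgraph_def compatible_def)
    have sub: "arcs H' \<subseteq> arcs G"
      using HG by (simp add: subgraph_def)
    have pot: "potential (edge ` arcs H') \<theta>"
      using \<theta> by (rule potential_subset) (use H' in \<open>auto simp: subgraph_def\<close>)
    have "card (edge ` arcs H') + 3 \<le> 2 * card (touched (edge ` arcs H'))"
      using assms sub H'(2) by (intro sparseD_potential[OF _ _ _ pot]) auto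
    moreover have "card (touched (edge ` arcs H')) \<le> card (verts H')"
      using touched_edge_subset[OF HG] finite_subgraph(1)[OF HG] card_mono by blast
    ultimately show "int (card (arcs H')) \<le> 2 * int (card (verts H')) - 3"
      using card_edge[OF sub] by simp
  qed
qed

definition edge_subgraph :: "'v set \<Rightarrow> 'e set \<Rightarrow> ('v, 'e) pre_digraph" where
  "edge_subgraph V B = \<lparr>verts = V, arcs = B, tail = tail G, head = head G\<rparr>"

lemma edge_subgraph_simps [simp]:
  "verts (edge_subgraph V B) = V" "arcs (edge_subgraph V B) = B"
  "tail (edge_subgraph V B) = tail G" "head (edge_subgraph V B) = head G"
  by (simp_all add: edge_subgraph_def)

lemma subgraph_edge_subgraph:
  assumes "B \<subseteq> arcs G" "touched (edge ` B) \<subseteq> V" "V \<subseteq> verts G"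
  shows "subgraph (edge_subgraph V B) G"
proof -
  have "wf_digraph (edge_subgraph V B)"
    using assms(2) by unfold_locales (auto simp: touched_def ends_edge)
  then show ?thesis
    using assms(1,3) wf_digraph_axioms by (auto simp: subgraph_def compatible_def)
qed

lemma touched_edge_verts: "B \<subseteq> arcs G \<Longrightarrow> touched (edge ` B) \<subseteq> verts G"
  by (auto simp: touched_def ends_edge)

text \<open>A set of edges with a potential need not be connected; the bound is proved by splitting off
  connected components.\<close>

lemma card_le_if_potential:
  assumes sparse: "gain_sparse_2_3_1 G \<psi>" and B: "B \<subseteq> arcs G" "B \<noteq> {}"
    and pot: "potential (edge ` B) \<theta>"
  shows "card B + 3 \<le> 2 * card (touched (edge ` B))"
  using B pot
proof (induction "card B" arbitrary: B rule: less_induct)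
  case less
  have finB: "finite B"
    using less.prems finite_subset finite_arcs by blast
  obtain e0 where e0: "e0 \<in> B"
    using less.prems by blast
  define r where "r = tail G e0"
  define V where "V = touched (edge ` B)"
  define H where "H = edge_subgraph V B"
  have HG: "subgraph H G"
    unfolding H_def V_def
    by (rule subgraph_edge_subgraph[OF less.prems(1) subset_refl touched_edge_verts[OF less.prems(1)]])
  then have wfH: "wf_digraph H"
    by (simp add: subgraph_def)
  have finV: "finite V"
    using finB by (simp add: V_def)
  define C where "C = {v. \<exists>w. undirected_walk H r w v}"
  have CV: "C \<subseteq> V"
    using undirected_walk_verts[of H r] by (auto simp: C_def H_def)
  have rC: "r \<in> C"
  proof -
    have "r \<in> verts H"
      using e0 by (force simp: H_def V_def r_def touched_def ends_edge)
    then show ?thesis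
      unfolding C_def by (intro CollectI exI[of _ "[]"]) simp
  qed
  have closed: "tail G e \<in> C \<longleftrightarrow> head G e \<in> C" if "e \<in> B" for e
  proof -
    have e: "e \<in> arcs H" using that by (simp add: H_def)
    note walk = undirected_walk_edge[OF wfH e]
    have ht: "tail H = tail G" "head H = head G"
      by (simp_all add: H_def)
    show ?thesis
    proof
      assume "tail G e \<in> C"
      then obtain w where "undirected_walk H r w (tail H e)"
        unfolding C_def ht by blast
      from undirected_walk_append[OF this walk(1)] show "head G e \<in> C"
        unfolding C_def ht by blast
    next
      assume "head G e \<in> C"
      then obtain w where "undirected_walk H r w (head H e)"
        unfolding C_def ht by blast
      from undirected_walk_append[OF this walk(2)] show "tail G e \<in> C"
        unfolding C_def ht by blast
    qed
  qed
  define B1 where "B1 = {e\<in>B. tail G e \<in> C}"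
  define H1 where "H1 = edge_subgraph C B1"
  have B1: "B1 \<subseteq> B" "e0 \<in> B1"
    using e0 rC by (auto simp: B1_def r_def)
  have C_touched: "touched (edge ` B1) \<subseteq> C"
    using closed by (auto simp: touched_def ends_edge B1_def)
  have H1G: "subgraph H1 G"
    unfolding H1_def using less.prems(1) B1 CV touched_edge_verts[OF less.prems(1)]
    by (intro subgraph_edge_subgraph C_touched) (auto simp: V_def)
  then have wfH1: "wf_digraph H1"
    by (simp add: subgraph_def)
  have stay: "undirected_walk H1 u w v" if "undirected_walk H u w v" "u \<in> C" for u w v
    using that
  proof (induction w arbitrary: u)
    case Nil
    then show ?case by (simp add: H1_def)
  next
    case (Cons a w)
    obtain e f where a: "a = (e, f)" by (cases a)
    have e: "e \<in> B"
      using Cons.prems by (simp add: a H_def)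
    show ?case
      using Cons closed[OF e] e by (cases f) (auto simp: a H_def H1_def B1_def)
  qed
  have "Digraph_Component.connected H1"
    unfolding connected_iff_undirected_walk[OF wfH1]
  proof (intro conjI ballI)
    show "verts H1 \<noteq> {}"
      using rC by (auto simp: H1_def)
    fix u v assume "u \<in> verts H1" "v \<in> verts H1"
    then have "u \<in> C" "v \<in> C"
      by (simp_all add: H1_def)
    then obtain w w' where "undirected_walk H r w u" "undirected_walk H r w' v"
      unfolding C_def by blast
    then have "undirected_walk H1 r w u" "undirected_walk H1 r w' v"
      using stay rC by blast+
    then have "undirected_walk H1 u (reverse_walk w @ w') v"
      using undirected_walk_append[OF undirected_walk_reverse[OF wfH1]] by blast
    then show "\<exists>w. undirected_walk H1 u w v" ..
  qed
  moreover have "walk_gain \<psi> w = \<one>\<^bsub>PSL2\<^esub>" if w: "undirected_walk H1 v w v" for v w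
  proof -
    have "potential (edge ` arcs H1) \<theta>"
      using less.prems(3) by (rule potential_subset) (use B1 in \<open>auto simp: H1_def\<close>)
    from walk_sum_potential[OF H1G this w] have "act (walk_sum w) = act 0"
      by simp
    moreover have "act 0 = id"
      by (rule ext) simp
    ultimately show ?thesis
      using walk_gain_trivial_iff[OF _ w] H1G by (simp add: subgraph_def)
  qed
  ultimately have "balanced H1 \<psi>"
    by (simp add: balanced_def)
  then have "two_sparse 3 H1"
    using sparse H1G B1 by (auto simp: gain_sparse_2_3_1_def H1_def)
  moreover have "subgraph H1 H1"
    using wfH1 by (simp add: subgraph_def compatible_def)
  ultimately have "int (card (arcs H1)) \<le> 2 * int (card (verts H1)) - 3"
    using B1 unfolding two_sparse_def by (metis H1_def edge_subgraph_simps(2) empty_iff)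
  then have card1: "card B1 + 3 \<le> 2 * card C"
    by (simp add: H1_def)
  define B2 where "B2 = B - B1"
  have cardB: "card B = card B1 + card B2"
    using finB B1 by (simp add: B2_def card_Diff_subset finite_subset card_mono)
  show ?case
  proof (cases "B2 = {}")
    case True
    have "card C \<le> card V"
      using CV finV card_mono by blast
    then show ?thesis
      using cardB card1 True by (simp add: V_def)
  next
    case False
    have "card B1 \<noteq> 0"
      using B1(2) finite_subset[OF B1(1) finB] by auto
    then have "card B2 < card B"
      using cardB by simp
    moreover have "B2 \<subseteq> arcs G"
      using less.prems(1) by (auto simp: B2_def)
    moreover have "potential (edge ` B2) \<theta>"
      using less.prems(3) by (rule potential_subset) (auto simp: B2_def)
    ultimately have card2: "card B2 + 3 \<le> 2 * card (touched (edge ` B2))"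
      using less.hyps False by blast
    have disj: "C \<inter> touched (edge ` B2) = {}"
      using closed by (auto simp: touched_def ends_edge B2_def B1_def)
    have "C \<union> touched (edge ` B2) \<subseteq> V"
      using CV by (auto simp: V_def touched_def B2_def)
    then have "card (C \<union> touched (edge ` B2)) \<le> card V"
      using finV card_mono by blast
    moreover have "card (C \<union> touched (edge ` B2)) = card C + card (touched (edge ` B2))"
      using disj finite_subset[OF CV finV] finB by (intro card_Un_disjoint) (auto simp: B2_def)
    ultimately show ?thesis
      using card1 card2 cardB by (simp add: V_def)
  qed
qed

lemma sparse_if_gain_sparse:
  assumes "gain_sparse_2_3_1 G \<psi>"
  shows "sparse (edge ` arcs G)"
  unfolding sparse_def
proof (intro allI impI conjI)
  fix F assume F: "F \<subseteq> edge ` arcs G" "F \<noteq> {}"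
  obtain B where B: "B \<subseteq> arcs G" "F = edge ` B"
    using F(1) by (metis subset_image_iff)
  have B0: "B \<noteq> {}"
    using F B by blast
  have "subgraph (edge_subgraph (touched F) B) G"
    unfolding B(2) by (rule subgraph_edge_subgraph[OF B(1) subset_refl touched_edge_verts[OF B(1)]])
  moreover have "two_sparse 1 G"
    using assms by (simp add: gain_sparse_2_3_1_def)
  ultimately have "int (card B) \<le> 2 * int (card (touched F)) - 1"
    using B0 unfolding two_sparse_def by (metis edge_subgraph_simps(1,2))
  then show "card F + 1 \<le> 2 * card (touched F)"
    using card_edge[OF B(1)] B(2) by simp
  assume "\<exists>\<theta>. potential F \<theta>"
  then show "card F + 3 \<le> 2 * card (touched F)"
    using card_le_if_potential[OF assms B(1) B0] card_edge[OF B(1)] B(2) by auto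
qed

end

section \<open>The orbit rigidity matrix in the linear model\<close>

lemma (in axial_action) prescribable_scaleR:
  assumes "prescribable P E" "\<And>a. s a \<noteq> 0"
  shows "prescribable (\<lambda>a. s a *\<^sub>R P a) E"
  unfolding prescribable_def
proof
  fix b
  obtain X where X: "\<forall>e\<in>E. length_change P e X = b e / (s (fst e) * s (snd (snd e)))"
    using assms(1)[unfolded prescribable_def, rule_format, of "\<lambda>e. b e / (s (fst e) * s (snd (snd e)))"]
    by blast
  have "length_change (\<lambda>a. s a *\<^sub>R P a) e X = s (fst e) * s (snd (snd e)) * length_change P e X" for e
    by (cases e) simp
  then show "\<exists>X. \<forall>e\<in>E. length_change (\<lambda>a. s a *\<^sub>R P a) e X = b e"
    using X assms(2) by (intro exI[of _ X]) simp
qed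

definition independent_rows :: "'i set \<Rightarrow> 'j set \<Rightarrow> ('i \<Rightarrow> 'j \<Rightarrow> real) \<Rightarrow> bool" where
  "independent_rows F J R \<longleftrightarrow> (\<forall>c. (\<forall>j\<in>J. (\<Sum>i\<in>F. c i * R i j) = 0) \<longrightarrow> (\<forall>i\<in>F. c i = 0))"

lemma matrix_rank_le_card:
  assumes "finite I"
  shows "matrix_rank I J R \<le> card I"
    and "matrix_rank I J R = card I \<longleftrightarrow> independent_rows I J R"
proof -
  let ?S = "{card F | F. F \<subseteq> I \<and> independent_rows F J R}"
  have rank: "matrix_rank I J R = Max ?S"
    by (simp add: matrix_rank_def independent_rows_def)
  have fin: "finite ?S"
    using assms by (intro finite_image_set) simp
  have "card {} \<in> ?S"
    by (intro CollectI exI[of _ "{}"]) (simp add: independent_rows_def)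
  then have ne: "?S \<noteq> {}"
    by blast
  have le: "k \<le> card I" if "k \<in> ?S" for k
    using that assms card_mono by blast
  show "matrix_rank I J R \<le> card I"
    unfolding rank using Max_in[OF fin ne] le by blast
  show "matrix_rank I J R = card I \<longleftrightarrow> independent_rows I J R"
  proof
    assume "matrix_rank I J R = card I"
    then have "card I \<in> ?S"
      using Max_in[OF fin ne] by (simp add: rank)
    then obtain F where "F \<subseteq> I" "independent_rows F J R" "card F = card I"
      by auto
    then show "independent_rows I J R"
      using card_subset_eq[OF assms] by blast
  next
    assume "independent_rows I J R"
    then have "card I \<in> ?S" by blast
    then show "matrix_rank I J R = card I"
      unfolding rank using fin le by (intro Max_eqI) auto
  qed
qed

context cyclic_gain_graph
begin

text \<open>Both directions of an edge have the same length factor, because the distance is symmetric and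
  invariant under the group. Moving the second term to the first vertex turns it into the second
  half of the length change.\<close>

lemma orbit_block_sum:
  assumes p: "realisation G p" and e: "e \<in> arcs G"
  obtains k where "k \<noteq> 0" "\<And>X. (\<Sum>v\<in>verts G. orbit_block G \<psi> p e v \<bullet> velocity (p v) (X v))
    = k * length_change (\<lambda>v. hyperboloid (p v)) (edge e) X"
proof -
  define a b n where "a = tail G e" and "b = head G e" and "n = gain e"
  have ab: "a \<in> verts G" "b \<in> verts G"
    using e by (simp_all add: a_def b_def)
  have det: "det (matrix_power M n) = 1" for n
    by (rule matrix_power_pencil(1)[OF det_M])
  have p_in: "p a \<in> upper_half_plane" "p b \<in> upper_half_plane"
    using p ab by (auto simp: realisation_def)
  define Q Q' where "Q = SL2_act (matrix_power M n) (p b)" and "Q' = SL2_act (matrix_power M (- n)) (p a)"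
  have Q: "Q \<in> upper_half_plane" "hyperboloid Q = act n (hyperboloid (p b))"
    unfolding Q_def by (rule hyperboloid_SL2_act[OF det p_in(2)])+
  have Q': "Q' \<in> upper_half_plane" "hyperboloid Q' = act (- n) (hyperboloid (p a))"
    unfolding Q'_def by (rule hyperboloid_SL2_act[OF det p_in(1)])+
  have gain_e: "\<psi> e = PSL2_power M n" "inv\<^bsub>PSL2\<^esub> \<psi> e = PSL2_power M (- n)"
    using gain[OF e] PSL2_power(2)[OF det_M, of n] by (simp_all add: n_def)
  have psi: "PSL2_act (\<psi> e) (p b) = Q"
    unfolding gain_e(1) PSL2_power(5)[OF det_M] Q_def ..
  have psi': "PSL2_act (inv\<^bsub>PSL2\<^esub> \<psi> e) (p a) = Q'"
    unfolding gain_e(2) PSL2_power(5)[OF det_M] Q'_def ..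
  have "2 * cosh_dist (p a) Q = bform (hyperboloid (p a)) (act n (hyperboloid (p b)))"
    using bform_hyperboloid[OF p_in(1) Q(1)] by (simp add: Q(2))
  also have "\<dots> = bform (act (- n) (hyperboloid (p a))) (hyperboloid (p b))"
    by (rule bform_A[of n "act (- n) (hyperboloid (p a))" "hyperboloid (p b)", unfolded A_cancel])
  also have "\<dots> = 2 * cosh_dist (p b) Q'"
    using bform_hyperboloid[OF p_in(2) Q'(1)] by (simp add: Q'(2) bform_commute)
  finally have cosh: "cosh_dist (p b) Q' = cosh_dist (p a) Q" by simp
  define S where "S = sqrt ((cosh_dist (p a) Q)\<^sup>2 - 1)"
  have sum: "(\<Sum>v\<in>verts G. orbit_block G \<psi> p e v \<bullet> velocity (p v) (X v))
      = length_change (\<lambda>v. hyperboloid (p v)) (edge e) X / (2 * S)" for X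
  proof -
    let ?out = "geodesic_direction (p a) Q" and ?in = "geodesic_direction (p b) Q'"
    have "(\<Sum>v\<in>verts G. orbit_block G \<psi> p e v \<bullet> velocity (p v) (X v))
        = (\<Sum>v\<in>verts G. (if v = a then ?out \<bullet> velocity (p a) (X a) else 0)
            + (if v = b then ?in \<bullet> velocity (p b) (X b) else 0))"
    proof (rule sum.cong[OF refl])
      fix v
      have "orbit_block G \<psi> p e v = (if v = a then ?out else 0) + (if v = b then ?in else 0)"
        unfolding orbit_block_def Let_def a_def[symmetric] b_def[symmetric] psi psi' by auto
      then show "orbit_block G \<psi> p e v \<bullet> velocity (p v) (X v)
          = (if v = a then ?out \<bullet> velocity (p a) (X a) else 0)
            + (if v = b then ?in \<bullet> velocity (p b) (X b) else 0)"
        by (simp add: inner_add_left)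
    qed
    also have "\<dots> = ?out \<bullet> velocity (p a) (X a) + ?in \<bullet> velocity (p b) (X b)"
      using ab by (simp add: sum.distrib)
    also have "?out \<bullet> velocity (p a) (X a)
        = triple (X a) (hyperboloid (p a)) (act n (hyperboloid (p b))) / (2 * S)"
      unfolding geodesic_direction_velocity[OF p_in(1) Q(1)] by (simp add: S_def Q(2))
    also have "?in \<bullet> velocity (p b) (X b)
        = triple (X b) (hyperboloid (p b)) (act (- n) (hyperboloid (p a))) / (2 * S)"
      unfolding geodesic_direction_velocity[OF p_in(2) Q'(1)] by (simp add: S_def Q'(2) cosh)
    also have "triple (X b) (hyperboloid (p b)) (act (- n) (hyperboloid (p a)))
        = triple (act n (X b)) (act n (hyperboloid (p b))) (hyperboloid (p a))"
      by (rule triple_A_move'[symmetric])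
    also have "\<dots> = - triple (act n (X b)) (hyperboloid (p a)) (act n (hyperboloid (p b)))"
      by (rule triple_swap')
    finally show ?thesis
      by (simp add: edge_def diff_divide_distrib flip: a_def b_def n_def)
  qed
  show ?thesis
  proof (cases "p a = Q")
    case True
    \<comment> \<open>The row vanishes, and the two directions are zero by convention.\<close>
    have "act n (hyperboloid (p b)) = hyperboloid (p a)"
      using Q(2) True by simp
    then have "length_change (\<lambda>v. hyperboloid (p v)) (edge e) X = 0" for X
      by (simp add: edge_def flip: a_def b_def n_def)
    then show ?thesis
      using that[of 1] sum by simp
  next
    case False
    have "(cosh_dist (p a) Q)\<^sup>2 > 1"
      using cosh_dist_gt_1[OF p_in(1) Q(1) False] by (simp add: power2_eq_square less_1_mult)
    then have "S \<noteq> 0"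
      by (simp add: S_def)
    then show ?thesis
      using that[of "1 / (2 * S)"] sum by simp
  qed
qed

lemma sum_verts_Basis:
  "(\<Sum>j\<in>verts G \<times> Basis. orbit_rigidity_matrix G \<psi> p e j * (case j of (v, b) \<Rightarrow> m v \<bullet> b))
    = (\<Sum>v\<in>verts G. orbit_block G \<psi> p e v \<bullet> m v)"
proof -
  have "(\<Sum>j\<in>verts G \<times> Basis. orbit_rigidity_matrix G \<psi> p e j * (case j of (v, b) \<Rightarrow> m v \<bullet> b))
      = (\<Sum>(v, b)\<in>verts G \<times> Basis. (orbit_block G \<psi> p e v \<bullet> b) * (m v \<bullet> b))"
    by (intro sum.cong refl) (auto simp: orbit_rigidity_matrix_def)
  also have "\<dots> = (\<Sum>v\<in>verts G. \<Sum>b\<in>Basis. (orbit_block G \<psi> p e v \<bullet> b) * (m v \<bullet> b))"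
    by (rule sum.cartesian_product[symmetric])
  also have "\<dots> = (\<Sum>v\<in>verts G. orbit_block G \<psi> p e v \<bullet> m v)"
    by (intro sum.cong refl) (rule euclidean_inner[symmetric])
  finally show ?thesis .
qed

text \<open>Every assignment of velocities comes from a field of vectors \<open>X v\<close>, so a linear relation
  between the rows is the same as a relation between the length changes, up to nonzero factors.\<close>

lemma independent_rows_iff:
  assumes p: "realisation G p"
  shows "independent_rows (arcs G) (verts G \<times> Basis) (orbit_rigidity_matrix G \<psi> p)
    \<longleftrightarrow> independent_at (\<lambda>v. hyperboloid (p v)) (edge ` arcs G)"
proof -
  let ?R = "orbit_rigidity_matrix G \<psi> p" and ?P = "\<lambda>v. hyperboloid (p v)"
  have "\<exists>k. k \<noteq> 0 \<and> (\<forall>X. (\<Sum>v\<in>verts G. orbit_block G \<psi> p e v \<bullet> velocity (p v) (X v))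
      = k * length_change ?P (edge e) X)" if "e \<in> arcs G" for e
    by (rule orbit_block_sum[OF p that]) blast
  then obtain k where k: "\<And>e. e \<in> arcs G \<Longrightarrow> k e \<noteq> 0"
    "\<And>e X. e \<in> arcs G \<Longrightarrow> (\<Sum>v\<in>verts G. orbit_block G \<psi> p e v \<bullet> velocity (p v) (X v))
      = k e * length_change ?P (edge e) X"
    by metis
  have row: "(\<Sum>j\<in>verts G \<times> Basis. ?R e j * (case j of (v, b) \<Rightarrow> velocity (p v) (X v) \<bullet> b))
      = k e * length_change ?P (edge e) X" if "e \<in> arcs G" for e X
    unfolding sum_verts_Basis by (rule k(2)[OF that])
  have relation: "(\<forall>j\<in>verts G \<times> Basis. (\<Sum>e\<in>arcs G. c e * ?R e j) = 0)
      \<longleftrightarrow> (\<forall>X. (\<Sum>e\<in>arcs G. c e * k e * length_change ?P (edge e) X) = 0)" for c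
  proof
    assume zero: "\<forall>j\<in>verts G \<times> Basis. (\<Sum>e\<in>arcs G. c e * ?R e j) = 0"
    show "\<forall>X. (\<Sum>e\<in>arcs G. c e * k e * length_change ?P (edge e) X) = 0"
    proof
      fix X
      let ?m = "\<lambda>j. case j of (v, b) \<Rightarrow> velocity (p v) (X v) \<bullet> b"
      have "(\<Sum>e\<in>arcs G. c e * k e * length_change ?P (edge e) X)
          = (\<Sum>e\<in>arcs G. \<Sum>j\<in>verts G \<times> Basis. c e * (?R e j * ?m j))"
        by (intro sum.cong refl) (simp add: row mult.assoc flip: sum_distrib_left)
      also have "\<dots> = (\<Sum>j\<in>verts G \<times> Basis. (\<Sum>e\<in>arcs G. c e * ?R e j) * ?m j)"
        by (subst sum.swap) (simp add: sum_distrib_right mult.assoc)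
      also have "\<dots> = 0"
        using zero by (intro sum.neutral) auto
      finally show "(\<Sum>e\<in>arcs G. c e * k e * length_change ?P (edge e) X) = 0" .
    qed
  next
    assume zero: "\<forall>X. (\<Sum>e\<in>arcs G. c e * k e * length_change ?P (edge e) X) = 0"
    show "\<forall>j\<in>verts G \<times> Basis. (\<Sum>e\<in>arcs G. c e * ?R e j) = 0"
    proof
      fix j0 assume j0: "j0 \<in> verts G \<times> (Basis :: complex set)"
      obtain v0 b0 where vb: "j0 = (v0, b0)" "v0 \<in> verts G" "b0 \<in> Basis"
        using j0 by blast
      have "\<exists>x. velocity (p v) x = (if v = v0 then b0 else 0)" if "v \<in> verts G" for v
      proof -
        have "p v \<in> upper_half_plane"
          using p that by (auto simp: realisation_def)
        then show ?thesis
          by (rule velocity_surj) blast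
      qed
      then obtain X where X: "\<And>v. v \<in> verts G \<Longrightarrow> velocity (p v) (X v) = (if v = v0 then b0 else 0)"
        by metis
      have "k e * length_change ?P (edge e) X = ?R e j0" if e: "e \<in> arcs G" for e
      proof -
        have "k e * length_change ?P (edge e) X
            = (\<Sum>v\<in>verts G. orbit_block G \<psi> p e v \<bullet> velocity (p v) (X v))"
          using k(2)[OF e] by simp
        also have "\<dots> = (\<Sum>v\<in>verts G. if v = v0 then orbit_block G \<psi> p e v0 \<bullet> b0 else 0)"
          by (intro sum.cong refl) (simp add: X)
        also have "\<dots> = ?R e j0"
          using vb by (simp add: orbit_rigidity_matrix_def)
        finally show ?thesis .
      qed
      then have "(\<Sum>e\<in>arcs G. c e * ?R e j0)
          = (\<Sum>e\<in>arcs G. c e * k e * length_change ?P (edge e) X)"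
        by (intro sum.cong refl) (simp add: mult.assoc)
      then show "(\<Sum>e\<in>arcs G. c e * ?R e j0) = 0"
        using zero by simp
    qed
  qed
  have reindex: "(\<Sum>f\<in>edge ` arcs G. d f * length_change ?P f X)
      = (\<Sum>e\<in>arcs G. d (edge e) * length_change ?P (edge e) X)" for d X
    by (simp add: sum.reindex[OF inj_edge])
  show ?thesis
  proof
    assume ind: "independent_rows (arcs G) (verts G \<times> Basis) ?R"
    show "independent_at ?P (edge ` arcs G)"
      unfolding independent_at_def reindex
    proof (intro allI impI)
      fix d assume zero: "\<forall>X. (\<Sum>e\<in>arcs G. d (edge e) * length_change ?P (edge e) X) = 0"
      define c where "c e = d (edge e) / k e" for e
      have "(\<Sum>e\<in>arcs G. c e * k e * length_change ?P (edge e) X)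
          = (\<Sum>e\<in>arcs G. d (edge e) * length_change ?P (edge e) X)" for X
        by (intro sum.cong refl) (simp add: c_def k(1))
      then have "\<forall>e\<in>arcs G. c e = 0"
        using ind relation[of c] zero unfolding independent_rows_def by simp
      then show "\<forall>f\<in>edge ` arcs G. d f = 0"
        using k(1) by (auto simp: c_def)
    qed
  next
    assume ind: "independent_at ?P (edge ` arcs G)"
    show "independent_rows (arcs G) (verts G \<times> Basis) ?R"
      unfolding independent_rows_def relation
    proof (intro allI impI)
      fix c assume zero: "\<forall>X. (\<Sum>e\<in>arcs G. c e * k e * length_change ?P (edge e) X) = 0"
      define d where "d f = c (the_inv_into (arcs G) edge f) * k (the_inv_into (arcs G) edge f)" for f
      have d: "d (edge e) = c e * k e" if "e \<in> arcs G" for e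
        using the_inv_into_f_f[OF inj_edge that] by (simp add: d_def)
      have "(\<Sum>e\<in>arcs G. d (edge e) * length_change ?P (edge e) X)
          = (\<Sum>e\<in>arcs G. c e * k e * length_change ?P (edge e) X)" for X
        by (intro sum.cong refl) (simp add: d)
      then have "\<forall>f\<in>edge ` arcs G. d f = 0"
        using ind zero unfolding independent_at_def reindex by simp
      then show "\<forall>e\<in>arcs G. c e = 0"
        using d k(1) by fastforce
    qed
  qed
qed

lemma independent_framework_iff:
  assumes "realisation G p"
  shows "independent_framework G \<psi> p \<longleftrightarrow> prescribable (\<lambda>v. hyperboloid (p v)) (edge ` arcs G)"
  unfolding independent_framework_def orbit_rank_def matrix_rank_le_card(2)[OF finite_arcs]
    independent_rows_iff[OF assms]
  using prescribable_iff_independent_at[of "edge ` arcs G"] by simp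

text \<open>Positions in the cone are projected radially to the hyperboloid, which rescales the length changes.\<close>

theorem symmetrically_independent_iff_gain_sparse:
  "symmetrically_independent G \<psi> \<longleftrightarrow> gain_sparse_2_3_1 G \<psi>"
proof
  assume "symmetrically_independent G \<psi>"
  then obtain p where p: "realisation G p" "prescribable (\<lambda>v. hyperboloid (p v)) (edge ` arcs G)"
    using independent_framework_iff by (auto simp: symmetrically_independent_def)
  define P where "P v = (if v \<in> verts G then hyperboloid (p v) else axis_of M)" for v
  have "prescribable P (edge ` arcs G)"
    by (rule prescribable_cong[THEN iffD1, OF _ p(2)])
      (use touched_edge_verts[OF subset_refl] in \<open>auto simp: P_def\<close>)
  moreover have "P v \<noteq> 0" for v
    using p(1) hyperboloid_in_cone(2)[of "p v"] cone_nz axis_nz by (auto simp: P_def realisation_def)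
  ultimately have "sparse (edge ` arcs G)"
    by (intro sparse_if_prescribable) auto
  then show "gain_sparse_2_3_1 G \<psi>"
    by (rule gain_sparse_if_sparse)
next
  assume "gain_sparse_2_3_1 G \<psi>"
  then have "sparse (edge ` arcs G)"
    by (rule sparse_if_gain_sparse)
  then obtain P where P: "\<And>v. good (P v)" "prescribable P (edge ` arcs G)"
    using prescribable_if_sparse[of "edge ` arcs G"] by auto
  have "\<exists>Q s. Q \<in> upper_half_plane \<and> s > 0 \<and> P v = s *\<^sub>R hyperboloid Q" for v
  proof -
    have "P v \<in> cone"
      using P(1)[of v] by (simp add: good_def)
    then show ?thesis
      by (rule cone_hyperboloid) blast
  qed
  then obtain p s where ps: "\<And>v. p v \<in> upper_half_plane" "\<And>v. s v > 0"
    "\<And>v. P v = s v *\<^sub>R hyperboloid (p v)"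
    by metis
  have "s v \<noteq> 0" for v
    using ps(2)[of v] by simp
  then have hyperboloid: "(1 / s v) *\<^sub>R P v = hyperboloid (p v)" for v
    by (simp add: ps(3))
  have "prescribable (\<lambda>v. (1 / s v) *\<^sub>R P v) (edge ` arcs G)"
    by (rule prescribable_scaleR[OF P(2)]) (use \<open>\<And>v. s v \<noteq> 0\<close> in simp)
  then have "prescribable (\<lambda>v. hyperboloid (p v)) (edge ` arcs G)"
    by (simp only: hyperboloid)
  moreover have "realisation G p"
    using ps(1) by (simp add: realisation_def)
  ultimately show "symmetrically_independent G \<psi>"
    using independent_framework_iff by (auto simp: symmetrically_independent_def)
qed

end

theorem theorem5p3:
  fixes \<Gamma> :: "(real^2^2) set set"
    and G :: "('v, 'e) pre_digraph"
    and \<psi> :: "'e \<Rightarrow> (real^2^2) set"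
  assumes "fuchsian_group \<Gamma>"
    and "cyclic_group (PSL2_subgroup \<Gamma>)"
    and "\<not> trivial_group (PSL2_subgroup \<Gamma>)"
    and "gain_graph \<Gamma> G \<psi>"
  shows "symmetrically_isostatic \<Gamma> G \<psi> \<longleftrightarrow> gain_tight_2_3_1 G \<psi>"
proof -
  have fin: "fin_digraph G" and ne: "verts G \<noteq> {}" and \<psi>: "\<psi> \<in> arcs G \<rightarrow> \<Gamma>"
    and parallel: "\<forall>e\<in>arcs G. \<forall>f\<in>arcs G. e \<noteq> f \<and> tail G e = tail G f \<and> head G e = head G f
        \<longrightarrow> \<psi> e \<noteq> \<psi> f"
    using assms(4)[unfolded gain_graph_def] by - (elim conjE, assumption)+
  have sub: "subgroup \<Gamma> PSL2"
    using assms(1) by (simp add: fuchsian_group_def)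
  obtain M where M: "det M = 1" "M \<noteq> mat 1" "M \<noteq> - mat 1" "\<Gamma> = range (PSL2_power M)"
    by (rule cyclic_PSL2_generator[OF sub assms(2,3)])
  have "\<exists>n. \<psi> e = PSL2_power M n" if "e \<in> arcs G" for e
    using \<psi> that M(4) by blast
  then obtain gain where gain: "\<And>e. e \<in> arcs G \<Longrightarrow> \<psi> e = PSL2_power M (gain e)"
    by metis
  obtain \<tau> \<kappa> where action: "axial_action (\<lambda>n. rho (matrix_power M n)) (axis_of M) \<tau> \<kappa>"
    using axial_action_rho[OF M(1-3)] .
  interpret cyclic_gain_graph M \<tau> \<kappa> G \<psi> gain
  proof (intro cyclic_gain_graph.intro cyclic_gain_graph_axioms.intro)
    show "axial_action (\<lambda>n. rho (matrix_power M n)) (axis_of M) \<tau> \<kappa>" "fin_digraph G" "det M = 1"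
      by (fact action fin M(1))+
    show "\<psi> e = PSL2_power M (gain e)" if "e \<in> arcs G" for e
      by (rule gain[OF that])
    show "e = f" if "e \<in> arcs G" "f \<in> arcs G" "tail G e = tail G f" "head G e = head G f"
      "\<psi> e = \<psi> f" for e f
      using parallel[rule_format, of e f] that by blast
  qed
  have card_verts: "card (verts G) > 0"
    using ne by (simp add: card_gt_0_iff)
  have rigid: "rigid_framework \<Gamma> G \<psi> p \<longleftrightarrow> int (orbit_rank G \<psi> p) = 2 * int (card (verts G)) - 1" for p
    using assms(2,3) by (simp add: rigid_framework_def)
  have rank_le: "orbit_rank G \<psi> p \<le> card (arcs G)" for p
    unfolding orbit_rank_def by (rule matrix_rank_le_card(1)[OF finite_arcs])
  show ?thesis
  proof
    assume iso: "symmetrically_isostatic \<Gamma> G \<psi>"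
    then have sparse: "gain_sparse_2_3_1 G \<psi>"
      using symmetrically_independent_iff_gain_sparse by (simp add: symmetrically_isostatic_def)
    obtain p where "int (orbit_rank G \<psi> p) = 2 * int (card (verts G)) - 1"
      using iso rigid by (auto simp: symmetrically_isostatic_def symmetrically_rigid_def)
    then have ge: "int (card (arcs G)) \<ge> 2 * int (card (verts G)) - 1"
      using rank_le[of p] by linarith
    then have "arcs G \<noteq> {}"
      using card_verts by auto
    moreover have "subgraph G G"
      using wf_digraph_axioms by (simp add: subgraph_def compatible_def)
    moreover have "two_sparse 1 G"
      using sparse by (simp add: gain_sparse_2_3_1_def)
    ultimately have "int (card (arcs G)) \<le> 2 * int (card (verts G)) - 1"
      unfolding two_sparse_def by blast
    then show "gain_tight_2_3_1 G \<psi>"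
      using sparse ge by (simp add: gain_tight_2_3_1_def)
  next
    assume tight: "gain_tight_2_3_1 G \<psi>"
    then have ind: "symmetrically_independent G \<psi>"
      using symmetrically_independent_iff_gain_sparse by (simp add: gain_tight_2_3_1_def)
    then obtain p where "realisation G p" "orbit_rank G \<psi> p = card (arcs G)"
      by (auto simp: symmetrically_independent_def independent_framework_def)
    then have "symmetrically_rigid \<Gamma> G \<psi>"
      using tight rigid by (auto simp: symmetrically_rigid_def gain_tight_2_3_1_def)
    then show "symmetrically_isostatic \<Gamma> G \<psi>"
      using ind by (simp add: symmetrically_isostatic_def)
  qed
qed

end
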